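(* For complete bipartite graphs the following hold: (1) $\ell(K_{n,n})=h\ell(K_{n,n})=n$ for $n\ge3$; (2) $\ell(K_{m,n})=m$ for $m>n>2$; (3) $\ell(K_{m,2})=1$ for any $m$.
   Context: All graphs are connected, undirected, simple and finite. $K_{m,n}$ denotes the complete bipartite graph with parts of sizes $m$ and $n$. A graph is Hamiltonian if it contains a cycle that visits every vertex exactly once. A graph embedding is an embedding $G\to S^3$ of a graph $G$, up to ambient isotopy; the spatial graph $\mathcal{G}$ is its image up to ambient isotopy. A cycle is unknotted if it can be embedded as the equator of a sphere $S^2$. The fragments of a graph $G$ with respect to a cycle $C$ are the closures of the connected components of $G-C$ (so an edge not in $C$ with both endpoints on $C$ is a fragment). A diagram of $\mathcal{G}$ is the image of a projection of $\mathcal{G}$ to $\mathbb{R}^2$ such that all intersections are transversal, no vertices and at most two points are mapped to a crossing, and each double point is assigned as an over- or under-crossing. It is reduced if no Reidemeister moves of type 1 and 2 can be applied to reduce its number of crossings. $\mathcal{G}$ is semi-leveled if there is an unknotted cycle $C$ (the spine) and a diagram $D$ of $\mathcal{G}$ (a semi-leveled diagram) in which no fragment with respect to $C$ has self-crossings, crossings with $C$, or both over- and under-crossings with another fragment. A reduced semi-leveled diagram in which every fragment lies in the bounded connected component of $\mathbb{R}^2\setminus C$ is divided in levels if there is a partition $\{L_1,\dots,L_n\}$ of all the fragments such that $L_1$ is the set of fragments that do not cross over any other fragment, and for $i>1$ the set $L_i$ consists of the fragments that cross over at least one fragment in $L_{i-1}$ and only cross over fragments in sets $L_k$ with $k<i$;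 then $n$ is the number of levels. A connected spatial graph is leveled (with spine $C$) if it has a semi-leveled diagram (with spine $C$) that is divided in levels; it is Hamiltonian leveled if the spine is a Hamiltonian cycle of the underlying graph. The level number $\ell(\mathcal{G})$ of a spatial graph is the minimum number of levels of $\mathcal{G}$ ranging over all possible spines, with $\ell(\mathcal{G})=\infty$ if $\mathcal{G}$ does not admit a leveled embedding; the level number $\ell(G)$ of an abstract graph $G$ is the minimum of $\ell(\mathcal{G})$ over all embeddings $\mathcal{G}$ of $G$. The Hamiltonian level number $h\ell(\mathcal{G})$ of a Hamiltonian spatial graph is the minimum number of levels ranging over all choices of Hamiltonian spines for a Hamiltonian leveled embedding of $\mathcal{G}$; $h\ell(G)$ of an abstract Hamiltonian graph $G$ is the minimum Hamiltonian level number of all its embeddings.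
   Formalization: Part (3) is stated for m ≥ 2 rather than for any m: K_{1,2} is a path without a cycle, so it has no spine and its level number is infinite, and K_{0,2} is not connected. *)

theory Defs
  imports "HOL-Analysis.Analysis"
begin

section \<open>Finite simple graphs\<close>

text \<open>Undirected edges are two-element sets of vertices.\<close>

record 'a graph =
  verts :: "'a set"
  edges :: "'a set set"

definition complete_bipartite :: "nat \<Rightarrow> nat \<Rightarrow> (nat + nat) graph" where
  "complete_bipartite m n =
     \<lparr>verts = {..<m} <+> {..<n},
      edges = {{Inl i, Inr j} | i j. i < m \<and> j < n}\<rparr>"

text \<open>The cycle through the listed vertices in cyclic order.\<close>

definition cycle_graph :: "'a list \<Rightarrow> 'a graph" where
  "cycle_graph vs =
     \<lparr>verts = set vs,
      edges = {{vs ! i, vs ! (Suc i mod length vs)} | i. i < length vs}\<rparr>"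

definition is_cycle :: "'a graph \<Rightarrow> 'a graph \<Rightarrow> bool" where
  "is_cycle G C \<longleftrightarrow>
     (\<exists>vs. distinct vs \<and> 3 \<le> length vs \<and> C = cycle_graph vs) \<and>
     verts C \<subseteq> verts G \<and> edges C \<subseteq> edges G"

definition is_hamiltonian_cycle :: "'a graph \<Rightarrow> 'a graph \<Rightarrow> bool" where
  "is_hamiltonian_cycle G C \<longleftrightarrow> is_cycle G C \<and> verts C = verts G"


section \<open>Graphs as topological spaces\<close>

text \<open>A point of the geometric realization is given by its barycentric coordinates, a
  nonnegative weight function of total weight 1 supported on a single vertex or on an
  edge.  The topology is that of the function type.  The realization of a subgraph is a
  subset of the realization of the graph.\<close>

definition weight_support :: "('a \<Rightarrow> real) \<Rightarrow> 'a set" where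
  "weight_support x = {v. x v \<noteq> 0}"

definition vertex_points :: "'a graph \<Rightarrow> ('a \<Rightarrow> real) set" where
  "vertex_points G = {\<lambda>w. if w = v then 1 else 0 | v. v \<in> verts G}"

definition edge_points :: "'a graph \<Rightarrow> ('a \<Rightarrow> real) set" where
  "edge_points G =
     {x. (\<forall>v. 0 \<le> x v) \<and> weight_support x \<in> edges G \<and> sum x (weight_support x) = 1}"

definition realization :: "'a graph \<Rightarrow> ('a \<Rightarrow> real) set" where
  "realization G = vertex_points G \<union> edge_points G"

definition fragments :: "'a graph \<Rightarrow> 'a graph \<Rightarrow> ('a \<Rightarrow> real) set set" where
  "fragments G C = closure ` components (realization G - realization C)"


section \<open>Embeddings in the 3-sphere up to ambient isotopy\<close>

text \<open>The plane is the type complex and 3-space is its product with the real line, so that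
  projecting to the plane is \<^const>\<open>fst\<close> and the height is \<^const>\<open>snd\<close>.\<close>

type_synonym space3 = "complex \<times> real"

abbreviation S3 :: "(space3 \<times> real) set" where
  "S3 \<equiv> sphere 0 1"

definition ambient_isotopy :: "(real \<Rightarrow> space3 \<times> real \<Rightarrow> space3 \<times> real) \<Rightarrow> bool" where
  "ambient_isotopy H \<longleftrightarrow>
     continuous_on ({0..1} \<times> S3) (\<lambda>(t, x). H t x) \<and>
     (\<forall>t\<in>{0..1}. \<exists>k. homeomorphism S3 S3 (H t) k) \<and>
     (\<forall>x\<in>S3. H 0 x = x)"

definition graph_embedding :: "'a graph \<Rightarrow> (('a \<Rightarrow> real) \<Rightarrow> space3 \<times> real) \<Rightarrow> bool" where
  "graph_embedding G f \<longleftrightarrow>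
     f ` realization G \<subseteq> S3 \<and> (\<exists>k. homeomorphism (realization G) (f ` realization G) f k)"

definition isotopic_embeddings ::
    "'a graph \<Rightarrow> (('a \<Rightarrow> real) \<Rightarrow> space3 \<times> real) \<Rightarrow> (('a \<Rightarrow> real) \<Rightarrow> space3 \<times> real) \<Rightarrow> bool" where
  "isotopic_embeddings G f g \<longleftrightarrow>
     (\<exists>H. ambient_isotopy H \<and> (\<forall>x\<in>realization G. H 1 (f x) = g x))"

text \<open>The equator of the 2-sphere in which the 3-sphere meets the hyperplane where the last
  coordinate vanishes.\<close>

definition equator :: "(space3 \<times> real) set" where
  "equator = {((z, 0), 0) | z. cmod z = 1}"

definition unknotted :: "(space3 \<times> real) set \<Rightarrow> bool" where
  "unknotted K \<longleftrightarrow> (\<exists>H. ambient_isotopy H \<and> H 1 ` K = equator)"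


section \<open>Diagrams\<close>

text \<open>Stereographic projection from the pole \<open>(0, 1)\<close>.\<close>

definition stereographic :: "space3 \<times> real \<Rightarrow> space3" where
  "stereographic = (\<lambda>(p, t). p /\<^sub>R (1 - t))"

text \<open>Throughout, \<open>F\<close> maps the realization of \<open>G\<close> into 3-space.  Edges are only
  continuous curves, so a transversal intersection is one at which the two strands look, in
  suitable local coordinates of the plane, like the two coordinate axes.\<close>

definition transversal_at ::
    "'a graph \<Rightarrow> (('a \<Rightarrow> real) \<Rightarrow> space3) \<Rightarrow> ('a \<Rightarrow> real) \<Rightarrow> ('a \<Rightarrow> real) \<Rightarrow> bool" where
  "transversal_at G F x y \<longleftrightarrow>
     (\<exists>A B U h k.
        openin (top_of_set (realization G)) A \<and> x \<in> A \<and>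
        openin (top_of_set (realization G)) B \<and> y \<in> B \<and>
        open U \<and> (fst \<circ> F) ` (A \<union> B) \<subseteq> U \<and>
        homeomorphism U (ball (0::complex) 1) h k \<and>
        h ` (fst \<circ> F) ` A = {z \<in> ball 0 1. Im z = 0} \<and>
        h ` (fst \<circ> F) ` B = {z \<in> ball 0 1. Re z = 0})"

definition double_pair ::
    "'a graph \<Rightarrow> (('a \<Rightarrow> real) \<Rightarrow> space3) \<Rightarrow> ('a \<Rightarrow> real) \<Rightarrow> ('a \<Rightarrow> real) \<Rightarrow> bool" where
  "double_pair G F x y \<longleftrightarrow>
     x \<in> realization G \<and> y \<in> realization G \<and> x \<noteq> y \<and> fst (F x) = fst (F y)"

definition is_diagram :: "'a graph \<Rightarrow> (('a \<Rightarrow> real) \<Rightarrow> space3) \<Rightarrow> bool" where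
  "is_diagram G F \<longleftrightarrow>
     finite {(x, y). double_pair G F x y} \<and>
     (\<forall>x y. double_pair G F x y \<longrightarrow>
        x \<notin> vertex_points G \<and> y \<notin> vertex_points G \<and> transversal_at G F x y \<and>
        (\<forall>z\<in>realization G. fst (F z) = fst (F x) \<longrightarrow> z = x \<or> z = y))"

definition crosses_over ::
    "(('a \<Rightarrow> real) \<Rightarrow> space3) \<Rightarrow> ('a \<Rightarrow> real) set \<Rightarrow> ('a \<Rightarrow> real) set \<Rightarrow> bool" where
  "crosses_over F A B \<longleftrightarrow>
     (\<exists>x\<in>A. \<exists>y\<in>B. fst (F x) = fst (F y) \<and> snd (F x) > snd (F y))"

text \<open>A Reidemeister move of type 1 removes a crossing when a strand forms a loop bounding an
  otherwise empty disc.\<close>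

definition R1_reducible :: "'a graph \<Rightarrow> (('a \<Rightarrow> real) \<Rightarrow> space3) \<Rightarrow> bool" where
  "R1_reducible G F \<longleftrightarrow>
     (\<exists>c. arc c \<and> path_image c \<subseteq> realization G - vertex_points G \<and>
        simple_path (fst \<circ> F \<circ> c) \<and>
        pathfinish (fst \<circ> F \<circ> c) = pathstart (fst \<circ> F \<circ> c) \<and>
        inside (path_image (fst \<circ> F \<circ> c)) \<inter> (fst \<circ> F) ` realization G = {})"

text \<open>A Reidemeister move of type 2 removes two crossings when two strands, one of which lies
  above the other at both crossings, bound an otherwise empty disc.\<close>

definition R2_reducible :: "'a graph \<Rightarrow> (('a \<Rightarrow> real) \<Rightarrow> space3) \<Rightarrow> bool" where
  "R2_reducible G F \<longleftrightarrow>
     (\<exists>c d. arc c \<and> path_image c \<subseteq> realization G - vertex_points G \<and>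
        arc d \<and> path_image d \<subseteq> realization G - vertex_points G \<and>
        arc (fst \<circ> F \<circ> c) \<and> arc (fst \<circ> F \<circ> d) \<and>
        pathstart (fst \<circ> F \<circ> c) = pathstart (fst \<circ> F \<circ> d) \<and>
        pathfinish (fst \<circ> F \<circ> c) = pathfinish (fst \<circ> F \<circ> d) \<and>
        path_image (fst \<circ> F \<circ> c) \<inter> path_image (fst \<circ> F \<circ> d) =
          {pathstart (fst \<circ> F \<circ> c), pathfinish (fst \<circ> F \<circ> c)} \<and>
        snd (F (pathstart c)) > snd (F (pathstart d)) \<and>
        snd (F (pathfinish c)) > snd (F (pathfinish d)) \<and>
        inside (path_image (fst \<circ> F \<circ> c) \<union> path_image (fst \<circ> F \<circ> d))
          \<inter> (fst \<circ> F) ` realization G = {})"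

definition reduced_diagram :: "'a graph \<Rightarrow> (('a \<Rightarrow> real) \<Rightarrow> space3) \<Rightarrow> bool" where
  "reduced_diagram G F \<longleftrightarrow> is_diagram G F \<and> \<not> R1_reducible G F \<and> \<not> R2_reducible G F"


section \<open>Leveled embeddings\<close>

definition semi_leveled_diagram ::
    "'a graph \<Rightarrow> 'a graph \<Rightarrow> (('a \<Rightarrow> real) \<Rightarrow> space3) \<Rightarrow> bool" where
  "semi_leveled_diagram G C F \<longleftrightarrow>
     is_diagram G F \<and>
     (\<forall>A\<in>fragments G C.
        inj_on (fst \<circ> F) A \<and>
        \<not> (\<exists>x\<in>A. \<exists>y\<in>realization C. double_pair G F x y) \<and>
        (\<forall>B\<in>fragments G C. A \<noteq> B \<longrightarrow> \<not> (crosses_over F A B \<and> crosses_over F B A)))"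

text \<open>Speaking of the bounded component of the complement of the spine presupposes that the
  spine is drawn as a Jordan curve; its inside is then that component.  As fragments are
  closed, they lie in it up to their attaching points on the spine.\<close>

definition spine_encloses_fragments ::
    "'a graph \<Rightarrow> 'a graph \<Rightarrow> (('a \<Rightarrow> real) \<Rightarrow> space3) \<Rightarrow> bool" where
  "spine_encloses_fragments G C F \<longleftrightarrow>
     inj_on (fst \<circ> F) (realization C) \<and>
     (\<forall>A\<in>fragments G C.
        (fst \<circ> F) ` (A - realization C) \<subseteq> inside ((fst \<circ> F) ` realization C))"

text \<open>The first level always exists, and is empty only when there are no fragments: a graph
  that is a single cycle thus has one level.\<close>

definition level_partition ::
    "'a graph \<Rightarrow> 'a graph \<Rightarrow> (('a \<Rightarrow> real) \<Rightarrow> space3) \<Rightarrow>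
     nat \<Rightarrow> (nat \<Rightarrow> ('a \<Rightarrow> real) set set) \<Rightarrow> bool" where
  "level_partition G C F n L \<longleftrightarrow>
     1 \<le> n \<and>
     (\<Union>i\<in>{1..n}. L i) = fragments G C \<and>
     (\<forall>i\<in>{1..n}. \<forall>j\<in>{1..n}. i \<noteq> j \<longrightarrow> L i \<inter> L j = {}) \<and>
     (\<forall>i\<in>{2..n}. L i \<noteq> {}) \<and>
     L 1 = {A \<in> fragments G C. \<forall>B\<in>fragments G C. B \<noteq> A \<longrightarrow> \<not> crosses_over F A B} \<and>
     (\<forall>i\<in>{2..n}. L i = {A \<in> fragments G C.
        (\<exists>B\<in>L (i - 1). B \<noteq> A \<and> crosses_over F A B) \<and>
        (\<forall>B\<in>fragments G C. B \<noteq> A \<and> crosses_over F A B \<longrightarrow> (\<exists>k\<in>{1..<i}. B \<in> L k))})"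

text \<open>\<open>leveled_with G f C n\<close>: the spatial graph represented by the embedding \<open>f\<close> has a leveled
  diagram with spine \<open>C\<close> and \<open>n\<close> levels.  The diagram is obtained from a representative \<open>g\<close> of the
  isotopy class that misses the pole of the stereographic projection.\<close>

definition leveled_with ::
    "'a graph \<Rightarrow> (('a \<Rightarrow> real) \<Rightarrow> space3 \<times> real) \<Rightarrow> 'a graph \<Rightarrow> nat \<Rightarrow> bool" where
  "leveled_with G f C n \<longleftrightarrow>
     is_cycle G C \<and> unknotted (f ` realization C) \<and>
     (\<exists>g. isotopic_embeddings G f g \<and> (0, 1) \<notin> g ` realization G \<and>
        semi_leveled_diagram G C (stereographic \<circ> g) \<and>
        reduced_diagram G (stereographic \<circ> g) \<and>
        spine_encloses_fragments G C (stereographic \<circ> g) \<and>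
        (\<exists>L. level_partition G C (stereographic \<circ> g) n L))"


section \<open>Level numbers\<close>

text \<open>An infimum in \<^typ>\<open>enat\<close> is a minimum, or infinity for the empty set.\<close>

definition spatial_level_number ::
    "'a graph \<Rightarrow> (('a \<Rightarrow> real) \<Rightarrow> space3 \<times> real) \<Rightarrow> enat" where
  "spatial_level_number G f = Inf {enat n | n C. leveled_with G f C n}"

definition level_number :: "'a graph \<Rightarrow> enat" where
  "level_number G = (INF f\<in>{f. graph_embedding G f}. spatial_level_number G f)"

definition spatial_hamiltonian_level_number ::
    "'a graph \<Rightarrow> (('a \<Rightarrow> real) \<Rightarrow> space3 \<times> real) \<Rightarrow> enat" where
  "spatial_hamiltonian_level_number G f =
     Inf {enat n | n C. is_hamiltonian_cycle G C \<and> leveled_with G f C n}"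

definition hamiltonian_level_number :: "'a graph \<Rightarrow> enat" where
  "hamiltonian_level_number G =
     (INF f\<in>{f. graph_embedding G f}. spatial_hamiltonian_level_number G f)"

end

theory Submission
  imports Defs
begin

text \<open>
  The lower bound.  A cycle in a complete bipartite graph with sides of sizes \<open>m \<ge> n \<ge> 3\<close>
  alternates between the sides, so a spine has \<open>2 k\<close> vertices with \<open>k \<le> n\<close>.  If \<open>k < n\<close>, some
  vertices \<open>u\<close> and \<open>w\<close> on different sides are both missed.  They are adjacent and hence lie in one
  fragment, but a detour through \<open>u\<close> and a detour through \<open>w\<close> can be chosen with attaching
  vertices that alternate along the spine, and such detours inside a Jordan curve meet: the fragment
  would cross itself (\<open>no_adjacent_bridges_off_spine\<close>).  So \<open>k = n\<close>, and the fragments are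
  \<open>n (n - 2)\<close> chords of the spine together with \<open>m - n\<close> stars, each attached to
  the whole side of size \<open>n\<close>, the right-hand vertices.

  Of two crossing fragments, one lies over the other, so their levels differ.  Chords with
  interleaved ends cross.  A star cuts each left-hand spine vertex off from all right-hand vertices
  but its two neighbours on the spine, so it crosses every chord.  Two stars cross because three legs
  of the first cut the disc into regions none of which touches all three attaching vertices
  (\<open>tripod_meets_connected\<close>).  Hence a star has its level to itself, and the chords of any other
  level are pairwise noncrossing; as they join vertices of different parity, they cut the
  \<open>2 n\<close>-gon into faces with at least four sides, so there are at most \<open>n - 2\<close> of them
  (\<open>card_noncrossing_chords\<close>).  Counting gives at least \<open>(m - n) + n\<close> levels
  (\<open>bipartite_levels_ge\<close>).

  The upper bound. Draw the spine as the unit circle at height \<open>0\<close> and every other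
  edge straight in the projection, with the vertices in general position
  (\<open>general_position_exists\<close>). Number the spine vertices cyclically. Chords whose
  ends have the same sum modulo \<open>2 n\<close> are parallel in a regular polygon, so they do
  not interleave, and the \<open>n\<close> odd sums colour the chords. Each star gets a further
  colour, for a total of \<open>m\<close>. A fragment of colour \<open>c\<close> is lifted to the
  paraboloid of height \<open>c (1 - |z|\<^sup>2)\<close>. These paraboloids meet only over the
  circle and are stacked by colour, so fragments cross over fragments of smaller colour only;
  grading fragments by the longest descending chain of crossings yields a partition into at most
  \<open>m\<close> levels (\<open>level_partition_exists\<close>). Straight edges cross at most
  once, which makes the diagram reduced (\<open>drawing_reduced\<close>). With
  \<open>n = 2\<close> there are no chords, and the stars, being paths between two spine vertices,
  can be drawn side by side on a single level.
\<close>

section \<open>Points, open edges and open stars of the realization\<close>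

definition vpoint :: "'a \<Rightarrow> 'a \<Rightarrow> real" where
  "vpoint v = (\<lambda>w. if w = v then 1 else 0)"

definition epoint :: "'a \<Rightarrow> 'a \<Rightarrow> real \<Rightarrow> 'a \<Rightarrow> real" where
  "epoint a b t = (\<lambda>w. (1 - t) * vpoint a w + t * vpoint b w)"

definition open_edge :: "'a set \<Rightarrow> ('a \<Rightarrow> real) set" where
  "open_edge e = {x. (\<forall>v. 0 \<le> x v) \<and> weight_support x = e \<and> sum x e = 1}"

text \<open>When all neighbours of \<open>u\<close> lie on a removed subgraph, this is what remains attached to \<open>u\<close>:
  a fragment without its attaching points.\<close>

definition open_star :: "'a graph \<Rightarrow> 'a \<Rightarrow> ('a \<Rightarrow> real) set" where
  "open_star G u = {x \<in> realization G. x u \<noteq> 0}"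

definition simple_graph :: "'a graph \<Rightarrow> bool" where
  "simple_graph G \<longleftrightarrow> finite (verts G) \<and>
     (\<forall>e\<in>edges G. \<exists>a b. a \<noteq> b \<and> a \<in> verts G \<and> b \<in> verts G \<and> e = {a, b})"

lemma vpoint_simps [simp]: "vpoint v v = 1" "w \<noteq> v \<Longrightarrow> vpoint v w = 0"
  by (auto simp: vpoint_def)

lemma vpoint_eq_iff [simp]: "vpoint a = vpoint b \<longleftrightarrow> a = b"
  by (metis vpoint_simps zero_neq_one)

lemma epoint_0 [simp]: "epoint a b 0 = vpoint a"
  by (simp add: epoint_def)

lemma epoint_1 [simp]: "epoint a b 1 = vpoint b"
  by (simp add: epoint_def)

lemma epoint_swap: "epoint a b t = epoint b a (1 - t)"
  by (auto simp: epoint_def)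

lemma epoint_fst [simp]: "a \<noteq> b \<Longrightarrow> epoint a b t a = 1 - t"
  by (simp add: epoint_def)

lemma epoint_snd [simp]: "a \<noteq> b \<Longrightarrow> epoint a b t b = t"
  by (simp add: epoint_def)

lemma epoint_other [simp]: "w \<noteq> a \<Longrightarrow> w \<noteq> b \<Longrightarrow> epoint a b t w = 0"
  by (simp add: epoint_def)

lemma continuous_on_epoint [continuous_intros]: "continuous_on S (epoint a b)"
  unfolding epoint_def by (intro continuous_intros)

lemma weight_support_vpoint [simp]: "weight_support (vpoint v) = {v}"
  by (auto simp: weight_support_def vpoint_def)

lemma weight_support_epoint:
  "a \<noteq> b \<Longrightarrow> t \<noteq> 0 \<Longrightarrow> t \<noteq> 1 \<Longrightarrow> weight_support (epoint a b t) = {a, b}"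
  by (auto simp: weight_support_def epoint_def vpoint_def)

lemma inj_epoint: "a \<noteq> b \<Longrightarrow> epoint a b s = epoint a b t \<longleftrightarrow> s = t"
  by (metis epoint_snd)

lemma open_edge_pair:
  assumes "a \<noteq> b"
  shows "open_edge {a, b} = epoint a b ` {0<..<1}"
proof (intro equalityI subsetI)
  fix x assume x: "x \<in> open_edge {a, b}"
  have "x a + x b = 1" "x a \<noteq> 0" "x b \<noteq> 0" "0 \<le> x a" "0 \<le> x b" "\<And>w. w \<noteq> a \<Longrightarrow> w \<noteq> b \<Longrightarrow> x w = 0"
    using x assms by (auto simp: open_edge_def weight_support_def)
  then have "x = epoint a b (x b)" "0 < x b" "x b < 1"
    using assms by (auto simp: epoint_def vpoint_def fun_eq_iff)
  then show "x \<in> epoint a b ` {0<..<1}" by auto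
next
  fix x assume "x \<in> epoint a b ` {0<..<1}"
  then show "x \<in> open_edge {a, b}"
    using assms by (auto simp: open_edge_def weight_support_epoint) (auto simp: epoint_def vpoint_def)
qed

lemma edge_points_eq: "edge_points G = (\<Union>e\<in>edges G. open_edge e)"
  by (auto simp: edge_points_def open_edge_def)

lemma vertex_points_eq: "vertex_points G = vpoint ` verts G"
  by (auto simp: vertex_points_def vpoint_def)

lemma realization_cases:
  assumes "x \<in> realization G"
  obtains v where "v \<in> verts G" "x = vpoint v" | e where "e \<in> edges G" "x \<in> open_edge e"
  using assms by (auto simp: realization_def edge_points_eq vertex_points_eq)

lemma vpoint_in_realization [simp]: "vpoint v \<in> realization G \<longleftrightarrow> v \<in> verts G"
  if "\<And>w. {w} \<notin> edges G" for v
  using that by (auto simp: realization_def edge_points_eq vertex_points_eq open_edge_def)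

lemma vpoint_in_realizationI [intro]: "v \<in> verts G \<Longrightarrow> vpoint v \<in> realization G"
  by (auto simp: realization_def edge_points_eq vertex_points_eq)

lemma open_edge_subset_realization: "e \<in> edges G \<Longrightarrow> open_edge e \<subseteq> realization G"
  by (auto simp: realization_def edge_points_eq)

lemma simple_graph_edgeE:
  assumes "simple_graph G" "e \<in> edges G"
  obtains a b where "a \<noteq> b" "a \<in> verts G" "b \<in> verts G" "e = {a, b}"
  using assms unfolding simple_graph_def by blast

lemma simple_graph_no_loop: "simple_graph G \<Longrightarrow> {w} \<notin> edges G"
  by (metis simple_graph_edgeE doubleton_eq_iff insert_absorb2)

lemma closed_edge_subset_realization:
  assumes "{a, b} \<in> edges G" "a \<noteq> b" "a \<in> verts G" "b \<in> verts G" "t \<in> {0..1}"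
  shows "epoint a b t \<in> realization G"
proof (cases "t = 0 \<or> t = 1")
  case True
  then show ?thesis using assms by auto
next
  case False
  then have "epoint a b t \<in> open_edge {a, b}"
    using assms by (auto simp: open_edge_pair)
  then show ?thesis using assms open_edge_subset_realization by blast
qed

text \<open>Each block is clopen, so a connected set that contains it cannot leave it.\<close>

lemma components_eq_open_partition:
  assumes S: "S = \<Union>\<K>"
    and op: "\<And>K. K \<in> \<K> \<Longrightarrow> openin (top_of_set S) K"
    and con: "\<And>K. K \<in> \<K> \<Longrightarrow> connected K" and ne: "\<And>K. K \<in> \<K> \<Longrightarrow> K \<noteq> {}"
    and dis: "pairwise disjnt \<K>"
  shows "components S = \<K>"
proof -
  have comp: "K \<in> components S" if K: "K \<in> \<K>" for K
    unfolding in_components_maximal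
  proof (intro conjI allI impI)
    fix d assume d: "d \<noteq> {} \<and> K \<subseteq> d \<and> d \<subseteq> S \<and> connected d"
    have "openin (top_of_set S) (S - K)"
    proof -
      have "S - K = \<Union>(\<K> - {K})"
        using K dis by (auto simp: S pairwise_def disjnt_def)
      then show ?thesis using op by (auto intro: openin_Union)
    qed
    then have "closedin (top_of_set S) K"
      using S K by (auto simp: closedin_def)
    then obtain T where T: "closed T" "K = S \<inter> T" by (auto simp: closedin_closed)
    obtain U where U: "open U" "K = S \<inter> U" using op[OF K] by (auto simp: openin_open)
    have "d \<inter> K = d \<inter> T" "d \<inter> K = d \<inter> U" using T U d by blast+
    then have "closedin (top_of_set d) (d \<inter> K)" "openin (top_of_set d) (d \<inter> K)"
      using T U by (metis closedin_closed_Int, metis openin_open_Int)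
    moreover have "d \<inter> K \<noteq> {}" using d ne[OF K] by blast
    ultimately show "d = K" using d unfolding connected_clopen by blast
  qed (use K S con ne in auto)
  moreover have "c \<in> \<K>" if c: "c \<in> components S" for c
  proof -
    obtain x where "x \<in> c" "x \<in> S"
      using c in_components_nonempty in_components_subset by fastforce
    then obtain K where "K \<in> \<K>" "x \<in> K" using S by blast
    then show ?thesis
      using comp components_nonoverlap[OF c comp[of K]] \<open>x \<in> c\<close> by auto
  qed
  ultimately show ?thesis by blast
qed

lemma continuous_on_coordinate [continuous_intros]: "continuous_on S (\<lambda>x. x i :: real)"
  by (rule continuous_on_subset[OF continuous_on_product_coordinates]) auto

lemma open_coordinate_ne_0: "open {x :: 'a \<Rightarrow> real. x i \<noteq> 0}"
proof -
  have "open ((\<lambda>x :: 'a \<Rightarrow> real. x i) -` (- {0}))"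
    by (intro open_vimage) auto
  then show ?thesis by (simp add: vimage_def)
qed

lemma connected_open_edge: "a \<noteq> b \<Longrightarrow> connected (open_edge {a, b})"
  unfolding open_edge_pair by (intro connected_continuous_image continuous_intros) auto

lemma open_star_eq:
  assumes "simple_graph G" "u \<in> verts G"
  shows "open_star G u = insert (vpoint u) (\<Union>b\<in>{b. {u, b} \<in> edges G}. epoint u b ` {0..<1})"
proof (intro equalityI subsetI)
  fix x assume "x \<in> open_star G u"
  then have x: "x \<in> realization G" "x u \<noteq> 0" by (auto simp: open_star_def)
  from x(1) show "x \<in> insert (vpoint u) (\<Union>b\<in>{b. {u, b} \<in> edges G}. epoint u b ` {0..<1})"
  proof (cases rule: realization_cases)
    case (1 v)
    then show ?thesis using x by (auto simp: vpoint_def split: if_splits)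
  next
    case (2 e)
    obtain a b where e: "a \<noteq> b" "e = {a, b}"
      using simple_graph_edgeE[OF assms(1) 2(1)] by metis
    have "u \<in> e" using 2 x by (auto simp: open_edge_def weight_support_def)
    then obtain c where c: "e = {u, c}" "u \<noteq> c" using e by blast
    then show ?thesis using 2 open_edge_pair[of u c] by fastforce
  qed
next
  fix x assume "x \<in> insert (vpoint u) (\<Union>b\<in>{b. {u, b} \<in> edges G}. epoint u b ` {0..<1})"
  moreover have "epoint u b t \<in> open_star G u" if "{u, b} \<in> edges G" "t \<in> {0..<1}" for b t
  proof -
    have "u \<noteq> b" "b \<in> verts G"
      using assms that simple_graph_no_loop[OF assms(1), of u] simple_graph_edgeE[OF assms(1) that(1)]
      by (auto simp: doubleton_eq_iff)
    then show ?thesis using that assms closed_edge_subset_realization[of u b G t]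
      by (auto simp: open_star_def)
  qed
  ultimately show "x \<in> open_star G u"
    using assms by (auto simp: open_star_def)
qed

lemma connected_open_star:
  assumes "simple_graph G" "u \<in> verts G"
  shows "connected (open_star G u)"
proof -
  have "connected (\<Union>(insert {vpoint u} ((\<lambda>b. epoint u b ` {0..<1}) ` {b. {u, b} \<in> edges G})))"
  proof (rule connected_Union)
    show "\<And>s. s \<in> insert {vpoint u} ((\<lambda>b. epoint u b ` {0..<1}) ` {b. {u, b} \<in> edges G}) \<Longrightarrow> connected s"
      by (auto intro!: connected_continuous_image continuous_intros)
    have "vpoint u \<in> epoint u b ` {0..<1}" for b
      by (rule image_eqI[of _ _ 0]) auto
    then show "\<Inter>(insert {vpoint u} ((\<lambda>b. epoint u b ` {0..<1}) ` {b. {u, b} \<in> edges G})) \<noteq> {}"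
      by auto
  qed
  then show ?thesis unfolding open_star_eq[OF assms] by simp
qed

lemma open_edge_disjoint: "x \<in> open_edge e \<Longrightarrow> x \<in> open_edge e' \<Longrightarrow> e = e'"
  by (simp add: open_edge_def)

lemma realization_subgraph_iff:
  assumes G: "simple_graph G" and C: "verts C \<subseteq> verts G" "edges C \<subseteq> edges G"
  shows "vpoint v \<in> realization C \<longleftrightarrow> v \<in> verts C"
    and "e \<in> edges G \<Longrightarrow> x \<in> open_edge e \<Longrightarrow> x \<in> realization C \<longleftrightarrow> e \<in> edges C"
proof -
  have nl: "{w} \<notin> edges C" for w using C simple_graph_no_loop[OF G] by blast
  then show "vpoint v \<in> realization C \<longleftrightarrow> v \<in> verts C" by simp
  assume e: "e \<in> edges G" "x \<in> open_edge e"
  have "x \<noteq> vpoint v" for v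
    using e simple_graph_no_loop[OF G, of v] by (auto simp: open_edge_def)
  then show "x \<in> realization C \<longleftrightarrow> e \<in> edges C"
    using e by (auto simp: realization_def vertex_points_eq edge_points_eq dest: open_edge_disjoint)
qed

section \<open>Components of the complement of a subgraph\<close>

text \<open>An edge that meets \<open>C\<close> cannot join two vertices off \<open>C\<close>, so the open star of such a vertex
  has no way out except through \<open>C\<close>.  Openness is read off the coordinates: one nonzero coordinate
  cuts out a star, two cut out an edge.  Applied with \<open>C\<close> the spine, this lists the fragments; with
  \<open>C\<close> all vertices and no edges, it separates the open edges.\<close>

lemma components_spine_complement:
  assumes G: "simple_graph G" and C: "verts C \<subseteq> verts G" "edges C \<subseteq> edges G"
    and Cs: "\<And>e. e \<in> edges C \<Longrightarrow> e \<subseteq> verts C"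
    and meet: "\<And>e. e \<in> edges G \<Longrightarrow> e \<inter> verts C \<noteq> {}"
  shows "components (realization G - realization C) =
     open_edge ` {e \<in> edges G - edges C. e \<subseteq> verts C} \<union> open_star G ` (verts G - verts C)"
    (is "components ?S = ?E \<union> ?V")
proof (rule components_eq_open_partition)
  note mem = realization_subgraph_iff[OF G C]
  have star: "open_star G u \<subseteq> ?S" if "u \<in> verts G - verts C" for u
  proof
    fix x assume x: "x \<in> open_star G u"
    then have "x \<in> realization G" "x u \<noteq> 0" by (auto simp: open_star_def)
    moreover from this(1) have "x \<notin> realization C"
    proof (cases rule: realization_cases)
      case (1 v)
      then show ?thesis using that \<open>x u \<noteq> 0\<close> mem(1) by (auto simp: vpoint_def split: if_splits)
    next
      case (2 e)
      then have "u \<in> e" using \<open>x u \<noteq> 0\<close> by (auto simp: open_edge_def weight_support_def)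
      then show ?thesis using 2 mem(2) Cs that by blast
    qed
    ultimately show "x \<in> ?S" by blast
  qed
  have edge: "open_edge e \<subseteq> ?S" if "e \<in> edges G - edges C" for e
    using that open_edge_subset_realization[of e G] mem(2)[of e] by auto
  show "?S = \<Union>(?E \<union> ?V)"
  proof (intro equalityI subsetI)
    fix x assume x: "x \<in> ?S"
    then have "x \<in> realization G" by simp
    then show "x \<in> \<Union>(?E \<union> ?V)"
    proof (cases rule: realization_cases)
      case (1 v)
      then have "v \<notin> verts C" "x \<in> open_star G v" using x by (auto simp: open_star_def)
      then show ?thesis using 1 by blast
    next
      case (2 e)
      then have eC: "e \<notin> edges C" using x mem(2) by auto
      show ?thesis
      proof (cases "e \<subseteq> verts C")
        case True
        then show ?thesis using 2 eC by auto
      next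
        case False
        then obtain u where u: "u \<in> e" "u \<notin> verts C" by blast
        then have "u \<in> verts G" using simple_graph_edgeE[OF G 2(1)] by auto
        moreover have "x \<in> open_star G u"
          using 2 x u by (auto simp: open_star_def open_edge_def weight_support_def)
        ultimately show ?thesis using u by blast
      qed
    qed
  next
    fix x assume "x \<in> \<Union>(?E \<union> ?V)"
    then show "x \<in> ?S" using star edge by blast
  qed
  show "openin (top_of_set ?S) K" if "K \<in> ?E \<union> ?V" for K
    using that
  proof
    assume "K \<in> ?E"
    then obtain e where e: "e \<in> edges G" "e \<notin> edges C" "e \<subseteq> verts C" "K = open_edge e" by auto
    obtain a b where ab: "a \<noteq> b" "e = {a, b}" using simple_graph_edgeE[OF G e(1)] by metis
    have "K = ?S \<inter> ({x. x a \<noteq> 0} \<inter> {x. x b \<noteq> 0})"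
    proof (intro equalityI subsetI)
      fix x assume "x \<in> K"
      then show "x \<in> ?S \<inter> ({x. x a \<noteq> 0} \<inter> {x. x b \<noteq> 0})"
        using e edge[of e] ab by (auto simp: open_edge_def weight_support_def)
    next
      fix x assume x: "x \<in> ?S \<inter> ({x. x a \<noteq> 0} \<inter> {x. x b \<noteq> 0})"
      then have "x \<in> realization G" by simp
      then show "x \<in> K"
      proof (cases rule: realization_cases)
        case (1 v)
        then show ?thesis using x ab by (auto simp: vpoint_def split: if_splits)
      next
        case (2 e')
        then have "a \<in> e'" "b \<in> e'" using x by (auto simp: open_edge_def weight_support_def)
        then have "e' = e" using simple_graph_edgeE[OF G 2(1)] ab by (metis doubleton_eq_iff empty_iff insert_iff)
        then show ?thesis using 2 e by simp
      qed
    qed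
    then show ?thesis by (auto intro!: openin_open_Int open_Int open_coordinate_ne_0)
  next
    assume "K \<in> ?V"
    then obtain u where u: "u \<in> verts G - verts C" "K = open_star G u" by blast
    then have "K = ?S \<inter> {x. x u \<noteq> 0}" using star[of u] by (auto simp: open_star_def)
    then show ?thesis by (auto intro!: openin_open_Int open_coordinate_ne_0)
  qed
  show "connected K" if "K \<in> ?E \<union> ?V" for K
    using that
  proof
    assume "K \<in> ?E"
    then obtain e where "e \<in> edges G" "K = open_edge e" by auto
    then show ?thesis using connected_open_edge by (metis simple_graph_edgeE[OF G])
  next
    assume "K \<in> ?V"
    then show ?thesis using connected_open_star[OF G] by auto
  qed
  show "K \<noteq> {}" if "K \<in> ?E \<union> ?V" for K
    using that
  proof
    assume "K \<in> ?E"
    then obtain a b where "a \<noteq> b" "K = open_edge {a, b}"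
      using simple_graph_edgeE[OF G] by (smt (verit) DiffD1 imageE mem_Collect_eq)
    then show ?thesis by (auto simp: open_edge_pair)
  next
    assume "K \<in> ?V"
    then obtain u where "u \<in> verts G" "K = open_star G u" by blast
    then have "vpoint u \<in> K" by (auto simp: open_star_def)
    then show ?thesis by blast
  qed
  have ee: "disjnt (open_edge e) (open_edge e')" if "e \<noteq> e'" for e e' :: "'a set"
    using that open_edge_disjoint by (auto simp: disjnt_def)
  have eu: "disjnt (open_edge e) (open_star G u)" if "e \<subseteq> verts C" "u \<notin> verts C" for e u
    using that by (auto simp: disjnt_def open_star_def open_edge_def weight_support_def)
  have uu: "disjnt (open_star G u) (open_star G v)"
    if uv: "u \<noteq> v" "u \<notin> verts C" "v \<notin> verts C" for u v
  proof -
    have False if x: "x \<in> realization G" "x u \<noteq> 0" "x v \<noteq> 0" for x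
      using x(1)
    proof (cases rule: realization_cases)
      case (1 w)
      then show ?thesis using x uv by (auto simp: vpoint_def split: if_splits)
    next
      case (2 e)
      then have "u \<in> e" "v \<in> e" using x by (auto simp: open_edge_def weight_support_def)
      moreover obtain a b where "e = {a, b}" using simple_graph_edgeE[OF G 2(1)] by metis
      ultimately show ?thesis using meet[OF 2(1)] uv by auto
    qed
    then show ?thesis by (auto simp: disjnt_def open_star_def)
  qed
  show "pairwise disjnt (?E \<union> ?V)"
    unfolding pairwise_def
  proof (intro ballI impI)
    fix K K' assume K: "K \<in> ?E \<union> ?V" "K' \<in> ?E \<union> ?V" "K \<noteq> K'"
    consider (ee) e e' where "K = open_edge e" "K' = open_edge e'"
      | (eu) e u where "K = open_edge e" "K' = open_star G u" "e \<subseteq> verts C" "u \<notin> verts C"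
      | (ue) e u where "K' = open_edge e" "K = open_star G u" "e \<subseteq> verts C" "u \<notin> verts C"
      | (uu) u v where "K = open_star G u" "K' = open_star G v" "u \<notin> verts C" "v \<notin> verts C"
      using K(1,2) by blast
    then show "disjnt K K'"
      using K(3) ee eu uu by cases (metis, metis, metis disjnt_sym, metis)
  qed
qed

section \<open>Walks as arcs\<close>

definition walk_points :: "'a list \<Rightarrow> ('a \<Rightarrow> real) set" where
  "walk_points us = {epoint (us ! k) (us ! Suc k) t | k t. Suc k < length us \<and> t \<in> {0..1}}"

lemma walk_points_Cons2:
  "walk_points (a # b # us) = epoint a b ` {0..1} \<union> walk_points (b # us)"
proof -
  have "x \<in> walk_points (a # b # us)" if x: "x \<in> walk_points (b # us)" for x
  proof -
    obtain k t where "x = epoint ((b # us) ! k) ((b # us) ! Suc k) t" "Suc k < length (b # us)" "t \<in> {0..1}"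
      using x unfolding walk_points_def by blast
    then show ?thesis unfolding walk_points_def
      by (intro CollectI exI[of _ "Suc k"] exI[of _ t]) auto
  qed
  moreover have "epoint a b t \<in> walk_points (a # b # us)" if "t \<in> {0..1}" for t
    unfolding walk_points_def using that by (intro CollectI exI[of _ "0"] exI[of _ t]) auto
  moreover have "x \<in> epoint a b ` {0..1} \<union> walk_points (b # us)" if x: "x \<in> walk_points (a # b # us)" for x
  proof -
    obtain k t where kt: "x = epoint ((a # b # us) ! k) ((a # b # us) ! Suc k) t"
        "Suc k < length (a # b # us)" "t \<in> {0..1}"
      using x unfolding walk_points_def by blast
    show ?thesis
    proof (cases k)
      case 0
      then show ?thesis using kt by auto
    next
      case (Suc k')
      then have "x \<in> walk_points (b # us)" unfolding walk_points_def using kt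
        by (intro CollectI exI[of _ k'] exI[of _ t]) auto
      then show ?thesis by simp
    qed
  qed
  ultimately show ?thesis by blast
qed

lemma walk_points_short [simp]: "walk_points [] = {}" "walk_points [a] = {}"
  by (auto simp: walk_points_def)

lemma walk_points_support: "x \<in> walk_points us \<Longrightarrow> weight_support x \<subseteq> set us"
  unfolding walk_points_def weight_support_def
  by (auto simp: epoint_def vpoint_def split: if_splits)

lemma arc_epoint: "a \<noteq> b \<Longrightarrow> arc (epoint a b)"
  by (auto simp: arc_def path_def continuous_on_epoint inj_on_def inj_epoint)

text \<open>The edges of a walk without repeated vertices can be joined one by one: a point shared with the
  rest of the walk has its support there, hence not at the first vertex.\<close>

lemma walk_arc:
  assumes "distinct us" "2 \<le> length us"
  shows "\<exists>g. arc g \<and> pathstart g = vpoint (hd us) \<and> pathfinish g = vpoint (last us) \<and>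
    path_image g = walk_points us"
  using assms
proof (induction us rule: induct_list012)
  case (3 a b us)
  show ?case
  proof (cases us)
    case Nil
    then show ?thesis using 3 arc_epoint[of a b]
      by (intro exI[of _ "epoint a b"])
         (auto simp: walk_points_Cons2 pathstart_def pathfinish_def path_image_def)
  next
    case (Cons c us')
    then obtain g where g: "arc g" "pathstart g = vpoint b" "pathfinish g = vpoint (last (b # us))"
       "path_image g = walk_points (b # us)"
      using 3 by auto
    have "path_image (epoint a b) \<inter> path_image g \<subseteq> {pathstart g}"
    proof
      fix x assume x: "x \<in> path_image (epoint a b) \<inter> path_image g"
      then obtain t where t: "x = epoint a b t" by (auto simp: path_image_def)
      have "a \<notin> weight_support x"
        using x g walk_points_support[of x "b # us"] 3 by auto
      then have "t = 1" using t 3 by (auto simp: weight_support_def)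
      then show "x \<in> {pathstart g}" using t g by simp
    qed
    moreover have e: "pathfinish (epoint a b) = pathstart g" "pathstart (epoint a b) = vpoint a"
      using g by (simp_all add: pathfinish_def pathstart_def)
    ultimately have "arc (epoint a b +++ g)"
      using g 3 arc_epoint[of a b] by (intro arc_join) auto
    moreover have "path_image (epoint a b +++ g) = walk_points (a # b # us)"
      using g e by (simp add: path_image_join walk_points_Cons2 path_image_def[of "epoint a b"])
    ultimately show ?thesis using g e
      by (intro exI[of _ "epoint a b +++ g"]) simp
  qed
qed auto

lemma walk_points_append:
  "walk_points (us @ [b] @ ws) = walk_points (us @ [b]) \<union> walk_points (b # ws)"
proof (induction us rule: induct_list012)
  case (2 x)
  then show ?case by (simp add: walk_points_Cons2)
qed (auto simp: walk_points_Cons2)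

lemma walk_points_rev: "walk_points (rev us) = walk_points us"
proof (induction us rule: induct_list012)
  case (3 a b us)
  have "epoint b a ` {0..1} = epoint a b ` {0..1}"
  proof -
    have "epoint b a ` {0..1} = epoint a b ` (\<lambda>t. 1 - t) ` {0..1}"
      unfolding image_image by (subst epoint_swap) simp
    also have "(\<lambda>t. 1 - t) ` {0..1::real} = {0..1}"
      by (simp add: image_diff_atLeastAtMost)
    finally show ?thesis .
  qed
  then show ?case using 3 walk_points_append[of "rev us" b "[a]"] by (simp add: walk_points_Cons2 Un_commute)
qed auto

section \<open>Connected sets and crosscuts inside a Jordan curve\<close>

text \<open>A crosscut \<open>c\<close> splits the inside of the curve into two open sides, and a connected set that
  avoids \<open>c\<close> stays in one of them.  The point \<open>q\<close> tells which one, since the closure of the other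
  side adds only points of \<open>c1\<close> and \<open>c\<close>.\<close>

lemma crosscut_side:
  fixes c1 c2 c :: "real \<Rightarrow> complex"
  assumes arcs: "arc c1" "arc c2" "arc c"
    and ends: "pathstart c1 = a" "pathfinish c1 = b" "pathstart c2 = a" "pathfinish c2 = b"
      "pathstart c = a" "pathfinish c = b"
    and c12: "path_image c1 \<inter> path_image c2 = {a, b}"
    and cut: "path_image c - {a, b} \<subseteq> inside (path_image c1 \<union> path_image c2)"
    and S: "connected S" "S \<subseteq> inside (path_image c1 \<union> path_image c2)" "S \<inter> path_image c = {}"
    and q: "q \<in> closure S" "q \<in> path_image c2" "q \<noteq> a" "q \<noteq> b"
  shows "S \<subseteq> inside (path_image c2 \<union> path_image c)"
    and "S \<inter> inside (path_image c1 \<union> path_image c) = {}"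
proof -
  let ?J = "path_image c1 \<union> path_image c2"
  have ab: "a \<noteq> b" using arcs(1) ends arc_distinct_ends by metis
  have disj: "inside ?J \<inter> ?J = {}" by (rule inside_no_overlap)
  have "a \<in> path_image c1" "b \<in> path_image c1" "a \<in> path_image c2" "b \<in> path_image c2"
     "a \<in> path_image c" "b \<in> path_image c"
    using ends pathstart_in_path_image pathfinish_in_path_image by metis+
  then have c1c: "path_image c1 \<inter> path_image c = {a, b}" and c2c: "path_image c2 \<inter> path_image c = {a, b}"
    using cut disj by blast+
  have "path_image c - {a, b} \<noteq> {}"
    using nonempty_simple_path_endless[of c] arcs ends arc_imp_simple_path by metis
  then have ne: "path_image c \<inter> inside ?J \<noteq> {}" using cut by blast
  obtain dis: "inside (path_image c1 \<union> path_image c) \<inter> inside (path_image c2 \<union> path_image c) = {}"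
    and un: "inside (path_image c1 \<union> path_image c) \<union> inside (path_image c2 \<union> path_image c) \<union>
           (path_image c - {a, b}) = inside ?J"
    using split_inside_simple_closed_curve[of c1 a b c2 c] arcs ends ab c12 c1c c2c ne
      arc_imp_simple_path by metis
  have cl: "closed (path_image c1 \<union> path_image c)" "closed (path_image c2 \<union> path_image c)"
    using arcs by (auto intro!: closed_Un closed_arc_image)
  have op: "open (inside (path_image c1 \<union> path_image c))" "open (inside (path_image c2 \<union> path_image c))"
    using cl open_inside by auto
  have cov: "S \<subseteq> inside (path_image c1 \<union> path_image c) \<union> inside (path_image c2 \<union> path_image c)"
    using S un by blast
  have "S \<subseteq> inside (path_image c1 \<union> path_image c) \<or> S \<subseteq> inside (path_image c2 \<union> path_image c)"
    using connectedD[OF S(1) op] dis cov by blast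
  moreover have "\<not> S \<subseteq> inside (path_image c1 \<union> path_image c)"
  proof
    assume "S \<subseteq> inside (path_image c1 \<union> path_image c)"
    then have "q \<in> (path_image c1 \<union> path_image c) \<union> inside (path_image c1 \<union> path_image c)"
      using q(1) closure_mono closure_inside_subset[OF cl(1)] by blast
    then show False using q c12 c2c un disj by blast
  qed
  ultimately show "S \<subseteq> inside (path_image c2 \<union> path_image c)" by blast
  then show "S \<inter> inside (path_image c1 \<union> path_image c) = {}" using dis by blast
qed

text \<open>A set that avoided the crosscut would lie on both sides of it, by \<open>crosscut_side\<close> applied to
  \<open>q\<close> and to \<open>p\<close>.\<close>

lemma crosscut_meets_connected:
  fixes c1 c2 c :: "real \<Rightarrow> complex"
  assumes arcs: "arc c1" "arc c2" "arc c"
    and ends: "pathstart c1 = a" "pathfinish c1 = b" "pathstart c2 = a" "pathfinish c2 = b"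
      "pathstart c = a" "pathfinish c = b"
    and c12: "path_image c1 \<inter> path_image c2 = {a, b}"
    and cut: "path_image c - {a, b} \<subseteq> inside (path_image c1 \<union> path_image c2)"
    and S: "connected S" "S \<subseteq> inside (path_image c1 \<union> path_image c2)"
    and p: "p \<in> closure S" "p \<in> path_image c1" "p \<noteq> a" "p \<noteq> b"
    and q: "q \<in> closure S" "q \<in> path_image c2" "q \<noteq> a" "q \<noteq> b"
  shows "S \<inter> path_image c \<noteq> {}"
proof
  assume Sc: "S \<inter> path_image c = {}"
  have "S \<inter> inside (path_image c1 \<union> path_image c) = {}"
    by (rule crosscut_side(2)[OF arcs ends c12 cut S Sc q])
  moreover have "S \<subseteq> inside (path_image c1 \<union> path_image c)"
    by (rule crosscut_side(1)[OF arcs(2,1,3) ends(3,4,1,2,5,6) _ _ S(1) _ Sc p])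
       (use c12 cut S in \<open>auto simp: Int_commute Un_commute\<close>)
  ultimately have "S = {}" by (metis Int_absorb2)
  then show False using p(1) by simp
qed

text \<open>This is the planar obstruction behind \<open>K 3 3\<close>.  The first two legs form a crosscut from \<open>y1\<close> to
  \<open>y2\<close>.  The set \<open>S\<close> and the third leg both reach \<open>y3\<close>, so both lie on the side of \<open>y3\<close>.  The third
  leg is a crosscut of that side from \<open>u\<close> to \<open>y3\<close>, and it has \<open>y1\<close> and \<open>y2\<close> on different sides, so
  \<open>S\<close>, which reaches both, must meet it.\<close>

lemma tripod_meets_connected:
  fixes a b d l1 l2 l3 :: "real \<Rightarrow> complex"
  assumes arcs: "arc a" "arc b" "arc d" "arc l1" "arc l2" "arc l3"
    and ends: "pathstart a = y1" "pathfinish a = y2" "pathstart b = y1" "pathfinish b = y3"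
      "pathstart d = y2" "pathfinish d = y3"
      "pathstart l1 = u" "pathfinish l1 = y1" "pathstart l2 = u" "pathfinish l2 = y2"
      "pathstart l3 = u" "pathfinish l3 = y3"
    and ints: "path_image a \<inter> path_image b = {y1}" "path_image a \<inter> path_image d = {y2}"
      "path_image b \<inter> path_image d = {y3}"
      "path_image l1 \<inter> path_image l2 = {u}" "path_image l1 \<inter> path_image l3 = {u}"
      "path_image l2 \<inter> path_image l3 = {u}"
    and J: "J = path_image a \<union> path_image b \<union> path_image d"
    and legs: "path_image l1 - {y1} \<subseteq> inside J" "path_image l2 - {y2} \<subseteq> inside J"
      "path_image l3 - {y3} \<subseteq> inside J"
    and S: "connected S" "S \<subseteq> inside J" "y1 \<in> closure S" "y2 \<in> closure S" "y3 \<in> closure S"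
  shows "S \<inter> (path_image l1 \<union> path_image l2 \<union> path_image l3) \<noteq> {}"
proof
  assume Sl: "S \<inter> (path_image l1 \<union> path_image l2 \<union> path_image l3) = {}"
  have ne: "y1 \<noteq> y2" "y1 \<noteq> y3" "y2 \<noteq> y3" "u \<noteq> y1" "u \<noteq> y2" "u \<noteq> y3"
    using arcs ends arc_distinct_ends by metis+
  note ins = pathstart_in_path_image pathfinish_in_path_image
  have mem: "y1 \<in> path_image a" "y2 \<in> path_image a" "y1 \<in> path_image b" "y3 \<in> path_image b"
    "y2 \<in> path_image d" "y3 \<in> path_image d" "u \<in> path_image l1" "u \<in> path_image l2" "u \<in> path_image l3"
    "y1 \<in> path_image l1" "y2 \<in> path_image l2" "y3 \<in> path_image l3"
    using ends ins by metis+
  define c where "c = reversepath l1 +++ l2"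
  define c2 where "c2 = b +++ reversepath d"
  have c: "arc c" "pathstart c = y1" "pathfinish c = y2" "path_image c = path_image l1 \<union> path_image l2"
    using arcs ends ints unfolding c_def
    by (auto intro!: arc_join arc_reversepath simp: path_image_join)
  have c2: "arc c2" "pathstart c2 = y1" "pathfinish c2 = y2" "path_image c2 = path_image b \<union> path_image d"
    using arcs ends ints unfolding c2_def
    by (auto intro!: arc_join arc_reversepath simp: path_image_join)
  have J2: "path_image a \<union> path_image c2 = J" using c2 J by blast
  have c12: "path_image a \<inter> path_image c2 = {y1, y2}" using c2 ints by blast
  have cut: "path_image c - {y1, y2} \<subseteq> inside (path_image a \<union> path_image c2)"
    using J2 c legs by auto
  have y3: "y3 \<in> path_image c2" "y3 \<noteq> y1" "y3 \<noteq> y2" using c2 mem ne by auto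
  have S2: "S \<subseteq> inside (path_image c2 \<union> path_image c)"
    by (rule crosscut_side(1)[OF arcs(1) c2(1) c(1) ends(1,2) c2(2,3) c(2,3) c12 cut S(1) _ _ S(5) y3])
       (use J2 S Sl c in auto)
  have l3_inner: "connected (path_image l3 - {u, y3})" "y3 \<in> closure (path_image l3 - {u, y3})"
  proof -
    have sl: "simple_path l3" using arcs by (simp add: arc_imp_simple_path)
    then show "connected (path_image l3 - {u, y3})"
      using connected_simple_path_endless[of l3] ends by simp
    show "y3 \<in> closure (path_image l3 - {u, y3})"
      using simple_path_endless[OF sl] ends arcs
    proof -
      have "l3 ` closure {0<..<1} \<subseteq> closure (l3 ` {0<..<1})"
        by (rule image_closure_subset) (use arcs in \<open>auto simp: arc_def path_def closure_subset\<close>)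
      then have "l3 1 \<in> closure (l3 ` {0<..<1})" by auto
      then show ?thesis using simple_path_endless[OF sl] ends by (simp add: pathfinish_def)
    qed
  qed
  have L2: "path_image l3 - {u, y3} \<subseteq> inside (path_image c2 \<union> path_image c)"
    by (rule crosscut_side(1)[OF arcs(1) c2(1) c(1) ends(1,2) c2(2,3) c(2,3) c12 cut l3_inner(1) _ _ l3_inner(2) y3])
       (use J2 legs c ints in auto)
  \<comment> \<open>The boundary of the side of \<open>y3\<close>, now seen as two arcs from \<open>u\<close> to \<open>y3\<close>.\<close>
  define e1 where "e1 = l1 +++ b"
  define e2 where "e2 = l2 +++ d"
  have dJ: "inside J \<inter> J = {}" by (rule inside_no_overlap)
  have lb: "path_image l1 \<inter> path_image b = {y1}" "path_image l2 \<inter> path_image d = {y2}"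
      "path_image l1 \<inter> path_image d = {}" "path_image l2 \<inter> path_image b = {}"
  proof -
    have l: "path_image l1 \<inter> J \<subseteq> {y1}" "path_image l2 \<inter> J \<subseteq> {y2}" using legs dJ by blast+
    have n: "y1 \<notin> path_image d" "y2 \<notin> path_image b" using ints mem ne by blast+
    show "path_image l1 \<inter> path_image b = {y1}" "path_image l2 \<inter> path_image d = {y2}"
      "path_image l1 \<inter> path_image d = {}" "path_image l2 \<inter> path_image b = {}"
      using l n mem unfolding J by blast+
  qed
  have e1: "arc e1" "pathstart e1 = u" "pathfinish e1 = y3" "path_image e1 = path_image l1 \<union> path_image b"
    using arcs ends lb unfolding e1_def by (auto intro!: arc_join simp: path_image_join)
  have e2: "arc e2" "pathstart e2 = u" "pathfinish e2 = y3" "path_image e2 = path_image l2 \<union> path_image d"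
    using arcs ends lb unfolding e2_def by (auto intro!: arc_join simp: path_image_join)
  have e12: "path_image e1 \<inter> path_image e2 = {u, y3}"
    unfolding e1 e2 Int_Un_distrib Int_Un_distrib2 using ints lb by auto
  have eJ: "path_image e1 \<union> path_image e2 = path_image c2 \<union> path_image c"
    using e1 e2 c c2 by blast
  have "S \<inter> path_image l3 \<noteq> {}"
    by (rule crosscut_meets_connected[OF e1(1) e2(1) arcs(6) e1(2,3) e2(2,3) ends(11,12) e12 _ S(1) _ S(3) _ _ _ S(4)])
       (use eJ L2 S2 e1 e2 mem ne in auto)
  then show False using Sl by blast
qed

section \<open>Drawings whose spine encloses the fragments\<close>

lemma path_subset_closure_inner:
  fixes p :: "real \<Rightarrow> 'b::t2_space"
  assumes "path p" "t \<in> {0..1}"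
  shows "p t \<in> closure (p ` {0<..<1})"
proof -
  have "p ` closure {0<..<1} \<subseteq> closure (p ` {0<..<1})"
    by (rule image_closure_subset) (use assms in \<open>auto simp: path_def closure_subset\<close>)
  then show ?thesis using assms by auto
qed

lemma arc_compose_inj:
  assumes "arc g" "continuous_on (path_image g) P" "inj_on P (path_image g)"
  shows "arc (P \<circ> g)"
  using assms by (auto simp: arc_def path_continuous_image path_image_def intro: comp_inj_on)

lemma walk_points_single_support:
  assumes "x \<in> walk_points us" "distinct us" "weight_support x \<subseteq> {v}"
  shows "x = vpoint v"
proof -
  obtain k t where k: "x = epoint (us ! k) (us ! Suc k) t" "Suc k < length us" "t \<in> {0..1}"
    using assms(1) unfolding walk_points_def by blast
  let ?a = "us ! k" and ?b = "us ! Suc k"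
  have ab: "?a \<noteq> ?b" using k assms(2) by (simp add: nth_eq_iff_index_eq)
  have "t = 0 \<or> t = 1"
    using weight_support_epoint[OF ab, of t] assms(3) k ab by (metis insert_subset singletonD)
  then show ?thesis using k assms(3) by auto
qed

lemma walk_points_ends:
  assumes "2 \<le> length us"
  shows "vpoint (hd us) \<in> walk_points us" "vpoint (last us) \<in> walk_points us"
proof -
  have "epoint (us ! 0) (us ! Suc 0) 0 \<in> walk_points us"
    unfolding walk_points_def using assms by (intro CollectI exI[of _ "0::nat"] exI[of _ "0::real"]) auto
  then show "vpoint (hd us) \<in> walk_points us" using assms by (cases us) auto
  have "epoint (us ! (length us - 2)) (us ! Suc (length us - 2)) 1 \<in> walk_points us"
    unfolding walk_points_def using assms by (intro CollectI exI[of _ "length us - 2"] exI[of _ "1::real"]) auto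
  moreover have "us ! Suc (length us - 2) = last us"
  proof -
    have "Suc (length us - 2) = length us - 1" "us \<noteq> []" using assms by auto
    then show ?thesis by (simp add: last_conv_nth)
  qed
  ultimately show "vpoint (last us) \<in> walk_points us" by simp
qed

text \<open>This shows that the two arcs of a cycle between \<open>a\<close> and \<open>b\<close> meet only at their ends.  If \<open>ys\<close>
  were empty, the support \<open>{a, b}\<close> would also be that of the inner points of the edge itself.\<close>

lemma walk_points_end_support:
  assumes "distinct (a # ys @ [b])" "ys \<noteq> []" "x \<in> walk_points (a # ys @ [b])"
    and "weight_support x \<subseteq> {a, b}"
  shows "x \<in> {vpoint a, vpoint b}"
proof -
  obtain y ys' where ys: "ys = y # ys'" using assms(2) by (cases ys) auto
  consider t where "t \<in> {0..1}" "x = epoint a y t" | "x \<in> walk_points (y # ys' @ [b])"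
    using assms(3) by (auto simp: ys walk_points_Cons2)
  then show ?thesis
  proof cases
    case 1
    have "a \<noteq> y" "y \<noteq> b" using assms(1) ys by auto
    moreover have "x y = 0" using assms(4) calculation by (auto simp: weight_support_def)
    ultimately have "t = 0" using 1 by simp
    then show ?thesis using 1 by simp
  next
    case 2
    then have "weight_support x \<subseteq> {b}"
      using walk_points_support[of x] assms ys by fastforce
    then show ?thesis using walk_points_single_support[OF 2] assms(1) ys by auto
  qed
qed

lemma walk_points_rotate:
  assumes "xs \<noteq> []" "ys \<noteq> []"
  shows "walk_points ((xs @ ys) @ [hd (xs @ ys)]) = walk_points ((ys @ xs) @ [hd (ys @ xs)])"
proof -
  obtain x xs' y ys' where "xs = x # xs'" "ys = y # ys'" using assms by (metis neq_Nil_conv)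
  then show ?thesis
    using walk_points_append[of "x # xs'" y "ys' @ [x]"] walk_points_append[of "y # ys'" x "xs' @ [y]"]
    by auto
qed

lemma realization_cycle_graph:
  assumes "distinct vs" "3 \<le> length vs"
  shows "realization (cycle_graph vs) = walk_points (vs @ [hd vs])"
proof -
  let ?N = "length vs"
  have nth: "(vs @ [hd vs]) ! i = vs ! i" "(vs @ [hd vs]) ! Suc i = vs ! (Suc i mod ?N)" if "i < ?N" for i
  proof -
    show "(vs @ [hd vs]) ! i = vs ! i" using that by (simp add: nth_append)
    show "(vs @ [hd vs]) ! Suc i = vs ! (Suc i mod ?N)"
    proof (cases "Suc i = ?N")
      case True
      then have "vs \<noteq> []" by auto
      then show ?thesis using True by (simp add: nth_append hd_conv_nth)
    next
      case False
      then show ?thesis using that by (simp add: nth_append)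
    qed
  qed
  have ne: "vs ! i \<noteq> vs ! (Suc i mod ?N)" if "i < ?N" for i
  proof -
    have "Suc i mod ?N < ?N" using assms by (intro mod_less_divisor) auto
    moreover have "i \<noteq> Suc i mod ?N"
      using that assms by (cases "Suc i = ?N") auto
    ultimately show ?thesis using assms that by (simp add: nth_eq_iff_index_eq)
  qed
  show ?thesis
  proof (intro equalityI subsetI)
    fix x assume "x \<in> realization (cycle_graph vs)"
    then show "x \<in> walk_points (vs @ [hd vs])"
    proof (cases rule: realization_cases)
      case (1 v)
      then obtain i where "i < ?N" "v = vs ! i" by (auto simp: cycle_graph_def in_set_conv_nth)
      then show ?thesis unfolding walk_points_def using 1 nth
        by (intro CollectI exI[of _ i] exI[of _ "0::real"]) auto
    next
      case (2 e)
      then obtain i where i: "i < ?N" "e = {vs ! i, vs ! (Suc i mod ?N)}" by (auto simp: cycle_graph_def)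
      then obtain t where "x = epoint (vs ! i) (vs ! (Suc i mod ?N)) t" "t \<in> {0<..<1}"
        using 2(2) open_edge_pair[OF ne[OF i(1)]] by auto
      then show ?thesis unfolding walk_points_def using i nth
        by (intro CollectI exI[of _ i] exI[of _ t]) auto
    qed
  next
    fix x assume "x \<in> walk_points (vs @ [hd vs])"
    then obtain k t where k: "x = epoint ((vs @ [hd vs]) ! k) ((vs @ [hd vs]) ! Suc k) t"
      "Suc k < length (vs @ [hd vs])" "t \<in> {0..1}"
      unfolding walk_points_def by blast
    then have kN: "k < ?N" by simp
    have "x = epoint (vs ! k) (vs ! (Suc k mod ?N)) t" using k nth[OF kN] by simp
    moreover have "Suc k mod ?N < ?N" using assms by (intro mod_less_divisor) auto
    ultimately show "x \<in> realization (cycle_graph vs)"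
      using closed_edge_subset_realization[of "vs ! k" "vs ! (Suc k mod ?N)" "cycle_graph vs" t] kN k ne[OF kN]
      by (auto simp: cycle_graph_def)
  qed
qed

lemma realization_eq_closed_edges:
  assumes "simple_graph G"
  shows "realization G = vpoint ` verts G \<union>
    (\<Union>(a, b)\<in>{(a, b). a \<in> verts G \<and> b \<in> verts G \<and> a \<noteq> b \<and> {a, b} \<in> edges G}. epoint a b ` {0..1})"
    (is "_ = ?R")
proof (intro equalityI subsetI)
  fix x assume "x \<in> realization G"
  then show "x \<in> ?R"
  proof (cases rule: realization_cases)
    case (2 e)
    obtain a b where ab: "a \<noteq> b" "a \<in> verts G" "b \<in> verts G" "e = {a, b}"
      using simple_graph_edgeE[OF assms 2(1)] by metis
    then have "x \<in> epoint a b ` {0..1}" using 2 open_edge_pair by fastforce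
    then show ?thesis using ab 2 by blast
  qed auto
next
  fix x assume "x \<in> ?R"
  then show "x \<in> realization G" using closed_edge_subset_realization[of _ _ G] by auto
qed

lemma compact_realization:
  fixes G :: "'a::countable graph"
  assumes "simple_graph G"
  shows "compact (realization G)"
proof -
  have fin: "finite (verts G)" using assms by (simp add: simple_graph_def)
  have "finite {(a, b). a \<in> verts G \<and> b \<in> verts G \<and> a \<noteq> b \<and> {a, b} \<in> edges G}"
    by (rule finite_subset[of _ "verts G \<times> verts G"]) (use fin in auto)
  then show ?thesis
    unfolding realization_eq_closed_edges[OF assms]
    using fin by (intro compact_Un compact_UN)
      (auto simp: finite_imp_compact intro!: compact_continuous_image continuous_on_epoint)
qed

lemma fragment_subset_realization:
  fixes G :: "'a::countable graph"
  assumes "simple_graph G" "A \<in> fragments G C"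
  shows "A \<subseteq> realization G"
proof -
  obtain K where K: "K \<in> components (realization G - realization C)" "A = closure K"
    using assms(2) by (auto simp: fragments_def)
  then have "K \<subseteq> realization G" using in_components_subset by blast
  then show ?thesis using K compact_imp_closed[OF compact_realization[OF assms(1)]]
    by (simp add: closure_minimal)
qed

locale spined_graph =
  fixes G :: "'a::countable graph" and vs :: "'a list"
  assumes G: "simple_graph G"
    and vs: "distinct vs" "3 \<le> length vs"
    and spine: "set vs \<subseteq> verts G" "edges (cycle_graph vs) \<subseteq> edges G"
begin

abbreviation "C \<equiv> cycle_graph vs"
abbreviation "chords \<equiv> edges G - edges C"

lemma verts_C: "verts C = set vs" by (simp add: cycle_graph_def)

lemma C: "verts C \<subseteq> verts G" "edges C \<subseteq> edges G" using spine verts_C by auto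

lemma spine_edge: "k < length vs \<Longrightarrow> {vs ! k, vs ! (Suc k mod length vs)} \<in> edges C"
  by (auto simp: cycle_graph_def)

lemma edges_C_subset: "e \<in> edges C \<Longrightarrow> e \<subseteq> verts C"
proof -
  assume "e \<in> edges C"
  then obtain i where "i < length vs" "e = {vs ! i, vs ! (Suc i mod length vs)}"
    by (auto simp: cycle_graph_def)
  moreover have "Suc i mod length vs < length vs" using vs by (intro mod_less_divisor) auto
  ultimately show ?thesis by (auto simp: verts_C)
qed

lemma edge_ends: "{a, b} \<in> edges G \<Longrightarrow> a \<noteq> b \<and> a \<in> verts G \<and> b \<in> verts G"
  using simple_graph_edgeE[OF G] by (metis doubleton_eq_iff)

lemma spine_subset: "realization C \<subseteq> realization G"
  using C by (auto simp: realization_def vertex_points_eq edge_points_eq)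

end

text \<open>What remains of a leveled diagram when the heights are forgotten.\<close>

locale enclosed_drawing = spined_graph G vs for G :: "'a::countable graph" and vs +
  fixes P :: "('a \<Rightarrow> real) \<Rightarrow> complex"
  assumes cont: "continuous_on (realization G) P"
    and inj_spine: "inj_on P (realization C)"
    and inj_fragment: "\<And>A. A \<in> fragments G C \<Longrightarrow> inj_on P A"
    and enclosed: "\<And>A. A \<in> fragments G C \<Longrightarrow> P ` (A - realization C) \<subseteq> inside (P ` realization C)"
begin

lemma walk_image_arc:
  assumes "distinct us" "2 \<le> length us" "walk_points us \<subseteq> realization G" "inj_on P (walk_points us)"
  obtains g where "arc g" "pathstart g = P (vpoint (hd us))" "pathfinish g = P (vpoint (last us))"
    "path_image g = P ` walk_points us"
proof -
  obtain g where g: "arc g" "pathstart g = vpoint (hd us)" "pathfinish g = vpoint (last us)"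
    "path_image g = walk_points us" using walk_arc[OF assms(1,2)] by blast
  show ?thesis
  proof (rule that[of "P \<circ> g"])
    show "arc (P \<circ> g)" using g assms continuous_on_subset[OF cont] by (auto intro!: arc_compose_inj)
  qed (use g in \<open>auto simp: pathstart_compose pathfinish_compose path_image_compose\<close>)
qed

lemma spine_walk_arc:
  assumes "distinct us" "2 \<le> length us" "walk_points us \<subseteq> realization C"
  obtains g where "arc g" "pathstart g = P (vpoint (hd us))" "pathfinish g = P (vpoint (last us))"
    "path_image g = P ` walk_points us"
  using walk_image_arc[OF assms(1,2)] assms spine_subset inj_on_subset[OF inj_spine] by blast

lemma spine_split:
  assumes "vs = xs @ a # ys @ b # zs"
  shows "realization C = walk_points (a # ys @ [b]) \<union> walk_points (b # zs @ xs @ [a])"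
proof -
  have "realization C = walk_points (vs @ [hd vs])" using realization_cycle_graph vs by blast
  also have "\<dots> = walk_points ((a # ys @ b # zs @ xs) @ [a])"
  proof (cases "xs = []")
    case False
    then show ?thesis using walk_points_rotate[of xs "a # ys @ b # zs"] assms by simp
  qed (use assms in simp)
  also have "\<dots> = walk_points (a # ys @ [b]) \<union> walk_points (b # zs @ xs @ [a])"
    using walk_points_append[of "a # ys" b "zs @ xs @ [a]"] by simp
  finally show ?thesis .
qed

text \<open>The image of the walk is a crosscut of the Jordan curve drawn by the spine, and \<open>p\<close> and \<open>q\<close> lie
  on different arcs between its ends.  The fragments \<open>A\<close> and \<open>B\<close> may coincide; then the common point
  of the images is a self-crossing.\<close>

lemma interleaved_pieces_meet:
  assumes dec: "vs = xs @ a # ys @ b # zs" "p \<in> set ys" "q \<in> set (zs @ xs)"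
    and us: "distinct us" "2 \<le> length us" "hd us = a" "last us = b"
    and A: "A \<in> fragments G C" "walk_points us \<subseteq> A" "walk_points us \<inter> realization C \<subseteq> {vpoint a, vpoint b}"
    and B: "B \<in> fragments G C" "connected T" "T \<subseteq> B" "T \<inter> realization C = {}"
      "P (vpoint p) \<in> closure (P ` T)" "P (vpoint q) \<in> closure (P ` T)"
  obtains x y where "x \<in> walk_points us" "x \<notin> realization C" "y \<in> T" "P x = P y"
proof -
  let ?u1 = "a # ys @ [b]" and ?u2 = "a # rev xs @ rev zs @ [b]"
  have sp: "realization C = walk_points ?u1 \<union> walk_points ?u2"
    using spine_split[OF dec(1)] walk_points_rev[of "b # zs @ xs @ [a]"] by simp
  have d: "distinct ?u1" "distinct ?u2" using vs dec by auto
  obtain g1 where g1: "arc g1" "pathstart g1 = P (vpoint a)" "pathfinish g1 = P (vpoint b)"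
    "path_image g1 = P ` walk_points ?u1"
    using spine_walk_arc[OF d(1)] sp by auto
  obtain g2 where g2: "arc g2" "pathstart g2 = P (vpoint a)" "pathfinish g2 = P (vpoint b)"
    "path_image g2 = P ` walk_points ?u2"
    using spine_walk_arc[OF d(2)] sp by auto
  obtain g where g: "arc g" "pathstart g = P (vpoint a)" "pathfinish g = P (vpoint b)"
    "path_image g = P ` walk_points us"
    using walk_image_arc[OF us(1,2)] A fragment_subset_realization[OF G A(1)]
      inj_on_subset[OF inj_fragment[OF A(1)] A(2)] us by (metis subset_trans)
  have J: "path_image g1 \<union> path_image g2 = P ` realization C" using g1 g2 sp by auto
  have ints: "walk_points ?u1 \<inter> walk_points ?u2 = {vpoint a, vpoint b}"
  proof
    show "walk_points ?u1 \<inter> walk_points ?u2 \<subseteq> {vpoint a, vpoint b}"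
    proof
      fix x assume x: "x \<in> walk_points ?u1 \<inter> walk_points ?u2"
      have "set ?u1 \<inter> set ?u2 \<subseteq> {a, b}" using vs dec by auto
      then have "weight_support x \<subseteq> {a, b}"
        using x walk_points_support[of x ?u1] walk_points_support[of x ?u2] by blast
      then show "x \<in> {vpoint a, vpoint b}"
        using walk_points_end_support[OF d(1)] x dec by fastforce
    qed
    show "{vpoint a, vpoint b} \<subseteq> walk_points ?u1 \<inter> walk_points ?u2"
      using walk_points_ends[of ?u1] walk_points_ends[of ?u2] by auto
  qed
  have c12: "path_image g1 \<inter> path_image g2 = {P (vpoint a), P (vpoint b)}"
    using inj_on_image_Int[OF inj_spine, of "walk_points ?u1" "walk_points ?u2"] sp g1 g2 ints by auto
  have cut: "path_image g - {P (vpoint a), P (vpoint b)} \<subseteq> inside (path_image g1 \<union> path_image g2)"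
    unfolding J using enclosed[OF A(1)] A g by blast
  have contT: "continuous_on T P"
    using fragment_subset_realization[OF G B(1)] B continuous_on_subset[OF cont] by blast
  have S: "connected (P ` T)" "P ` T \<subseteq> inside (path_image g1 \<union> path_image g2)"
    unfolding J using connected_continuous_image[OF contT B(2)] enclosed[OF B(1)] B by blast+
  have mem: "vpoint v \<in> realization C" if "v \<in> set vs" for v
    using that vs by (auto simp: cycle_graph_def)
  have pq: "P (vpoint p) \<in> path_image g1" "P (vpoint q) \<in> path_image g2"
  proof -
    have "p \<in> set vs" "q \<in> set vs" using dec by auto
    then have "vpoint p \<in> realization C" "vpoint q \<in> realization C" using mem by auto
    moreover have "vpoint p \<notin> walk_points ?u2" "vpoint q \<notin> walk_points ?u1"
      using walk_points_support[of "vpoint p" ?u2] walk_points_support[of "vpoint q" ?u1] vs dec by auto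
    ultimately show "P (vpoint p) \<in> path_image g1" "P (vpoint q) \<in> path_image g2"
      using sp g1 g2 by auto
  qed
  have ne: "P (vpoint v) \<noteq> P (vpoint w)" if "v \<in> set vs" "w \<in> set vs" "v \<noteq> w" for v w
    using inj_onD[OF inj_spine, of "vpoint v" "vpoint w"] mem that by auto
  have ne': "P (vpoint p) \<noteq> P (vpoint a)" "P (vpoint p) \<noteq> P (vpoint b)"
    "P (vpoint q) \<noteq> P (vpoint a)" "P (vpoint q) \<noteq> P (vpoint b)"
    by (rule ne; use vs(1) dec in auto)+
  have "P ` T \<inter> path_image g \<noteq> {}"
    by (rule crosscut_meets_connected[OF g1(1) g2(1) g(1) g1(2,3) g2(2,3) g(2,3) c12 cut S
         B(5) pq(1) ne'(1,2) B(6) pq(2) ne'(3,4)])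
  then obtain z where "z \<in> P ` T" "z \<in> P ` walk_points us" using g by auto
  then obtain x y where xy: "x \<in> walk_points us" "y \<in> T" "P x = P y" by (metis imageE)
  moreover have "P y \<in> inside (P ` realization C)" using enclosed[OF B(1)] xy B by blast
  then have "x \<notin> realization C" using xy inside_no_overlap[of "P ` realization C"] by (metis disjoint_iff imageI)
  ultimately show ?thesis using that by blast
qed

text \<open>Together with a vertex outside the spine, two disjoint bridges attached to the same three spine
  vertices would give a planar drawing of \<open>K 3 3\<close>.\<close>

lemma tripod_pieces_meet:
  assumes dec: "vs = xs @ a # ys @ b # zs @ c # ws"
    and u: "u \<notin> set vs" "\<And>v. v \<in> {a, b, c} \<Longrightarrow> {u, v} \<in> edges G"
    and A: "A \<in> fragments G C" "\<And>v. v \<in> {a, b, c} \<Longrightarrow> epoint u v ` {0..1} \<subseteq> A"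
    and B: "B \<in> fragments G C" "connected T" "T \<subseteq> B" "T \<inter> realization C = {}"
      "\<And>v. v \<in> {a, b, c} \<Longrightarrow> P (vpoint v) \<in> closure (P ` T)"
  obtains x y v where "v \<in> {a, b, c}" "x \<in> epoint u v ` {0..1}" "x \<notin> realization C" "y \<in> T" "P x = P y"
proof -
  let ?u1 = "a # ys @ [b]" and ?u2 = "a # rev xs @ rev ws @ [c]" and ?u3 = "b # zs @ [c]"
  have sp: "realization C = walk_points ?u1 \<union> walk_points ?u2 \<union> walk_points ?u3"
    using spine_split[of xs a ys b "zs @ c # ws"] dec walk_points_rev[of "c # ws @ xs @ [a]"]
      walk_points_append[of "b # zs" c "ws @ xs @ [a]"] by auto
  have d: "distinct ?u1" "distinct ?u2" "distinct ?u3" using vs dec by auto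
  obtain g1 where g1: "arc g1" "pathstart g1 = P (vpoint a)" "pathfinish g1 = P (vpoint b)"
    "path_image g1 = P ` walk_points ?u1"
    using spine_walk_arc[OF d(1)] sp by auto
  obtain g2 where g2: "arc g2" "pathstart g2 = P (vpoint a)" "pathfinish g2 = P (vpoint c)"
    "path_image g2 = P ` walk_points ?u2"
    using spine_walk_arc[OF d(2)] sp by auto
  obtain g3 where g3: "arc g3" "pathstart g3 = P (vpoint b)" "pathfinish g3 = P (vpoint c)"
    "path_image g3 = P ` walk_points ?u3"
    using spine_walk_arc[OF d(3)] sp by auto
  have leg: "arc (P \<circ> epoint u v)" "pathstart (P \<circ> epoint u v) = P (vpoint u)"
      "pathfinish (P \<circ> epoint u v) = P (vpoint v)" "path_image (P \<circ> epoint u v) = P ` epoint u v ` {0..1}"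
    if "v \<in> {a, b, c}" for v
  proof -
    have "u \<noteq> v" using u that dec by auto
    moreover have "epoint u v ` {0..1} \<subseteq> realization G"
      using A fragment_subset_realization[OF G A(1)] that by blast
    ultimately show "arc (P \<circ> epoint u v)"
      using A that continuous_on_subset[OF cont] inj_on_subset[OF inj_fragment[OF A(1)]]
      by (intro arc_compose_inj arc_epoint) (auto simp: path_image_def)
  qed (auto simp: pathstart_def pathfinish_def path_image_def)
  have int_sp: "P ` walk_points us \<inter> P ` walk_points us' = {P (vpoint v)}"
    if "walk_points us \<subseteq> realization C" "walk_points us' \<subseteq> realization C" "set us \<inter> set us' \<subseteq> {v}"
      "distinct us" "vpoint v \<in> walk_points us" "vpoint v \<in> walk_points us'" for us us' v
  proof -
    have "walk_points us \<inter> walk_points us' = {vpoint v}"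
    proof (intro equalityI subsetI)
      fix x assume x: "x \<in> walk_points us \<inter> walk_points us'"
      then have "weight_support x \<subseteq> {v}"
        using walk_points_support[of x us] walk_points_support[of x us'] that(3) by blast
      then show "x \<in> {vpoint v}" using walk_points_single_support[of x us v] x that by auto
    qed (use that in auto)
    then show ?thesis using inj_on_image_Int[OF inj_spine that(1,2)] by simp
  qed
  have i12: "path_image g1 \<inter> path_image g2 = {P (vpoint a)}"
    unfolding g1 g2 using sp d walk_points_ends[of ?u1] walk_points_ends[of ?u2] vs dec by (intro int_sp) auto
  have i13: "path_image g1 \<inter> path_image g3 = {P (vpoint b)}"
    unfolding g1 g3 using sp d walk_points_ends[of ?u1] walk_points_ends[of ?u3] vs dec by (intro int_sp) auto
  have i23: "path_image g2 \<inter> path_image g3 = {P (vpoint c)}"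
    unfolding g2 g3 using sp d walk_points_ends[of ?u2] walk_points_ends[of ?u3] vs dec by (intro int_sp) auto
  have il: "path_image (P \<circ> epoint u v) \<inter> path_image (P \<circ> epoint u w) = {P (vpoint u)}"
    if vw: "v \<in> {a, b, c}" "w \<in> {a, b, c}" "v \<noteq> w" for v w
  proof -
    have "u \<noteq> v" "u \<noteq> w" using u dec vw by auto
    have "epoint u v ` {0..1} \<inter> epoint u w ` {0..1} = {vpoint u}"
    proof (intro equalityI subsetI)
      fix x assume "x \<in> epoint u v ` {0..1} \<inter> epoint u w ` {0..1}"
      then obtain s t where st: "x = epoint u v s" "x = epoint u w t" by blast
      then have "s = x v" using \<open>u \<noteq> v\<close> by simp
      also have "\<dots> = 0" using st(2) vw(3) \<open>u \<noteq> v\<close> by simp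
      finally show "x \<in> {vpoint u}" using st by simp
    next
      fix x assume "x \<in> {vpoint u}"
      then show "x \<in> epoint u v ` {0..1} \<inter> epoint u w ` {0..1}"
        by (auto intro!: image_eqI[of _ _ 0])
    qed
    then show ?thesis using inj_on_image_Int[OF inj_fragment[OF A(1)] A(2)[OF vw(1)] A(2)[OF vw(2)]] leg vw
      by simp
  qed
  have J: "P ` realization C = path_image g1 \<union> path_image g2 \<union> path_image g3" using g1 g2 g3 sp by auto
  have legs: "path_image (P \<circ> epoint u v) - {P (vpoint v)} \<subseteq> inside (P ` realization C)"
    if "v \<in> {a, b, c}" for v
  proof -
    have "epoint u v t \<in> A - realization C" if t: "t \<in> {0..1}" "t \<noteq> 1" for t
    proof -
      have uv: "u \<noteq> v" "u \<notin> verts C" using u dec \<open>v \<in> {a, b, c}\<close> vs by (auto simp: cycle_graph_def)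
      have "epoint u v t \<notin> realization C"
      proof (cases "t = 0")
        case True
        then show ?thesis using uv realization_subgraph_iff(1)[OF G C] by simp
      next
        case False
        then have "epoint u v t \<in> open_edge {u, v}" using uv t by (auto simp: open_edge_pair)
        moreover have "{u, v} \<notin> edges C" using edges_C_subset[of "{u, v}"] uv(2) by auto
        ultimately show ?thesis using realization_subgraph_iff(2)[OF G C] u \<open>v \<in> {a, b, c}\<close> by blast
      qed
      then show ?thesis using A(2)[OF \<open>v \<in> {a, b, c}\<close>] t by auto
    qed
    moreover have "epoint u v t \<in> {epoint u v 1}" if "t = 1" for t using that by simp
    ultimately have "epoint u v ` {0..1} - {vpoint v} \<subseteq> A - realization C" by fastforce
    then have "P ` (epoint u v ` {0..1} - {vpoint v}) \<subseteq> inside (P ` realization C)"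
      using enclosed[OF A(1)] by (meson image_mono subset_trans)
    moreover have "P ` epoint u v ` {0..1} - {P (vpoint v)} \<subseteq> P ` (epoint u v ` {0..1} - {vpoint v})"
      using image_diff_subset[of P _ "{vpoint v}"] by simp
    ultimately show ?thesis unfolding leg(4)[OF that] by (rule subset_trans[rotated])
  qed
  have contT: "continuous_on T P"
    using fragment_subset_realization[OF G B(1)] B continuous_on_subset[OF cont] by blast
  have S: "connected (P ` T)" "P ` T \<subseteq> inside (P ` realization C)"
    using connected_continuous_image[OF contT B(2)] enclosed[OF B(1)] B by blast+
  have abc: "a \<in> {a, b, c}" "b \<in> {a, b, c}" "c \<in> {a, b, c}" "a \<noteq> b" "a \<noteq> c" "b \<noteq> c"
    using vs dec by auto
  have "P ` T \<inter> (path_image (P \<circ> epoint u a) \<union> path_image (P \<circ> epoint u b) \<union> path_image (P \<circ> epoint u c)) \<noteq> {}"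
    using tripod_meets_connected[OF g1(1) g2(1) g3(1) leg(1)[OF abc(1)] leg(1)[OF abc(2)] leg(1)[OF abc(3)]
      g1(2,3) g2(2,3) g3(2,3) leg(2,3)[OF abc(1)] leg(2,3)[OF abc(2)] leg(2,3)[OF abc(3)]
      i12 i13 i23 il[OF abc(1,2,4)] il[OF abc(1,3,5)] il[OF abc(2,3,6)] J
      legs[OF abc(1)] legs[OF abc(2)] legs[OF abc(3)] S B(5)[OF abc(1)] B(5)[OF abc(2)] B(5)[OF abc(3)]] .
  then obtain z where "z \<in> P ` T" "z \<in> path_image (P \<circ> epoint u a) \<or> z \<in> path_image (P \<circ> epoint u b) \<or> z \<in> path_image (P \<circ> epoint u c)"
    by auto
  then obtain v where v: "v \<in> {a, b, c}" "z \<in> path_image (P \<circ> epoint u v)" and z: "z \<in> P ` T" by auto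
  then obtain x y where xy: "v \<in> {a, b, c}" "x \<in> epoint u v ` {0..1}" "y \<in> T" "P x = P y"
    unfolding leg(4)[OF v(1)] by blast
  moreover have "P y \<in> inside (P ` realization C)" using S xy by blast
  then have "x \<notin> realization C" using xy inside_no_overlap[of "P ` realization C"] by (metis disjoint_iff imageI)
  ultimately show ?thesis using that by blast
qed

end

section \<open>Noncrossing chords\<close>

text \<open>The elements of \<open>V\<close> are the corners of a polygon, and the parity condition says that a chord
  cuts off an even number of them.  A chord with the fewest corners strictly between its ends shields
  them from all other chords.  Deleting the chord with these corners, of which there are at least
  two, keeps all parities and the chords nondegenerate.  Corners are an arbitrary finite set rather
  than an interval so that this step needs no renumbering.\<close>

lemma card_noncrossing_chords:
  fixes V :: "nat set"
  assumes "finite V" "2 \<le> card V" "finite S"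
    and "\<And>a b. (a, b) \<in> S \<Longrightarrow> a \<in> V \<and> b \<in> V \<and> a < b \<and>
      even (card (V \<inter> {a<..<b})) \<and> V \<inter> {a<..<b} \<noteq> {}"
    and "\<And>a b c d. (a, b) \<in> S \<Longrightarrow> (c, d) \<in> S \<Longrightarrow> \<not> (a < c \<and> c < b \<and> b < d)"
  shows "2 * card S + 2 \<le> card V"
  using assms
proof (induction "card S" arbitrary: S V)
  case 0
  then show ?case by simp
next
  case (Suc k)
  note chord = Suc.prems(4) and nc = Suc.prems(5) and fin = Suc.prems(1)
  define w where "w = (\<lambda>(a, b). card (V \<inter> {a<..<b}))"
  have "S \<noteq> {}" using Suc.hyps(2) by auto
  then obtain s where s: "s \<in> S" "\<And>t. t \<in> S \<Longrightarrow> w s \<le> w t"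
    using ex_min_if_finite[OF finite_imageI[OF Suc.prems(3), of w]] by (force simp: not_less)
  obtain a b where ab: "s = (a, b)" by (cases s)
  define M where "M = V \<inter> {a<..<b}"
  have abS: "(a, b) \<in> S" using s ab by simp
  have least: "card M \<le> card (V \<inter> {c<..<d})" if "(c, d) \<in> S" for c d
    using s(2)[OF that] by (simp add: ab w_def M_def)
  have avoid: "c \<notin> M \<and> d \<notin> M" if cd: "(c, d) \<in> S" "(c, d) \<noteq> (a, b)" for c d
  proof -
    have c: "c \<in> V" "d \<in> V" "c < d" using chord[OF cd(1)] by auto
    have cM: "c \<notin> M"
    proof
      assume "c \<in> M"
      then have "a < c" "c < b" by (auto simp: M_def)
      then have "d \<le> b" using nc[OF abS cd(1)] by auto
      then have "V \<inter> {c<..<d} \<subset> M" using \<open>c \<in> M\<close> \<open>a < c\<close> by (auto simp: M_def)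
      then have "card (V \<inter> {c<..<d}) < card M" using fin by (intro psubset_card_mono) (auto simp: M_def)
      then show False using least[OF cd(1)] by simp
    qed
    moreover have "d \<notin> M"
    proof
      assume "d \<in> M"
      then have d: "a < d" "d < b" by (auto simp: M_def)
      then have "c \<le> a" using cM c by (auto simp: M_def)
      then have "c = a" using nc[OF cd(1) abS] d by auto
      then have "V \<inter> {c<..<d} \<subset> M" using \<open>d \<in> M\<close> by (auto simp: M_def)
      then have "card (V \<inter> {c<..<d}) < card M" using fin by (intro psubset_card_mono) (auto simp: M_def)
      then show False using least[OF cd(1)] by simp
    qed
    ultimately show ?thesis by simp
  qed
  have abV: "a \<in> V" "b \<in> V" "a < b" "even (card M)" "M \<noteq> {}" "finite M" "M \<subseteq> V"
    using chord[OF abS] fin by (auto simp: M_def)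
  then have "card M \<noteq> 0" by simp
  then have "2 \<le> card M" using abV(4) by presburger
  have "2 * card (S - {(a, b)}) + 2 \<le> card (V - M)"
  proof (rule Suc.hyps(1))
    show "k = card (S - {(a, b)})" using Suc.hyps(2) abS Suc.prems(3) by simp
    have "{a, b} \<subseteq> V - M" using abV by (auto simp: M_def)
    then have "card {a, b} \<le> card (V - M)" using fin by (intro card_mono) auto
    then show "2 \<le> card (V - M)" using abV by simp
  next
    fix c d assume "(c, d) \<in> S - {(a, b)}"
    then have cd: "(c, d) \<in> S" "(c, d) \<noteq> (a, b)" by auto
    note c = chord[OF cd(1)] and av = avoid[OF cd]
    have split: "M \<subseteq> V \<inter> {c<..<d} \<and> c \<le> a \<and> b \<le> d \<or> M \<inter> {c<..<d} = {}"
    proof (cases "M \<inter> {c<..<d} = {}")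
      case False
      then obtain x where "x \<in> M" "c < x" "x < d" by auto
      then have "c \<le> a" "b \<le> d" using av c by (auto simp: M_def)
      then show ?thesis by (auto simp: M_def)
    qed simp
    have eq: "(V - M) \<inter> {c<..<d} = V \<inter> {c<..<d} - M" by blast
    have "even (card ((V - M) \<inter> {c<..<d}))"
      using split
    proof
      assume "M \<subseteq> V \<inter> {c<..<d} \<and> c \<le> a \<and> b \<le> d"
      then have "card (V \<inter> {c<..<d} - M) = card (V \<inter> {c<..<d}) - card M"
        using abV by (intro card_Diff_subset) auto
      then show ?thesis using c abV eq by simp
    next
      assume "M \<inter> {c<..<d} = {}"
      then have "V \<inter> {c<..<d} - M = V \<inter> {c<..<d}" by auto
      then show ?thesis using c eq by simp
    qed
    moreover have "(V - M) \<inter> {c<..<d} \<noteq> {}"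
      using split
    proof
      assume l: "M \<subseteq> V \<inter> {c<..<d} \<and> c \<le> a \<and> b \<le> d"
      then have "c < a \<or> b < d" using cd by auto
      then have "a \<in> (V - M) \<inter> {c<..<d} \<or> b \<in> (V - M) \<inter> {c<..<d}" using l abV by (auto simp: M_def)
      then show ?thesis by blast
    next
      assume "M \<inter> {c<..<d} = {}"
      then show ?thesis using c eq by auto
    qed
    ultimately show "c \<in> V - M \<and> d \<in> V - M \<and> c < d \<and> even (card ((V - M) \<inter> {c<..<d})) \<and>
      (V - M) \<inter> {c<..<d} \<noteq> {}" using c av by simp
  next
    fix c d c' d' assume "(c, d) \<in> S - {(a, b)}" "(c', d') \<in> S - {(a, b)}"
    then show "\<not> (c < c' \<and> c' < d \<and> d < d')" using nc[of c d c' d'] by simp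
  qed (use Suc.prems in auto)
  moreover have "card S = Suc (card (S - {(a, b)}))" using Suc.prems(3) abS by (metis card_Suc_Diff1)
  moreover have "card (V - M) = card V - card M" using abV by (intro card_Diff_subset) auto
  moreover have "card M \<le> card V" using abV fin by (intro card_mono) auto
  ultimately show ?case using \<open>2 \<le> card M\<close> by simp
qed

lemma list_split2:
  assumes "i < j" "j < length vs"
  shows "vs = take i vs @ vs ! i # take (j - Suc i) (drop (Suc i) vs) @ vs ! j # drop (Suc j) vs"
proof -
  have "drop (Suc i) vs = take (j - Suc i) (drop (Suc i) vs) @ drop j vs"
    using append_take_drop_id[of "j - Suc i" "drop (Suc i) vs"] assms by simp
  also have "drop j vs = vs ! j # drop (Suc j) vs" using assms by (simp add: Cons_nth_drop_Suc)
  finally have "drop i vs = vs ! i # take (j - Suc i) (drop (Suc i) vs) @ vs ! j # drop (Suc j) vs"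
    using assms Cons_nth_drop_Suc[of i vs] by simp
  then show ?thesis by (metis append_take_drop_id)
qed

lemma nth_mem_take_drop:
  assumes "i < k" "k < j" "j < length vs"
  shows "vs ! k \<in> set (take (j - Suc i) (drop (Suc i) vs))"
proof -
  have "take (j - Suc i) (drop (Suc i) vs) ! (k - Suc i) = vs ! k" using assms by simp
  moreover have "k - Suc i < length (take (j - Suc i) (drop (Suc i) vs))" using assms by auto
  ultimately show ?thesis by (metis nth_mem)
qed

lemma nth_mem_outer:
  assumes "l < i \<or> j < l" "i < j" "j < length vs" "l < length vs"
  shows "vs ! l \<in> set (drop (Suc j) vs @ take i vs)"
  using assms(1)
proof
  assume "l < i"
  then have "take i vs ! l = vs ! l" "l < length (take i vs)" using assms by auto
  then show ?thesis by (metis UnCI nth_mem set_append)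
next
  assume "j < l"
  then have "drop (Suc j) vs ! (l - Suc j) = vs ! l" "l - Suc j < length (drop (Suc j) vs)"
    using assms by auto
  then show ?thesis by (metis UnCI nth_mem set_append)
qed

section \<open>Relations between fragments and the spine\<close>

text \<open>A component is relatively closed, so taking the closure adds only points of the spine.\<close>

lemma component_closure_off_spine:
  assumes "K \<in> components (realization G - realization C)"
  shows "(realization G - realization C) \<inter> closure K = K"
proof -
  let ?S = "realization G - realization C"
  have "closedin (top_of_set ?S) K" using assms by (simp add: closedin_component)
  then obtain T where "closed T" "K = ?S \<inter> T" by (auto simp: closedin_closed)
  then have "?S \<inter> closure K \<subseteq> K" using closure_minimal[of K T] by blast
  moreover have "K \<subseteq> ?S \<inter> closure K" using closure_subset in_components_subset[OF assms] by blast
  ultimately show ?thesis by blast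
qed

lemma fragment_eq_closure_component:
  assumes "A \<in> fragments G C" "x \<in> A" "x \<in> realization G" "x \<notin> realization C"
  shows "A = closure (connected_component_set (realization G - realization C) x)"
proof -
  let ?S = "realization G - realization C"
  obtain K where K: "K \<in> components ?S" "A = closure K" using assms by (auto simp: fragments_def)
  then have "x \<in> K" using assms component_closure_off_spine[OF K(1)] by blast
  moreover obtain y where "K = connected_component_set ?S y" using K(1) by (auto simp: components_def)
  ultimately have "K = connected_component_set ?S x" using connected_component_eq[of x ?S y] by simp
  then show ?thesis using K(2) by simp
qed

lemma fragments_inter:
  fixes G :: "'a::countable graph"
  assumes "simple_graph G" "A \<in> fragments G C" "B \<in> fragments G C" "x \<in> A" "x \<in> B" "x \<notin> realization C"
  shows "A = B"
  using fragment_eq_closure_component[OF assms(2,4) _ assms(6)] fragment_eq_closure_component[OF assms(3,5) _ assms(6)]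
    fragment_subset_realization[OF assms(1,2)] assms(4) by auto

lemma connected_in_fragment:
  assumes "connected T" "T \<noteq> {}" "T \<subseteq> realization G - realization C"
  obtains A where "A \<in> fragments G C" "closure T \<subseteq> A"
proof -
  obtain x where "x \<in> T" using assms by blast
  then have "T \<subseteq> connected_component_set (realization G - realization C) x"
    using assms by (intro connected_component_maximal) auto
  moreover have "connected_component_set (realization G - realization C) x \<in> components (realization G - realization C)"
    using \<open>x \<in> T\<close> assms by (auto simp: components_def)
  ultimately show ?thesis
    using that[of "closure (connected_component_set (realization G - realization C) x)"]
    by (auto simp: fragments_def closure_mono)
qed

context spined_graph
begin

lemma open_star_subset: "u \<notin> set vs \<Longrightarrow> open_star G u \<subseteq> realization G - realization C"
proof
  fix x assume u: "u \<notin> set vs" and x: "x \<in> open_star G u"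
  then have xG: "x \<in> realization G" "x u \<noteq> 0" by (auto simp: open_star_def)
  have "x \<notin> realization C"
    using xG(1)
  proof (cases rule: realization_cases)
    case (1 v)
    then show ?thesis using u xG(2) realization_subgraph_iff(1)[OF G C] verts_C
      by (auto simp: vpoint_def split: if_splits)
  next
    case (2 e)
    then have "u \<in> e" using xG(2) by (auto simp: open_edge_def weight_support_def)
    then show ?thesis using 2 realization_subgraph_iff(2)[OF G C] edges_C_subset u verts_C by blast
  qed
  then show "x \<in> realization G - realization C" using xG by simp
qed

lemma open_edge_subset: "e \<in> edges G - edges C \<Longrightarrow> open_edge e \<subseteq> realization G - realization C"
  using open_edge_subset_realization[of e G] realization_subgraph_iff(2)[OF G C, of e] by auto

lemma closed_edge_subset_closure:
  assumes "{a, b} \<in> edges G"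
  shows "epoint a b ` {0..1} \<subseteq> closure (open_edge {a, b})"
proof -
  have "a \<noteq> b" using edge_ends[OF assms] by simp
  moreover have "path (epoint a b)" by (simp add: path_def continuous_on_epoint)
  ultimately show ?thesis
    using path_subset_closure_inner[of "epoint a b"] by (auto simp: open_edge_pair)
qed

lemma open_edge_subset_star: "{u, b} \<in> edges G \<Longrightarrow> open_edge {u, b} \<subseteq> open_star G u"
  using open_edge_subset_realization[of "{u, b}" G]
  by (auto simp: open_star_def open_edge_def weight_support_def)

end

context enclosed_drawing
begin

lemma end_in_closure_image:
  assumes "{a, b} \<in> edges G" "open_edge {a, b} \<subseteq> T" "v \<in> {a, b}"
  shows "P (vpoint v) \<in> closure (P ` T)"
proof -
  note e = edge_ends[OF assms(1)]
  have "epoint a b ` {0..1} \<subseteq> realization G"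
    using closed_edge_subset_realization[OF assms(1)] e by auto
  then have "path (P \<circ> epoint a b)"
    unfolding path_def by (intro continuous_on_compose continuous_on_epoint continuous_on_subset[OF cont])
  then have "(P \<circ> epoint a b) t \<in> closure ((P \<circ> epoint a b) ` {0<..<1})" if "t \<in> {0..1}" for t
    using path_subset_closure_inner that by blast
  moreover have "(P \<circ> epoint a b) ` {0<..<1} \<subseteq> P ` T"
    using assms(2) e by (auto simp: open_edge_pair)
  ultimately have "(P \<circ> epoint a b) t \<in> closure (P ` T)" if "t \<in> {0..1}" for t
    using that closure_mono by blast
  from this[of 0] this[of 1] show ?thesis using assms(3) by auto
qed

lemma interleaved_indices_meet:
  assumes ij: "i < j" "j < length vs" "i < k" "k < j" "l < i \<or> j < l" "l < length vs"
    and us: "distinct us" "2 \<le> length us" "hd us = vs ! i" "last us = vs ! j"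
    and A: "A \<in> fragments G C" "walk_points us \<subseteq> A"
      "walk_points us \<inter> realization C \<subseteq> {vpoint (vs ! i), vpoint (vs ! j)}"
    and B: "B \<in> fragments G C" "connected T" "T \<subseteq> B" "T \<inter> realization C = {}"
      "P (vpoint (vs ! k)) \<in> closure (P ` T)" "P (vpoint (vs ! l)) \<in> closure (P ` T)"
  obtains x y where "x \<in> walk_points us" "x \<notin> realization C" "y \<in> T" "P x = P y"
  using interleaved_pieces_meet[OF list_split2[OF ij(1,2)] nth_mem_take_drop[OF ij(3,4,2)]
    nth_mem_outer[OF ij(5,1,2,6)] us A B] .

end

section \<open>From leveled embeddings to planar drawings\<close>

lemma inj_on_stereographic: "inj_on stereographic (S3 - {(0, 1)})"
  and continuous_on_stereographic: "continuous_on (S3 - {(0, 1)}) stereographic"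
proof -
  have S3: "norm p ^ 2 + t ^ 2 = 1" if "(p, t) \<in> S3" for p :: space3 and t
    using that by (simp add: norm_prod_def)
  have ne: "t \<noteq> 1" if "(p, t) \<in> S3 - {(0, 1)}" for p :: space3 and t
    using S3[of p t] that by auto
  show "inj_on stereographic (S3 - {(0, 1)})"
  proof (rule inj_onI)
    fix x y assume xy: "x \<in> S3 - {(0, 1)}" "y \<in> S3 - {(0, 1)}" "stereographic x = stereographic y"
    obtain p s q t where pq: "x = (p, s)" "y = (q, t)" by (cases x, cases y)
    have st: "s \<noteq> 1" "t \<noteq> 1" using ne xy(1,2) unfolding pq by blast+
    have e: "p /\<^sub>R (1 - s) = q /\<^sub>R (1 - t)" using xy(3) by (simp add: stereographic_def pq)
    then have "norm (p /\<^sub>R (1 - s)) ^ 2 = norm (q /\<^sub>R (1 - t)) ^ 2" by simp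
    \<comment> \<open>The norm of the image determines the last coordinate.\<close>
    then have "norm p ^ 2 / (1 - s) ^ 2 = norm q ^ 2 / (1 - t) ^ 2"
      by (simp add: power_mult_distrib divide_inverse power_inverse mult.commute)
    moreover have "norm p ^ 2 = 1 - s ^ 2" "norm q ^ 2 = 1 - t ^ 2"
      using S3[of p s] S3[of q t] xy(1,2) unfolding pq by auto
    then have "norm p ^ 2 = (1 - s) * (1 + s)" "norm q ^ 2 = (1 - t) * (1 + t)"
      by (simp_all add: algebra_simps power2_eq_square)
    ultimately have "(1 + s) / (1 - s) = (1 + t) / (1 - t)"
      using st by (simp add: power2_eq_square)
    then have "s = t" using st by (simp add: field_simps)
    then show "x = y" using e st pq by simp
  qed
  have "continuous_on (S3 - {(0, 1)}) (\<lambda>x. fst x /\<^sub>R (1 - snd x))"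
    by (intro continuous_intros) (use ne in fastforce)
  then show "continuous_on (S3 - {(0, 1)}) stereographic"
    by (simp add: stereographic_def case_prod_beta')
qed

text \<open>The isotopy ends in a homeomorphism of the sphere, so the diagram still comes from a continuous
  injective map into space.  Injectivity is what separates the heights of distinct points with the
  same projection.\<close>

lemma leveled_with_drawing:
  fixes G :: "'a::countable graph"
  assumes G: "simple_graph G" and f: "graph_embedding G f" and l: "leveled_with G f C N"
  obtains vs F L where "C = cycle_graph vs" "enclosed_drawing G vs (fst \<circ> F)" "inj_on F (realization G)"
    "level_partition G C F N L"
proof -
  obtain g L where cyc: "is_cycle G C" and iso: "isotopic_embeddings G f g"
    and pole: "(0, 1) \<notin> g ` realization G" and sl: "semi_leveled_diagram G C (stereographic \<circ> g)"
    and sp: "spine_encloses_fragments G C (stereographic \<circ> g)"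
    and L: "level_partition G C (stereographic \<circ> g) N L"
    using l unfolding leveled_with_def by (elim conjE exE) (rule that, assumption+)
  obtain vs where vs: "distinct vs" "3 \<le> length vs" "C = cycle_graph vs"
    and C: "verts C \<subseteq> verts G" "edges C \<subseteq> edges G"
    using cyc by (auto simp: is_cycle_def)
  obtain H where H': "ambient_isotopy H" "\<And>x. x \<in> realization G \<Longrightarrow> H 1 (f x) = g x"
    using iso unfolding isotopic_embeddings_def by blast
  have "(1::real) \<in> {0..1}" by simp
  then obtain k where "homeomorphism S3 S3 (H 1) k"
    using H'(1) unfolding ambient_isotopy_def by blast
  note H = this H'(2)
  obtain k' where k': "homeomorphism (realization G) (f ` realization G) f k'" and fS: "f ` realization G \<subseteq> S3"
    using f unfolding graph_embedding_def by blast
  have Hc: "continuous_on S3 (H 1)" "inj_on (H 1) S3" "H 1 ` S3 = S3"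
    using H(1) by (auto simp: homeomorphism_def intro: inj_on_inverseI)
  have fc: "continuous_on (realization G) f" "inj_on f (realization G)"
    using k' by (auto simp: homeomorphism_def intro: inj_on_inverseI)
  have "continuous_on (realization G) (H 1 \<circ> f)"
    using fc Hc fS by (intro continuous_on_compose) (auto intro: continuous_on_subset)
  then have gc: "continuous_on (realization G) g"
    by (rule continuous_on_eq) (simp add: H)
  have "inj_on (H 1 \<circ> f) (realization G)"
    using fc Hc fS by (intro comp_inj_on) (auto intro: inj_on_subset)
  then have gi: "inj_on g (realization G)" using H(2) by (auto simp: inj_on_def)
  have gS: "g ` realization G \<subseteq> S3 - {(0, 1)}"
  proof
    fix y assume "y \<in> g ` realization G"
    then obtain x where x: "x \<in> realization G" "y = g x" by blast
    then have "y = H 1 (f x)" "f x \<in> S3" using H(2) fS by auto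
    then have "y \<in> S3" using Hc(3) by blast
    moreover have "y \<noteq> (0, 1)" using x pole by blast
    ultimately show "y \<in> S3 - {(0, 1)}" by blast
  qed
  let ?F = "stereographic \<circ> g"
  have Fc: "continuous_on (realization G) ?F"
    using gc gS continuous_on_stereographic by (intro continuous_on_compose) (auto intro: continuous_on_subset)
  have Fi: "inj_on ?F (realization G)"
    using gi gS inj_on_stereographic by (intro comp_inj_on) (auto intro: inj_on_subset)
  have "enclosed_drawing G vs (fst \<circ> ?F)"
    unfolding enclosed_drawing_def enclosed_drawing_axioms_def spined_graph_def vs(3)[symmetric]
  proof (intro conjI allI impI)
    show "continuous_on (realization G) (fst \<circ> ?F)"
      using continuous_on_fst[OF Fc] by (simp add: comp_def)
    show "inj_on (fst \<circ> ?F) (realization C)" using sp by (simp only: spine_encloses_fragments_def)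
    show "inj_on (fst \<circ> ?F) A" if "A \<in> fragments G C" for A
      using sl that unfolding semi_leveled_diagram_def by metis
    show "(fst \<circ> ?F) ` (A - realization C) \<subseteq> inside ((fst \<circ> ?F) ` realization C)"
      if "A \<in> fragments G C" for A
      using sp that unfolding spine_encloses_fragments_def by metis
    show "set vs \<subseteq> verts G" using C(1) vs(3) by (simp add: cycle_graph_def)
  qed (fact G vs C)+
  then show ?thesis using that vs(3) Fi L by blast
qed

text \<open>A fragment crosses over fragments of strictly smaller levels only, and the levels are disjoint.\<close>

lemma level_partition_no_crossing:
  assumes L: "level_partition G C F N L" and i: "i \<in> {1..N}" and A: "A \<in> L i" and B: "B \<in> L i" "A \<noteq> B"
  shows "\<not> crosses_over F A B"
proof
  assume cr: "crosses_over F A B"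
  have part: "(\<Union>i\<in>{1..N}. L i) = fragments G C"
    using L unfolding level_partition_def by (elim conjE) assumption
  have disj: "\<forall>i\<in>{1..N}. \<forall>j\<in>{1..N}. i \<noteq> j \<longrightarrow> L i \<inter> L j = {}"
    using L unfolding level_partition_def by (elim conjE) assumption
  have L1: "L 1 = {A \<in> fragments G C. \<forall>B\<in>fragments G C. B \<noteq> A \<longrightarrow> \<not> crosses_over F A B}"
    using L unfolding level_partition_def by (elim conjE) assumption
  have Li: "\<forall>i\<in>{2..N}. L i = {A \<in> fragments G C.
        (\<exists>B\<in>L (i - 1). B \<noteq> A \<and> crosses_over F A B) \<and>
        (\<forall>B\<in>fragments G C. B \<noteq> A \<and> crosses_over F A B \<longrightarrow> (\<exists>k\<in>{1..<i}. B \<in> L k))}"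
    using L unfolding level_partition_def by (elim conjE) assumption
  have fr: "B \<in> fragments G C" using part i B(1) by blast
  show False
  proof (cases "i = 1")
    case True
    then have "A \<in> L 1" using A by simp
    then show ?thesis using cr fr B(2) unfolding L1 by simp
  next
    case False
    then have "i \<in> {2..N}" using i by auto
    note eq = Li[rule_format, OF this]
    have "\<forall>B\<in>fragments G C. B \<noteq> A \<and> crosses_over F A B \<longrightarrow> (\<exists>k\<in>{1..<i}. B \<in> L k)"
      using A unfolding eq by simp
    then obtain k where k: "k \<in> {1..<i}" "B \<in> L k" using fr cr B(2) by metis
    then have "L i \<inter> L k = {}" using disj[rule_format, of i k] i by auto
    then show ?thesis using k B(1) by blast
  qed
qed

section \<open>Detours through vertices off the spine\<close>

context enclosed_drawing
begin

lemma spine_support: "x \<in> realization C \<Longrightarrow> weight_support x \<subseteq> set vs"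
  using edges_C_subset verts_C
  by (auto simp: realization_def vertex_points_eq edge_points_eq open_edge_def)

lemma detour_walk:
  assumes "u \<notin> set vs" "{u, a} \<in> edges G" "{u, b} \<in> edges G" "a \<noteq> b"
  shows "walk_points [a, u, b] \<subseteq> closure (open_star G u)"
    and "walk_points [a, u, b] \<inter> realization C \<subseteq> {vpoint a, vpoint b}"
proof -
  have e: "{a, u} \<in> edges G" "{u, a} \<in> edges G" using assms by (simp_all add: insert_commute)
  have "epoint a u ` {0..1} \<subseteq> closure (open_star G u)"
    using closed_edge_subset_closure[OF e(1)] closure_mono[OF open_edge_subset_star[OF e(2)]]
    by (simp add: insert_commute)
  moreover have "epoint u b ` {0..1} \<subseteq> closure (open_star G u)"
    using closed_edge_subset_closure[OF assms(3)] closure_mono[OF open_edge_subset_star[OF assms(3)]] by simp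
  ultimately show "walk_points [a, u, b] \<subseteq> closure (open_star G u)"
    by (simp add: walk_points_Cons2)
  show "walk_points [a, u, b] \<inter> realization C \<subseteq> {vpoint a, vpoint b}"
  proof
    fix x assume x: "x \<in> walk_points [a, u, b] \<inter> realization C"
    then have "u \<notin> weight_support x" using spine_support assms by blast
    then have "weight_support x \<subseteq> {a, b}" using x walk_points_support[of x "[a, u, b]"] by auto
    then show "x \<in> {vpoint a, vpoint b}"
      using walk_points_end_support[of a "[u]" b x] x edge_ends[OF assms(2)] edge_ends[OF assms(3)] assms(4)
      by auto
  qed
qed

lemma chord_walk:
  assumes "{a, b} \<in> edges G - edges C"
  shows "walk_points [a, b] \<subseteq> closure (open_edge {a, b})"
    and "walk_points [a, b] \<inter> realization C \<subseteq> {vpoint a, vpoint b}"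
proof -
  show "walk_points [a, b] \<subseteq> closure (open_edge {a, b})"
    using closed_edge_subset_closure[of a b] assms by (simp add: walk_points_Cons2)
  show "walk_points [a, b] \<inter> realization C \<subseteq> {vpoint a, vpoint b}"
  proof
    fix x assume x: "x \<in> walk_points [a, b] \<inter> realization C"
    then obtain t where t: "x = epoint a b t" "t \<in> {0..1}" by (auto simp: walk_points_Cons2)
    have "x \<notin> open_edge {a, b}" using x open_edge_subset[OF assms] by blast
    then have "t = 0 \<or> t = 1"
      using t edge_ends[of a b] assms by (auto simp: open_edge_pair image_iff)
    then show "x \<in> {vpoint a, vpoint b}" using t by auto
  qed
qed

text \<open>The fragment that contains the adjacent vertices \<open>u\<close> and \<open>w\<close> contains a detour through \<open>u\<close>
  between the spine vertices with indices 0 and 2, and the star of \<open>w\<close> reaches those with indices 1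
  and 3.  So the fragment would cross itself.\<close>

lemma no_adjacent_bridges_off_spine:
  assumes "4 \<le> length vs" "u \<notin> set vs" "w \<notin> set vs"
    and e: "{u, w} \<in> edges G" "{u, vs ! 0} \<in> edges G" "{u, vs ! 2} \<in> edges G"
      "{w, vs ! 1} \<in> edges G" "{w, vs ! 3} \<in> edges G"
  shows False
proof -
  have uw: "u \<noteq> w" "u \<in> verts G" "w \<in> verts G" using edge_ends[OF e(1)] by auto
  have "open_edge {u, w} \<subseteq> open_star G u \<inter> open_star G w"
    using open_edge_subset_star[of u w] open_edge_subset_star[of w u] e(1) by (simp add: insert_commute)
  moreover have "open_edge {u, w} \<noteq> {}" using uw by (auto simp: open_edge_pair)
  ultimately have "connected (open_star G u \<union> open_star G w)"
    using connected_open_star[OF G] uw by (intro connected_Un) auto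
  moreover have "vpoint u \<in> open_star G u" using uw by (auto simp: open_star_def)
  ultimately obtain A where A: "A \<in> fragments G C" "closure (open_star G u \<union> open_star G w) \<subseteq> A"
    using connected_in_fragment[of "open_star G u \<union> open_star G w" G C] open_star_subset assms(2,3) by blast
  then have Au: "closure (open_star G u) \<subseteq> A" and Aw: "open_star G w \<subseteq> A"
    using closure_subset by (auto simp: closure_Un)
  have ne: "vs ! 0 \<noteq> vs ! 2" 
  proof -
    have "0 < length vs" "2 < length vs" using assms(1) by linarith+
    then show ?thesis using nth_eq_iff_index_eq[OF vs(1), of 0 2] by simp
  qed
  have uv: "u \<noteq> vs ! 0" "u \<noteq> vs ! 2" using edge_ends e by blast+
  have wv: "w \<noteq> vs ! 0" "w \<noteq> vs ! 2" 
  proof -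
    have "vs ! 0 \<in> set vs" "vs ! 2 \<in> set vs" using assms(1) by (auto intro!: nth_mem)
    then show "w \<noteq> vs ! 0" "w \<noteq> vs ! 2" using assms(3) by metis+
  qed
  note dw = detour_walk[OF assms(2) e(2,3) ne]
  have W: "walk_points [vs ! 0, u, vs ! 2] \<subseteq> A" using dw(1) Au by (rule subset_trans)
  obtain x y where xy: "x \<in> walk_points [vs ! 0, u, vs ! 2]" "x \<notin> realization C" "y \<in> open_star G w" "P x = P y"
  proof (rule interleaved_indices_meet[of 0 2 1 3 "[vs ! 0, u, vs ! 2]" A A "open_star G w"])
    show "P (vpoint (vs ! 1)) \<in> closure (P ` open_star G w)" "P (vpoint (vs ! 3)) \<in> closure (P ` open_star G w)"
      using end_in_closure_image[OF e(4) open_edge_subset_star[OF e(4)]]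
        end_in_closure_image[OF e(5) open_edge_subset_star[OF e(5)]] by auto
    show "walk_points [vs ! 0, u, vs ! 2] \<inter> realization C \<subseteq> {vpoint (vs ! 0), vpoint (vs ! 2)}"
      by (rule dw(2))
    show "open_star G w \<inter> realization C = {}" using open_star_subset[OF assms(3)] by blast
  qed (use assms A W Aw uv ne open_star_subset connected_open_star[OF G] uw in auto)
  have "x \<in> A" "y \<in> A" using xy W Aw by auto
  then have "x = y" using inj_fragment[OF A(1)] xy(4) unfolding inj_on_def by blast
  moreover have "y w \<noteq> 0" using xy(3) by (simp add: open_star_def)
  moreover have "weight_support x \<subseteq> {vs ! 0, u, vs ! 2}" using walk_points_support[OF xy(1)] by simp
  ultimately show False using uw wv by (auto simp: weight_support_def)
qed

end

section \<open>The number of levels of a complete bipartite graph\<close>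

lemma complete_bipartite_simps:
  "verts (complete_bipartite m n) = Inl ` {..<m} \<union> Inr ` {..<n}"
  "{Inl i, Inr j} \<in> edges (complete_bipartite m n) \<longleftrightarrow> i < m \<and> j < n"
  "{Inr j, Inl i} \<in> edges (complete_bipartite m n) \<longleftrightarrow> i < m \<and> j < n"
  by (auto simp: complete_bipartite_def Plus_def doubleton_eq_iff)

lemma complete_bipartite_edgeE:
  assumes "e \<in> edges (complete_bipartite m n)"
  obtains i j where "i < m" "j < n" "e = {Inl i, Inr j}"
  using assms by (auto simp: complete_bipartite_def)

lemma complete_bipartite_edge_sides:
  assumes "{u, v} \<in> edges (complete_bipartite m n)"
  shows "isl u \<longleftrightarrow> \<not> isl v"
proof -
  obtain i j where "{u, v} = {Inl i, Inr j}" using assms by (rule complete_bipartite_edgeE)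
  then show ?thesis by (auto simp: doubleton_eq_iff)
qed

lemma simple_complete_bipartite: "simple_graph (complete_bipartite m n)"
  unfolding simple_graph_def
proof (intro conjI ballI)
  show "finite (verts (complete_bipartite m n))" by (simp add: complete_bipartite_simps)
  fix e assume "e \<in> edges (complete_bipartite m n)"
  then obtain i j where "i < m" "j < n" "e = {Inl i, Inr j}" by (rule complete_bipartite_edgeE)
  then show "\<exists>a b. a \<noteq> b \<and> a \<in> verts (complete_bipartite m n) \<and> b \<in> verts (complete_bipartite m n) \<and> e = {a, b}"
    by (intro exI[of _ "Inl i"] exI[of _ "Inr j"]) (auto simp: complete_bipartite_simps)
qed

lemma card_even_below: "card {i. i < 2 * k \<and> even i} = k"
  and card_odd_below: "card {i. i < 2 * k \<and> odd i} = k" for k :: nat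
proof -
  have "{i. i < 2 * k \<and> even i} = (\<lambda>i. 2 * i) ` {..<k}" by (auto elim!: evenE)
  then show "card {i. i < 2 * k \<and> even i} = k" by (simp add: card_image inj_on_def)
  have "{i. i < 2 * k \<and> odd i} = (\<lambda>i. 2 * i + 1) ` {..<k}" by (auto elim!: oddE)
  then show "card {i. i < 2 * k \<and> odd i} = k" by (simp add: card_image inj_on_def)
qed

locale leveled_bipartite = enclosed_drawing "complete_bipartite m n" vs "fst \<circ> F"
  for m n :: nat and vs and F :: "(nat + nat \<Rightarrow> real) \<Rightarrow> space3" +
  fixes N :: nat and L
  assumes inj_F: "inj_on F (realization (complete_bipartite m n))"
    and levels: "level_partition (complete_bipartite m n) (cycle_graph vs) F N L"
    and nm: "n \<le> m" and n3: "3 \<le> n"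
begin

abbreviation "K \<equiv> complete_bipartite m n"

lemma sides: "i < length vs \<Longrightarrow> isl (vs ! i) \<longleftrightarrow> (isl (vs ! 0) \<longleftrightarrow> even i)"
proof (induction i)
  case (Suc i)
  then have "{vs ! i, vs ! Suc i} \<in> edges K" using spine_edge[of i] C by auto
  then have "isl (vs ! i) \<longleftrightarrow> \<not> isl (vs ! Suc i)" by (rule complete_bipartite_edge_sides)
  then show ?case using Suc by auto
qed simp

lemma even_length: "even (length vs)"
proof -
  have ne: "0 < length vs" using vs by linarith
  have l: "length vs - 1 < length vs" "Suc (length vs - 1) mod length vs = 0" using ne by auto
  have "{vs ! (length vs - 1), vs ! 0} \<in> edges K" using spine_edge[OF l(1)] C l(2) by auto
  then have "isl (vs ! (length vs - 1)) \<longleftrightarrow> \<not> isl (vs ! 0)" by (rule complete_bipartite_edge_sides)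
  then have "odd (length vs - 1)" using sides[OF l(1)] by blast
  then show ?thesis using ne by simp
qed

lemma length4: "4 \<le> length vs" using vs even_length by presburger

lemma card_sides: "card {v \<in> set vs. isl v} = length vs div 2" "card {v \<in> set vs. \<not> isl v} = length vs div 2"
proof -
  have bij: "card {v \<in> set vs. Q v} = card {i. i < length vs \<and> Q (vs ! i)}" for Q
  proof -
    have "{v \<in> set vs. Q v} = (!) vs ` {i. i < length vs \<and> Q (vs ! i)}"
      by (auto simp: in_set_conv_nth)
    moreover have "inj_on ((!) vs) {i. i < length vs \<and> Q (vs ! i)}"
      using vs by (auto simp: inj_on_def nth_eq_iff_index_eq)
    ultimately show ?thesis by (simp add: card_image)
  qed
  obtain k where k: "length vs = 2 * k" using even_length by (elim evenE)
  have "{i. i < length vs \<and> isl (vs ! i)} = (if isl (vs ! 0) then {i. i < 2 * k \<and> even i} else {i. i < 2 * k \<and> odd i})"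
    using sides k by auto
  then show "card {v \<in> set vs. isl v} = length vs div 2"
    using bij[of isl] card_even_below[of k] card_odd_below[of k] k by (auto split: if_splits)
  have "{i. i < length vs \<and> \<not> isl (vs ! i)} = (if isl (vs ! 0) then {i. i < 2 * k \<and> odd i} else {i. i < 2 * k \<and> even i})"
    using sides k by auto
  then show "card {v \<in> set vs. \<not> isl v} = length vs div 2"
    using bij[of "\<lambda>v. \<not> isl v"] card_even_below[of k] card_odd_below[of k] k by (auto split: if_splits)
qed

lemma set_vs: "set vs \<subseteq> verts K" using C verts_C by simp

text \<open>A spine that misses a right-hand vertex is shorter than \<open>2 n \<le> 2 m\<close>, so it also misses a
  left-hand vertex, and \<open>no_adjacent_bridges_off_spine\<close> applies to the two.\<close>

lemma Inr_on_spine: "j < n \<Longrightarrow> Inr j \<in> set vs"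
proof (rule ccontr)
  assume j: "j < n" "Inr j \<notin> set vs"
  have "{v \<in> set vs. \<not> isl v} \<subseteq> Inr ` ({..<n} - {j})"
    using set_vs j by (auto simp: complete_bipartite_simps)
  then have "card {v \<in> set vs. \<not> isl v} \<le> card (Inr ` ({..<n} - {j}) :: (nat + nat) set)"
    by (intro card_mono) auto
  also have "\<dots> < n" using j by (simp add: card_image)
  finally have k: "length vs div 2 < n" using card_sides by simp
  have "\<not> Inl ` {..<m} \<subseteq> {v \<in> set vs. isl v}"
  proof
    assume "Inl ` {..<m} \<subseteq> {v \<in> set vs. isl v}"
    then have "card (Inl ` {..<m} :: (nat + nat) set) \<le> card {v \<in> set vs. isl v}" by (intro card_mono) auto
    then show False using k nm card_sides by (simp add: card_image)
  qed
  then obtain i where i: "i < m" "Inl i \<notin> set vs" by auto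
  have vl: "\<exists>a<m. v = Inl a" if "v \<in> set vs" "isl v" for v using that set_vs by (auto simp: complete_bipartite_simps)
  have vr: "\<exists>a<n. v = Inr a" if "v \<in> set vs" "\<not> isl v" for v using that set_vs by (auto simp: complete_bipartite_simps)
  have m: "vs ! 0 \<in> set vs" "vs ! 1 \<in> set vs" "vs ! 2 \<in> set vs" "vs ! 3 \<in> set vs"
    using length4 by (auto intro!: nth_mem)
  have s: "isl (vs ! 2) = isl (vs ! 0)" "isl (vs ! 1) \<noteq> isl (vs ! 0)" "isl (vs ! 3) \<noteq> isl (vs ! 0)"
    using sides[of 1] sides[of 2] sides[of 3] length4 by auto
  have el: "{Inl i, v} \<in> edges K" if "v \<in> set vs" "\<not> isl v" for v
    using vr[OF that] i by (auto simp: complete_bipartite_simps)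
  have er: "{Inr j, v} \<in> edges K" if "v \<in> set vs" "isl v" for v
    using vl[OF that] j by (auto simp: complete_bipartite_simps)
  show False
  proof (cases "isl (vs ! 0)")
    case True
    show False
      by (rule no_adjacent_bridges_off_spine[OF length4 j(2) i(2)])
        (use True m s i j el er in \<open>auto simp: complete_bipartite_simps\<close>)
  next
    case False
    show False
      by (rule no_adjacent_bridges_off_spine[OF length4 i(2) j(2)])
        (use False m s i j el er in \<open>auto simp: complete_bipartite_simps\<close>)
  qed
qed

lemma Inr_spine_eq: "{v \<in> set vs. \<not> isl v} = Inr ` {..<n}"
  using Inr_on_spine set_vs by (auto simp: complete_bipartite_simps)

lemma length_vs: "length vs = 2 * n"
proof -
  have "length vs div 2 = n" using card_sides(2) unfolding Inr_spine_eq by (simp add: card_image)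
  then show ?thesis using even_length by auto
qed

lemma fragments_eq:
  "fragments K C = closure ` (open_edge ` {e \<in> edges K - edges C. e \<subseteq> set vs} \<union> open_star K ` (verts K - set vs))"
  unfolding fragments_def verts_C[symmetric]
  by (subst components_spine_complement[OF G C edges_C_subset])
     (use Inr_on_spine verts_C in \<open>auto elim!: complete_bipartite_edgeE\<close>)

definition chord :: "nat \<Rightarrow> nat \<Rightarrow> bool" where
  "chord i j \<longleftrightarrow> i < j \<and> j < length vs \<and> {vs ! i, vs ! j} \<in> edges K - edges C"

abbreviation "chord_fragment i j \<equiv> closure (open_edge {vs ! i, vs ! j})"
abbreviation "star_fragment u \<equiv> closure (open_star K u)"

lemma chord_fragment: "chord i j \<Longrightarrow> chord_fragment i j \<in> fragments K C"
  unfolding fragments_eq chord_def by (intro imageI UnI1) auto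

lemma star_fragment: "u \<in> verts K - set vs \<Longrightarrow> star_fragment u \<in> fragments K C"
  unfolding fragments_eq by (intro imageI UnI2) auto

text \<open>Distinct points over the same point of the plane have different heights, so one of the two
  fragments would cross over the other.\<close>

lemma same_level_fragments_disjoint:
  assumes "l \<in> {1..N}" "A \<in> L l" "B \<in> L l"
    and xy: "x \<in> A" "x \<notin> realization C" "y \<in> B" "y \<notin> realization C" "fst (F x) = fst (F y)"
  shows "A = B"
proof (rule ccontr)
  assume "A \<noteq> B"
  have AB: "A \<in> fragments K C" "B \<in> fragments K C"
  proof -
    have "(\<Union>l\<in>{1..N}. L l) = fragments K C"
      using levels unfolding level_partition_def by (elim conjE) assumption
    then show "A \<in> fragments K C" "B \<in> fragments K C" using assms(1-3) by blast+
  qed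
  have "x \<noteq> y" using fragments_inter[OF G AB] xy \<open>A \<noteq> B\<close> by auto
  moreover have "x \<in> realization K" "y \<in> realization K"
    using AB xy fragment_subset_realization[OF G] by blast+
  ultimately have "F x \<noteq> F y" using inj_F by (auto dest: inj_onD)
  then have "snd (F x) \<noteq> snd (F y)" using xy(5) by (simp add: prod_eq_iff)
  then have "snd (F x) > snd (F y) \<or> snd (F y) > snd (F x)" by auto
  then have "crosses_over F A B \<or> crosses_over F B A"
    unfolding crosses_over_def using xy by metis
  then show False using level_partition_no_crossing[OF levels assms(1)] assms(2,3) \<open>A \<noteq> B\<close> by metis
qed

lemma chord_edge: "chord i j \<Longrightarrow> {vs ! i, vs ! j} \<in> edges K - edges C" by (simp add: chord_def)

lemma chord_open_edge:
  assumes "chord i j"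
  shows "connected (open_edge {vs ! i, vs ! j})" "open_edge {vs ! i, vs ! j} \<inter> realization C = {}"
    "open_edge {vs ! i, vs ! j} \<subseteq> chord_fragment i j"
    "v \<in> {vs ! i, vs ! j} \<Longrightarrow> (fst \<circ> F) (vpoint v) \<in> closure ((fst \<circ> F) ` open_edge {vs ! i, vs ! j})"
proof -
  note e = chord_edge[OF assms]
  show "connected (open_edge {vs ! i, vs ! j})"
    by (rule connected_open_edge) (use edge_ends[OF DiffD1[OF e]] in simp)
  show "open_edge {vs ! i, vs ! j} \<inter> realization C = {}" using open_edge_subset[OF e] by blast
  show "open_edge {vs ! i, vs ! j} \<subseteq> chord_fragment i j" by (rule closure_subset)
  have k: "{vs ! i, vs ! j} \<in> edges K" using e by (rule DiffD1)
  show "(fst \<circ> F) (vpoint v) \<in> closure ((fst \<circ> F) ` open_edge {vs ! i, vs ! j})" if "v \<in> {vs ! i, vs ! j}"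
    by (rule end_in_closure_image[OF k order_refl that])
qed

lemma closure_support:
  assumes "x \<in> closure T" "x w \<noteq> (0 :: real)"
  obtains y where "y \<in> T" "y w \<noteq> 0"
proof -
  have "{y. y w \<noteq> 0} \<inter> closure T \<noteq> {}" using assms by auto
  then have "{y. y w \<noteq> 0} \<inter> T \<noteq> {}" by (simp add: open_Int_closure_eq_empty open_coordinate_ne_0)
  then show ?thesis using that by blast
qed

lemma chord_fragment_eqD:
  assumes "chord i j" "chord i' j'" "chord_fragment i j = chord_fragment i' j'"
  shows "(i, j) = (i', j')"
proof -
  have sub: "{vs ! i, vs ! j} \<subseteq> {vs ! i', vs ! j'}"
  proof
    fix v assume v: "v \<in> {vs ! i, vs ! j}"
    have "open_edge {vs ! i, vs ! j} \<noteq> {}"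
      using edge_ends chord_edge[OF assms(1)] open_edge_pair[of "vs ! i" "vs ! j"] by auto
    then obtain x where x: "x \<in> open_edge {vs ! i, vs ! j}" by blast
    then have "x \<in> chord_fragment i' j'" unfolding assms(3)[symmetric] using closure_subset by blast
    moreover have "x v \<noteq> 0" using x v by (auto simp: open_edge_def weight_support_def)
    ultimately obtain y where "y \<in> open_edge {vs ! i', vs ! j'}" "y v \<noteq> 0" by (rule closure_support)
    then show "v \<in> {vs ! i', vs ! j'}" by (auto simp: open_edge_def weight_support_def)
  qed
  have l: "i < length vs" "j < length vs" "i' < length vs" "j' < length vs" "i < j" "i' < j'"
    using assms(1,2) by (auto simp: chord_def)
  then have "i \<in> {i', j'}" "j \<in> {i', j'}" using sub vs(1) by (auto simp: nth_eq_iff_index_eq)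
  then show ?thesis using l by auto
qed

lemma off_spine: "u \<in> verts K - set vs \<Longrightarrow> \<exists>i<m. u = Inl i"
  using Inr_on_spine by (auto simp: complete_bipartite_simps)

lemma star_fragment_eqD:
  assumes "u \<in> verts K - set vs" "u' \<in> verts K - set vs" "star_fragment u = star_fragment u'"
  shows "u = u'"
proof (rule ccontr)
  assume "u \<noteq> u'"
  have "vpoint u \<in> open_star K u" using assms(1) by (auto simp: open_star_def)
  then have "vpoint u \<in> star_fragment u'" using closure_subset assms(3) by blast
  then obtain y where y: "y \<in> open_star K u'" "y u \<noteq> 0"
    by (rule closure_support[of _ _ u]) auto
  then have "y \<in> realization K" "y u' \<noteq> 0" by (auto simp: open_star_def)
  from this(1) show False
  proof (cases rule: realization_cases)
    case (1 v)
    then show ?thesis using y \<open>y u' \<noteq> 0\<close> \<open>u \<noteq> u'\<close> by (auto simp: vpoint_def split: if_splits)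
  next
    case (2 e)
    then have "u \<in> e" "u' \<in> e" using y \<open>y u' \<noteq> 0\<close> by (auto simp: open_edge_def weight_support_def)
    moreover obtain i j where "e = {Inl i, Inr j}" using 2(1) by (rule complete_bipartite_edgeE)
    ultimately show ?thesis using off_spine[OF assms(1)] off_spine[OF assms(2)] \<open>u \<noteq> u'\<close> by auto
  qed
qed

lemma chord_fragment_neq_star:
  assumes "u \<in> verts K - set vs" "chord i j"
  shows "chord_fragment i j \<noteq> star_fragment u"
proof
  assume eq: "chord_fragment i j = star_fragment u"
  have "vpoint u \<in> open_star K u" using assms(1) by (auto simp: open_star_def)
  then have "vpoint u \<in> chord_fragment i j" using closure_subset eq by blast
  then obtain y where y: "y \<in> open_edge {vs ! i, vs ! j}" "y u \<noteq> 0"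
    by (rule closure_support[of _ _ u]) auto
  then have "u \<in> {vs ! i, vs ! j}" by (auto simp: open_edge_def weight_support_def)
  moreover have "vs ! i \<in> set vs" "vs ! j \<in> set vs" using assms(2) by (auto simp: chord_def)
  ultimately show False using assms(1) by auto
qed

lemma star_edge: "u \<in> verts K - set vs \<Longrightarrow> v \<in> set vs \<Longrightarrow> \<not> isl v \<Longrightarrow> {u, v} \<in> edges K"
  using off_spine[of u] set_vs by (auto simp: complete_bipartite_simps)

lemma star_open:
  assumes "u \<in> verts K - set vs"
  shows "connected (open_star K u)" "open_star K u \<subseteq> star_fragment u" "open_star K u \<inter> realization C = {}"
    and "v \<in> set vs \<Longrightarrow> \<not> isl v \<Longrightarrow> (fst \<circ> F) (vpoint v) \<in> closure ((fst \<circ> F) ` open_star K u)"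
proof -
  show "connected (open_star K u)" using connected_open_star[OF G] assms by blast
  show "open_star K u \<subseteq> star_fragment u" by (rule closure_subset)
  show "open_star K u \<inter> realization C = {}" using open_star_subset[of u] assms by blast
  assume "v \<in> set vs" "\<not> isl v"
  then have "{u, v} \<in> edges K" using star_edge assms by blast
  then show "(fst \<circ> F) (vpoint v) \<in> closure ((fst \<circ> F) ` open_star K u)"
    using end_in_closure_image[of u v "open_star K u" v] open_edge_subset_star[of u v] by simp
qed

lemma chord_chord_level:
  assumes "chord a b" "chord c d" "a < c" "c < b" "b < d"
    and l: "l \<in> {1..N}" "chord_fragment a b \<in> L l" "chord_fragment c d \<in> L l"
  shows False
proof -
  have ab: "vs ! a \<noteq> vs ! b" using edge_ends[of "vs ! a" "vs ! b"] chord_edge[OF assms(1)] by auto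
  note cd = chord_open_edge[OF assms(2)]
  note w = chord_walk[OF chord_edge[OF assms(1)]]
  obtain x y where xy: "x \<in> walk_points [vs ! a, vs ! b]" "x \<notin> realization C"
    "y \<in> open_edge {vs ! c, vs ! d}" "(fst \<circ> F) x = (fst \<circ> F) y"
  proof (rule interleaved_indices_meet[of a b c d "[vs ! a, vs ! b]" "chord_fragment a b"
        "chord_fragment c d" "open_edge {vs ! c, vs ! d}"])
    show "chord_fragment a b \<in> fragments K C" "chord_fragment c d \<in> fragments K C"
      using chord_fragment assms by auto
    show "b < length vs" "d < length vs" using assms by (auto simp: chord_def)
  qed (use assms(3-5) ab cd w in auto)
  have "y \<notin> realization C" using xy(3) cd(2) by blast
  moreover have "x \<in> chord_fragment a b" "y \<in> chord_fragment c d" using xy w(1) cd(3) by blast+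
  moreover have "fst (F x) = fst (F y)" using xy(4) by simp
  ultimately have "chord_fragment a b = chord_fragment c d"
    using same_level_fragments_disjoint[OF l] xy(2) by blast
  then show False using chord_fragment_eqD[OF assms(1,2)] assms(3) by simp
qed

text \<open>The detour through \<open>u\<close> between the right-hand vertices with indices \<open>i\<close> and \<open>j\<close> separates the
  ends of the chord.\<close>

lemma chord_star_indices:
  assumes "chord a b" "i < length vs" "j < length vs" "i < j" "\<not> isl (vs ! i)" "\<not> isl (vs ! j)"
    and sep: "i < a \<and> a < j \<and> (b < i \<or> j < b) \<or> i < b \<and> b < j \<and> (a < i \<or> j < a)"
    and u: "u \<in> verts K - set vs"
    and l: "l \<in> {1..N}" "chord_fragment a b \<in> L l" "star_fragment u \<in> L l"
  shows False
proof -
  have ij: "vs ! i \<noteq> vs ! j" "vs ! i \<in> set vs" "vs ! j \<in> set vs"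
    using assms(2-4) vs(1) by (auto simp: nth_eq_iff_index_eq)
  have ui: "{u, vs ! i} \<in> edges K" "{u, vs ! j} \<in> edges K"
    using star_edge[OF u ij(2) assms(5)] star_edge[OF u ij(3) assms(6)] by auto
  have us: "u \<notin> set vs" using u by blast
  note w = detour_walk[OF us ui ij(1)]
  note ab = chord_open_edge[OF assms(1)]
  have abl: "a < length vs" "b < length vs" using assms(1) by (auto simp: chord_def)
  have cl: "(fst \<circ> F) (vpoint (vs ! a)) \<in> closure ((fst \<circ> F) ` open_edge {vs ! a, vs ! b})"
    "(fst \<circ> F) (vpoint (vs ! b)) \<in> closure ((fst \<circ> F) ` open_edge {vs ! a, vs ! b})"
    using ab(4) by blast+
  have us3: "distinct [vs ! i, u, vs ! j]" "2 \<le> length [vs ! i, u, vs ! j]"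
    "hd [vs ! i, u, vs ! j] = vs ! i" "last [vs ! i, u, vs ! j] = vs ! j"
    using ij us by auto
  obtain x y where xy: "x \<in> walk_points [vs ! i, u, vs ! j]" "x \<notin> realization C"
    "y \<in> open_edge {vs ! a, vs ! b}" "(fst \<circ> F) x = (fst \<circ> F) y"
    using sep
  proof
    assume "i < a \<and> a < j \<and> (b < i \<or> j < b)"
    then have s: "i < a" "a < j" "b < i \<or> j < b" by auto
    show thesis
      using interleaved_indices_meet[OF assms(4,3) s abl(2) us3 star_fragment[OF u] w
        chord_fragment[OF assms(1)] ab(1,3,2) cl] that by metis
  next
    assume "i < b \<and> b < j \<and> (a < i \<or> j < a)"
    then have s: "i < b" "b < j" "a < i \<or> j < a" by auto
    show thesis
      using interleaved_indices_meet[OF assms(4,3) s abl(1) us3 star_fragment[OF u] w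
        chord_fragment[OF assms(1)] ab(1,3,2) cl(2,1)] that by metis
  qed
  have "y \<notin> realization C" using xy(3) ab(2) by blast
  moreover have "x \<in> star_fragment u" "y \<in> chord_fragment a b" using xy w(1) ab(3) by blast+
  moreover have "fst (F x) = fst (F y)" using xy(4) by simp
  ultimately have "star_fragment u = chord_fragment a b"
    using same_level_fragments_disjoint[OF l(1,3,2)] xy(2) by blast
  then show False using chord_fragment_neq_star[OF u assms(1)] by simp
qed

lemma chord_not_spine_edge:
  assumes "chord a b"
  shows "b \<noteq> Suc a" "\<not> (a = 0 \<and> b = length vs - 1)" "isl (vs ! a) \<longleftrightarrow> \<not> isl (vs ! b)" "odd (b - a)"
proof -
  have ab: "a < b" "b < length vs" "{vs ! a, vs ! b} \<notin> edges C" "{vs ! a, vs ! b} \<in> edges K"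
    using assms by (auto simp: chord_def)
  show "b \<noteq> Suc a" using spine_edge[of a] ab by auto
  show "\<not> (a = 0 \<and> b = length vs - 1)"
  proof
    assume "a = 0 \<and> b = length vs - 1"
    moreover from this have "Suc b = length vs" using ab by simp
    then have "Suc b mod length vs = 0" by simp
    ultimately show False using spine_edge[OF ab(2)] ab(3) by (simp add: insert_commute)
  qed
  show s: "isl (vs ! a) \<longleftrightarrow> \<not> isl (vs ! b)" using complete_bipartite_edge_sides[OF ab(4)] .
  then show "odd (b - a)" using sides[of a] sides[of b] ab by auto
qed

text \<open>Let the detour join the two spine neighbours of the left-hand end of the chord.  The other end is
  a right-hand vertex different from both, since a chord is not a spine edge.  The cases cope with a
  neighbour on the far side of the seam between the last index and index 0.\<close>

lemma chord_star_level:
  assumes ch: "chord a b" and u: "u \<in> verts K - set vs"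
    and l: "l \<in> {1..N}" "chord_fragment a b \<in> L l" "star_fragment u \<in> L l"
  shows False
proof -
  note ns = chord_not_spine_edge[OF ch]
  have len: "6 \<le> length vs" using length_vs n3 by simp
  have ab: "a < b" "b < length vs" using ch by (auto simp: chord_def)
  have flip: "isl (vs ! i) \<noteq> isl (vs ! j)" if "i < length vs" "j < length vs" "odd (i + j)" for i j
    using sides[OF that(1)] sides[OF that(2)] that(3) by auto
  have o: "odd (a + b)" using ns(4) ab by (metis add.commute even_diff_nat less_imp_le_nat not_less)
  note st = chord_star_indices[OF ch _ _ _ _ _ _ u l]
  show False
  proof (cases "isl (vs ! a)")
    case True
    show False
    proof (cases "a = 0")
      case True
      have "\<not> isl (vs ! 1)" "\<not> isl (vs ! (length vs - 1))"
      proof -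
        have "0 < length vs" "1 < length vs" "length vs - 1 < length vs" using len by linarith+
        then show "\<not> isl (vs ! 1)" "\<not> isl (vs ! (length vs - 1))"
          using flip[of 1 a] flip[of "length vs - 1" a] \<open>isl (vs ! a)\<close> True even_length by auto
      qed
      moreover have "1 < b" "b < length vs - 1" using ns ab True by auto
      moreover have "length vs - 1 < length vs" "1 < length vs - 1" using len by linarith+
      ultimately show False using st[of 1 "length vs - 1"] True by simp
    next
      case False
      have "a < length vs - 1" using ab by simp
      then have "\<not> isl (vs ! (a - 1))" "\<not> isl (vs ! (a + 1))"
        using flip[of "a - 1" a] flip[of "a + 1" a] \<open>isl (vs ! a)\<close> False len by auto
      moreover have "a + 1 < b" using ns ab by auto
      moreover have "a - 1 < length vs" "a + 1 < length vs" "a - 1 < a + 1" "a - 1 < a" using False ab calculation by linarith+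
      ultimately show False using st[of "a - 1" "a + 1"] by simp
    qed
  next
    case False
    then have b: "isl (vs ! b)" using ns by simp
    show False
    proof (cases "b = length vs - 1")
      case True
      have "\<not> isl (vs ! 0)" "\<not> isl (vs ! (b - 1))"
      proof -
        have "0 < length vs" "b - 1 < length vs" "odd (0 + b)" "odd (b - 1 + b)"
          using len ab True even_length by auto
        then show "\<not> isl (vs ! 0)" "\<not> isl (vs ! (b - 1))"
          using flip[of 0 b] flip[of "b - 1" b] b ab by auto
      qed
      moreover have "0 < a" "a < b - 1" using ns ab True by auto
      moreover have "0 < length vs" "b - 1 < length vs" "0 < b - 1" "b - 1 < b" using len True by linarith+
      ultimately show False using st[of 0 "b - 1"] by simp
    next
      case False
      then have "b + 1 < length vs" using ab by simp
      then have "\<not> isl (vs ! (b - 1))" "\<not> isl (vs ! (b + 1))"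
        using flip[of "b - 1" b] flip[of "b + 1" b] b ab by auto
      moreover have "a < b - 1" using ns ab by auto
      moreover have "b - 1 < length vs" "b - 1 < b + 1" "b - 1 < b" using ab by linarith+
      ultimately show False using st[of "b - 1" "b + 1"] \<open>b + 1 < length vs\<close> by simp
    qed
  qed
qed

lemma star_star_level:
  assumes u: "u \<in> verts K - set vs" "u' \<in> verts K - set vs"
    and l: "l \<in> {1..N}" "star_fragment u \<in> L l" "star_fragment u' \<in> L l"
  shows "u = u'"
proof -
  \<comment> \<open>The first index of a right-hand vertex; since \<open>n \<ge> 3\<close>, the indices \<open>r\<close>, \<open>r + 2\<close> and \<open>r + 4\<close> exist.\<close>
  define r where "r = (if isl (vs ! 0) then 1 else 0 :: nat)"
  have len: "6 \<le> length vs" using length_vs n3 by simp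
  have rl: "r < r + 2" "r + 2 < length vs" "r + 4 < length vs" using len by (auto simp: r_def)
  let ?a = "vs ! r" and ?b = "vs ! (r + 2)" and ?c = "vs ! (r + 4)"
  have s: "\<not> isl (vs ! r)" "\<not> isl (vs ! (r + 2))" "\<not> isl (vs ! (r + 4))"
    using sides[of r] sides[of "r + 2"] sides[of "r + 4"] rl by (auto simp: r_def)
  have m: "?a \<in> set vs" "?b \<in> set vs" "?c \<in> set vs" using rl by auto
  have sm: "v \<in> set vs \<and> \<not> isl v" if "v \<in> {?a, ?b, ?c}" for v using that s m by blast
  have "drop r vs = ?a # [vs ! Suc r] @ ?b # [vs ! Suc (Suc (Suc r))] @ ?c # drop (Suc (Suc (Suc (Suc (Suc r))))) vs"
    using rl by (simp add: Cons_nth_drop_Suc numeral_eq_Suc)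
  then have dec: "vs = take r vs @ ?a # [vs ! Suc r] @ ?b # [vs ! Suc (Suc (Suc r))] @ ?c # drop (Suc (Suc (Suc (Suc (Suc r))))) vs"
    by (metis append_take_drop_id)
  have us: "u \<notin> set vs" using u by blast
  note so = star_open[OF u(2)]
  obtain x y v where xy: "v \<in> {?a, ?b, ?c}" "x \<in> epoint u v ` {0..1}" "x \<notin> realization C"
    "y \<in> open_star K u'" "(fst \<circ> F) x = (fst \<circ> F) y"
  proof (rule tripod_pieces_meet[OF dec us _ star_fragment[OF u(1)] _ star_fragment[OF u(2)] so(1,2,3)])
    fix v assume v: "v \<in> {?a, ?b, ?c}"
    show e: "{u, v} \<in> edges K" using star_edge[OF u(1)] sm[OF v] by blast
    show "epoint u v ` {0..1} \<subseteq> star_fragment u"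
      using closed_edge_subset_closure[OF e] closure_mono[OF open_edge_subset_star[OF e]] by (rule subset_trans)
    show "(fst \<circ> F) (vpoint v) \<in> closure ((fst \<circ> F) ` open_star K u')"
      using so(4) sm[OF v] by blast
  qed blast
  have "{u, v} \<in> edges K" using star_edge[OF u(1)] sm[OF xy(1)] by blast
  then have "x \<in> star_fragment u"
    using closed_edge_subset_closure[of u v] closure_mono[OF open_edge_subset_star[of u v]] xy(2) by blast
  moreover have "y \<in> star_fragment u'" "y \<notin> realization C" using xy(4) so(2,3) by blast+
  moreover have "fst (F x) = fst (F y)" using xy(5) by simp
  ultimately have "star_fragment u = star_fragment u'"
    using same_level_fragments_disjoint[OF l] xy(3) by blast
  then show ?thesis by (rule star_fragment_eqD[OF u])
qed

text \<open>The pair \<open>(0, 2 n - 1)\<close> is the spine edge that closes the cycle.  It crosses nothing, and counting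
  it along with the chords sharpens the bound from \<open>n - 1\<close> to \<open>n - 2\<close>.\<close>

lemma card_chords_level:
  assumes "l \<in> {1..N}"
  shows "card {(i, j). chord i j \<and> chord_fragment i j \<in> L l} \<le> n - 2"
proof -
  define S where "S = {(i, j). chord i j \<and> chord_fragment i j \<in> L l}"
  let ?e = "(0, length vs - 1)"
  have len: "length vs = 2 * n" "6 \<le> length vs" using length_vs n3 by auto
  have fin: "finite S"
    by (rule finite_subset[of _ "{..<length vs} \<times> {..<length vs}"]) (auto simp: S_def chord_def)
  have e: "?e \<notin> S" using chord_not_spine_edge(2) by (auto simp: S_def)
  have "2 * card (insert ?e S) + 2 \<le> card {..<length vs}"
  proof (rule card_noncrossing_chords)
    fix a b assume ab: "(a, b) \<in> insert ?e S"
    have "a < b \<and> b < length vs \<and> odd (b - a) \<and> b \<noteq> Suc a"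
    proof (cases "(a, b) = ?e")
      case False
      then have "chord a b" using ab by (auto simp: S_def)
      then show ?thesis using chord_not_spine_edge[of a b] by (auto simp: chord_def)
    qed (use len in auto)
    moreover from this have "{..<length vs} \<inter> {a<..<b} = {a<..<b}" by auto
    moreover have "Suc a \<in> {a<..<b}" using calculation by auto
    then have "{a<..<b} \<noteq> {}" by blast
    ultimately show "a \<in> {..<length vs} \<and> b \<in> {..<length vs} \<and> a < b \<and>
      even (card ({..<length vs} \<inter> {a<..<b})) \<and> {..<length vs} \<inter> {a<..<b} \<noteq> {}"
      by auto
  next
    fix a b c d assume ab: "(a, b) \<in> insert ?e S" "(c, d) \<in> insert ?e S"
    show "\<not> (a < c \<and> c < b \<and> b < d)"
    proof
      assume o: "a < c \<and> c < b \<and> b < d"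
      have lt: "d < length vs" using ab(2) len by (auto simp: S_def chord_def)
      have "(a, b) \<in> S" "(c, d) \<in> S" using ab o lt by auto
      then show False using chord_chord_level[of a b c d l] o assms by (auto simp: S_def)
    qed
  qed (use fin len in auto)
  then have "card S \<le> n - 2" using fin e len by simp
  then show ?thesis by (simp add: S_def)
qed

text \<open>The \<open>n * n\<close> edges between spine vertices include the \<open>2 n\<close> spine edges.\<close>

lemma card_chords: "n * (n - 2) \<le> card {(i, j). chord i j}"
proof -
  let ?E = "{e \<in> edges K. e \<subseteq> set vs}"
  have len: "length vs = 2 * n" by (rule length_vs)
  define I where "I = {v \<in> set vs. isl v}"
  define J where "J = {v \<in> set vs. \<not> isl v}"
  have IJ: "card I = n" "card J = n" "finite I" "finite J" using card_sides len by (auto simp: I_def J_def)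
  have inj: "inj_on (\<lambda>(v, w). {v, w}) (I \<times> J)" by (auto simp: inj_on_def I_def J_def doubleton_eq_iff)
  have sub: "(\<lambda>(v, w). {v, w}) ` (I \<times> J) \<subseteq> ?E"
  proof clarify
    fix v w assume vw: "v \<in> I" "w \<in> J"
    then obtain i j where "v = Inl i" "w = Inr j" by (cases v; cases w) (auto simp: I_def J_def)
    then show "{v, w} \<in> edges K \<and> {v, w} \<subseteq> set vs"
      using vw set_vs by (auto simp: I_def J_def complete_bipartite_simps)
  qed
  have fin: "finite ?E" by (rule finite_subset[of _ "Pow (set vs)"]) auto
  have "card (I \<times> J) \<le> card ?E" using card_mono[OF fin sub] card_image[OF inj] by simp
  then have E: "n * n \<le> card ?E" by (simp add: card_cartesian_product IJ)
  have ec: "edges C = (\<lambda>i. {vs ! i, vs ! (Suc i mod length vs)}) ` {..<length vs}"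
    by (auto simp: cycle_graph_def)
  then have finC: "finite (edges C)" and "card (edges C) \<le> 2 * n"
    using card_image_le[of "{..<length vs}" "\<lambda>i. {vs ! i, vs ! (Suc i mod length vs)}"] len by auto
  then have "n * n - 2 * n \<le> card (?E - edges C)"
    using E diff_card_le_card_Diff[OF finC, of ?E] by linarith
  also have "\<dots> \<le> card ((\<lambda>(i, j). {vs ! i, vs ! j}) ` {(i, j). chord i j})"
  proof (rule card_mono)
    have finc: "finite {(i, j). chord i j}"
      by (rule finite_subset[of _ "{..<length vs} \<times> {..<length vs}"]) (auto simp: chord_def)
    then show "finite ((\<lambda>(i, j). {vs ! i, vs ! j}) ` {(i, j). chord i j})" by (rule finite_imageI)
    show "?E - edges C \<subseteq> (\<lambda>(i, j). {vs ! i, vs ! j}) ` {(i, j). chord i j}"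
    proof
      fix e assume e: "e \<in> ?E - edges C"
      then obtain a b where ab: "a \<noteq> b" "e = {a, b}" "a \<in> set vs" "b \<in> set vs"
      proof -
        have "e \<in> edges K" "e \<subseteq> set vs" using e by auto
        then show thesis using that simple_graph_edgeE[OF G \<open>e \<in> edges K\<close>] by (metis insert_subset)
      qed
      then obtain i j where ij: "i < length vs" "a = vs ! i" "j < length vs" "b = vs ! j"
        by (metis in_set_conv_nth)
      then have "i \<noteq> j" using ab by auto
      then have "chord i j \<or> chord j i" using e ab ij by (auto simp: chord_def insert_commute)
      then show "e \<in> (\<lambda>(i, j). {vs ! i, vs ! j}) ` {(i, j). chord i j}"
        using ab ij by (auto simp: image_iff insert_commute)
    qed
  qed
  also have "\<dots> \<le> card {(i, j). chord i j}"
    by (rule card_image_le, rule finite_subset[of _ "{..<length vs} \<times> {..<length vs}"]) (auto simp: chord_def)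
  finally show ?thesis by (simp add: diff_mult_distrib2 mult.commute)
qed

lemma level_of_fragment: "A \<in> fragments K C \<Longrightarrow> \<exists>l\<in>{1..N}. A \<in> L l"
proof -
  assume "A \<in> fragments K C"
  moreover have "(\<Union>l\<in>{1..N}. L l) = fragments K C"
    using levels unfolding level_partition_def by (elim conjE) assumption
  ultimately show "\<exists>l\<in>{1..N}. A \<in> L l" by blast
qed

text \<open>The levels in \<open>H\<close> are those of the stars: one for each star, and without chords.  The remaining
  levels have to accommodate \<open>n (n - 2)\<close> chords, at most \<open>n - 2\<close> in each.\<close>

theorem levels_ge: "m \<le> N"
proof -
  let ?U = "verts K - set vs"
  define S where "S l = {(i, j). chord i j \<and> chord_fragment i j \<in> L l}" for l
  define H where "H = {l \<in> {1..N}. \<exists>u\<in>?U. star_fragment u \<in> L l}"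
  have finS: "finite (S l)" for l
    by (rule finite_subset[of _ "{..<length vs} \<times> {..<length vs}"]) (auto simp: S_def chord_def)
  have H: "H \<subseteq> {1..N}" "finite H" by (auto simp: H_def)
  have SH: "S l = {}" if "l \<in> H" for l
    using that chord_star_level by (auto simp: S_def H_def)
  obtain lev where lev: "\<And>u. u \<in> ?U \<Longrightarrow> lev u \<in> {1..N} \<and> star_fragment u \<in> L (lev u)"
    using bchoice[of ?U "\<lambda>u l. l \<in> {1..N} \<and> star_fragment u \<in> L l"] level_of_fragment[OF star_fragment] by blast
  have "inj_on lev ?U" using lev star_star_level by (intro inj_onI) metis
  moreover have "lev ` ?U \<subseteq> H" using lev by (auto simp: H_def)
  ultimately have "card ?U \<le> card H" using H(2) by (metis card_image card_mono)
  moreover have "card ?U = m - n"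
  proof -
    have "card (verts K) = m + n"
      unfolding complete_bipartite_simps by (subst card_Un_disjoint) (auto simp: card_image)
    moreover have "card (set vs) = 2 * n" using vs(1) length_vs by (simp add: distinct_card)
    moreover have "card ?U = card (verts K) - card (set vs)"
      using set_vs by (intro card_Diff_subset) auto
    ultimately show ?thesis by simp
  qed
  ultimately have Hm: "m - n \<le> card H" by simp
  have "{(i, j). chord i j} \<subseteq> (\<Union>l\<in>{1..N} - H. S l)"
  proof clarify
    fix i j assume ch: "chord i j"
    then obtain l where l: "l \<in> {1..N}" "chord_fragment i j \<in> L l"
      using level_of_fragment[OF chord_fragment] by blast
    then have "(i, j) \<in> S l" using ch by (simp add: S_def)
    then show "(i, j) \<in> (\<Union>l\<in>{1..N} - H. S l)" using l SH by blast
  qed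
  then have "card {(i, j). chord i j} \<le> card (\<Union>l\<in>{1..N} - H. S l)"
    using finS by (intro card_mono) auto
  also have "\<dots> \<le> (\<Sum>l\<in>{1..N} - H. card (S l))" by (rule card_UN_le) simp
  also have "\<dots> \<le> (\<Sum>l\<in>{1..N} - H. n - 2)"
    using card_chords_level by (intro sum_mono) (auto simp: S_def)
  also have "\<dots> = (N - card H) * (n - 2)" using H by (simp add: card_Diff_subset)
  finally have "n * (n - 2) \<le> (N - card H) * (n - 2)" using card_chords by linarith
  then have "n \<le> N - card H" using n3 by simp
  then show ?thesis using Hm nm n3 by linarith
qed

end

theorem bipartite_levels_ge:
  assumes "graph_embedding (complete_bipartite m n) f" "leveled_with (complete_bipartite m n) f C N"
    and "n \<le> m" "3 \<le> n"
  shows "m \<le> N"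
proof -
  obtain vs F L where C: "C = cycle_graph vs" and d: "enclosed_drawing (complete_bipartite m n) vs (fst \<circ> F)"
    "inj_on F (realization (complete_bipartite m n))" "level_partition (complete_bipartite m n) C F N L"
    by (rule leveled_with_drawing[OF simple_complete_bipartite assms(1,2)])
  interpret leveled_bipartite m n vs F N L
    using d assms(3,4) unfolding C by (simp add: leveled_bipartite_def leveled_bipartite_axioms_def)
  show ?thesis by (rule levels_ge)
qed

section \<open>Straight chords inside a circular spine\<close>

lemma cis_eq_in_period:
  assumes "cis a = cis b" "c \<le> a" "a < c + 2 * pi" "c \<le> b" "b < c + 2 * pi"
  shows "a = b"
proof -
  have "sin a = sin b \<and> cos a = cos b" using assms(1) by (simp add: complex_eq_iff)
  then obtain n :: int where n: "a = b + 2 * pi * n" using sin_cos_eq_iff[of a b] by auto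
  then have "\<bar>2 * pi * n\<bar> < 2 * pi" using assms by auto
  then have "\<bar>real_of_int n\<bar> < 1" by (simp add: abs_mult)
  then have "n = 0" by linarith
  then show ?thesis using n by simp
qed

text \<open>The defect \<open>1 - |z|\<^sup>2\<close> exceeds the weighted average of its values at the ends by a term that is
  positive strictly between distinct ends.  This makes the disc strictly convex.\<close>

lemma chord_norm:
  fixes a b :: complex
  shows "1 - (cmod ((1 - t) *\<^sub>R a + t *\<^sub>R b))\<^sup>2 =
    (1 - t) * (1 - (cmod a)\<^sup>2) + t * (1 - (cmod b)\<^sup>2) + t * (1 - t) * (cmod (a - b))\<^sup>2"
  by (simp only: cmod_power2) (simp add: power2_eq_square algebra_simps)

text \<open>The spine vertices sit on the unit circle at increasing angles, and the angle with index
  \<open>length vs\<close> closes the turn.  Edges carry colours, and the colour of a singleton \<open>{u}\<close> is that of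
  the star of the off-spine vertex \<open>u\<close>; in this way the colour of a fragment is the colour of the
  support of any of its points off the spine.  Transversality is the nonvanishing of the
  determinant of the two directions, and it is only required at actual crossings.\<close>

locale chord_drawing = spined_graph G vs for G :: "'a::countable graph" and vs +
  fixes pos :: "'a \<Rightarrow> complex" and \<theta> :: "nat \<Rightarrow> real" and col :: "'a set \<Rightarrow> nat" and M :: nat
  assumes meets: "\<And>e. e \<in> edges G \<Longrightarrow> e \<inter> set vs \<noteq> {}"
    and angle: "\<And>k. k < length vs \<Longrightarrow> \<theta> k < \<theta> (Suc k)" "\<theta> (length vs) = \<theta> 0 + 2 * pi"
      "0 \<le> \<theta> 0" "\<theta> 0 < 2 * pi"
    and pos_spine: "\<And>k. k < length vs \<Longrightarrow> pos (vs ! k) = cis (\<theta> k)"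
    and pos_off: "\<And>v. v \<in> verts G - set vs \<Longrightarrow> cmod (pos v) < 1"
    and pos_off_inj: "inj_on pos (verts G - set vs)"
    and off_edge: "\<And>v a b. v \<in> verts G - set vs \<Longrightarrow> {a, b} \<in> chords \<Longrightarrow>
       pos v \<notin> open_segment (pos a) (pos b)"
    and transverse: "\<And>a b c d z. {a, b} \<in> chords \<Longrightarrow>
       {c, d} \<in> chords \<Longrightarrow> {a, b} \<noteq> {c, d} \<Longrightarrow>
       z \<in> open_segment (pos a) (pos b) \<Longrightarrow> z \<in> open_segment (pos c) (pos d) \<Longrightarrow>
       Im (cnj (pos b - pos a) * (pos d - pos c)) \<noteq> 0"
    and no_triple: "\<And>a b c d e f z. {a, b} \<in> chords \<Longrightarrow>
       {c, d} \<in> chords \<Longrightarrow> {e, f} \<in> chords \<Longrightarrow>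
       {a, b} \<noteq> {c, d} \<Longrightarrow> {a, b} \<noteq> {e, f} \<Longrightarrow> {c, d} \<noteq> {e, f} \<Longrightarrow>
       z \<in> open_segment (pos a) (pos b) \<Longrightarrow> z \<in> open_segment (pos c) (pos d) \<Longrightarrow>
       z \<notin> open_segment (pos e) (pos f)"
    and same_colour: "\<And>a b c d z. {a, b} \<in> chords \<Longrightarrow>
       {c, d} \<in> chords \<Longrightarrow> {a, b} \<noteq> {c, d} \<Longrightarrow> col {a, b} = col {c, d} \<Longrightarrow>
       z \<in> open_segment (pos a) (pos b) \<Longrightarrow> z \<notin> open_segment (pos c) (pos d)"
    and colour_star: "\<And>u b. u \<notin> set vs \<Longrightarrow> {u, b} \<in> edges G \<Longrightarrow> col {u, b} = col {u}"
    and colour_range: "\<And>e. e \<in> chords \<Longrightarrow> 1 \<le> col e \<and> col e \<le> M" "1 \<le> M"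
      "\<And>u. u \<in> verts G - set vs \<Longrightarrow> 1 \<le> col {u} \<and> col {u} \<le> M"
begin

abbreviation "seg a b \<equiv> open_segment (pos a) (pos b)"

definition next_vertex :: "nat \<Rightarrow> 'a" where
  "next_vertex k = vs ! (Suc k mod length vs)"

text \<open>At a spine vertex both adjacent edges qualify; \<open>planar_spine\<close> shows that the choice between them
  does not affect the drawing.\<close>

definition spine_edge_of :: "('a \<Rightarrow> real) \<Rightarrow> nat" where
  "spine_edge_of x = (SOME k. k < length vs \<and> x \<in> epoint (vs ! k) (next_vertex k) ` {0..1})"

definition planar :: "('a \<Rightarrow> real) \<Rightarrow> complex" where
  "planar x = (if x \<in> realization C
     then let k = spine_edge_of x in cis (\<theta> k + x (next_vertex k) * (\<theta> (Suc k) - \<theta> k))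
     else \<Sum>v\<in>verts G. x v *\<^sub>R pos v)"

text \<open>The paraboloids of height \<open>c (1 - |z|\<^sup>2)\<close> for different \<open>c\<close> are disjoint over the open disc and
  all pass through the unit circle at height 0, so the heights of crossing fragments compare as
  their colours do and every fragment joins the spine continuously.\<close>

definition drawing :: "('a \<Rightarrow> real) \<Rightarrow> space3" where
  "drawing x = (planar x, real (col (weight_support x)) * (1 - (cmod (planar x))\<^sup>2))"

lemma N_pos: "0 < length vs" using vs by linarith

lemma finite_verts: "finite (verts G)" using G by (simp add: simple_graph_def)

lemma cis_angle_mod: "k < length vs \<Longrightarrow> cis (\<theta> (Suc k)) = pos (next_vertex k)"
proof -
  assume k: "k < length vs"
  show ?thesis
  proof (cases "Suc k = length vs")
    case True
    then have "next_vertex k = vs ! 0" by (simp add: next_vertex_def)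
    moreover have "cis (\<theta> (Suc k)) = cis (\<theta> 0)" using angle(2) True by (simp add: complex_eq_iff)
    ultimately show ?thesis using pos_spine[OF N_pos] by simp
  next
    case False
    then show ?thesis using pos_spine[of "Suc k"] k by (simp add: next_vertex_def)
  qed
qed

lemma next_vertex_neq: "k < length vs \<Longrightarrow> vs ! k \<noteq> next_vertex k"
proof -
  assume k: "k < length vs"
  have "Suc k mod length vs \<noteq> k" using k vs(2) by (cases "Suc k = length vs") auto
  then show ?thesis using k vs(1) N_pos by (simp add: next_vertex_def nth_eq_iff_index_eq)
qed

lemma edges_C_iff: "e \<in> edges C \<longleftrightarrow> (\<exists>k<length vs. e = {vs ! k, next_vertex k})"
  by (auto simp: cycle_graph_def next_vertex_def)

lemma next_in_spine: "next_vertex k \<in> set vs"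
  using N_pos by (simp add: next_vertex_def)

lemma spine_edge_index_unique:
  assumes "k < length vs" "k' < length vs" "{vs ! k, next_vertex k} = {vs ! k', next_vertex k'}"
  shows "k = k'"
proof (rule ccontr)
  assume ne: "k \<noteq> k'"
  then have "vs ! k \<noteq> vs ! k'" using assms vs(1) by (simp add: nth_eq_iff_index_eq)
  then have "vs ! k = next_vertex k'" "vs ! k' = next_vertex k" using assms(3) by (auto simp: doubleton_eq_iff)
  moreover have m: "Suc k mod length vs < length vs" "Suc k' mod length vs < length vs" using N_pos by auto
  ultimately have "k = Suc k' mod length vs" "k' = Suc k mod length vs"
    unfolding next_vertex_def
    using nth_eq_iff_index_eq[OF vs(1) assms(1) m(2)] nth_eq_iff_index_eq[OF vs(1) assms(2) m(1)] by simp_all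
  moreover have "Suc i mod length vs = (if Suc i = length vs then 0 else Suc i)" if "i < length vs" for i
    using that by simp
  ultimately show False using assms(1,2) vs(2) by (auto split: if_splits)
qed

lemma spine_points:
  assumes "x \<in> realization C"
  obtains k t where "k < length vs" "0 \<le> t" "t < 1" "x = epoint (vs ! k) (next_vertex k) t"
  using assms
proof (cases rule: realization_cases)
  case (1 v)
  then obtain k where "k < length vs" "v = vs ! k" by (auto simp: verts_C in_set_conv_nth)
  then show ?thesis using that[of k 0] 1 by simp
next
  case (2 e)
  then obtain k where k: "k < length vs" "e = {vs ! k, next_vertex k}" unfolding edges_C_iff by blast
  then obtain t where "t \<in> {0<..<1}" "x = epoint (vs ! k) (next_vertex k) t"
    using 2(2) open_edge_pair[OF next_vertex_neq[OF k(1)]] by auto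
  then show ?thesis using that[of k t] k by simp
qed

lemma spine_points_in: "k < length vs \<Longrightarrow> t \<in> {0..1} \<Longrightarrow> epoint (vs ! k) (next_vertex k) t \<in> realization C"
proof (rule closed_edge_subset_realization)
  assume k: "k < length vs" and t: "t \<in> {0..1}"
  show "{vs ! k, next_vertex k} \<in> edges C" using k unfolding edges_C_iff by blast
  show "vs ! k \<noteq> next_vertex k" by (rule next_vertex_neq[OF k])
  show "vs ! k \<in> verts C" "next_vertex k \<in> verts C" unfolding verts_C using next_in_spine k by simp_all
  show "t \<in> {0..1}" by (rule t)
qed

lemma planar_spine:
  assumes k: "k < length vs" and t: "t \<in> {0..1}"
  shows "planar (epoint (vs ! k) (next_vertex k) t) = cis (\<theta> k + t * (\<theta> (Suc k) - \<theta> k))"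
proof -
  let ?x = "epoint (vs ! k) (next_vertex k) t"
  define k' where "k' = spine_edge_of ?x"
  have "k' < length vs \<and> ?x \<in> epoint (vs ! k') (next_vertex k') ` {0..1}"
    unfolding k'_def spine_edge_of_def by (rule someI[of _ k]) (use k t in auto)
  then obtain t' where k': "k' < length vs" and t': "t' \<in> {0..1}" "?x = epoint (vs ! k') (next_vertex k') t'" by auto
  have ne: "vs ! k \<noteq> next_vertex k" "vs ! k' \<noteq> next_vertex k'" using next_vertex_neq k k' by auto
  have p: "planar ?x = cis (\<theta> k' + t' * (\<theta> (Suc k') - \<theta> k'))"
    using spine_points_in[OF k t] ne unfolding planar_def Let_def k'_def[symmetric] by (simp add: t'(2))
  have vertex: "cis (\<theta> i + s * (\<theta> (Suc i) - \<theta> i)) = pos v"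
    if "i < length vs" "epoint (vs ! i) (next_vertex i) s = vpoint v" for i s v
  proof -
    have ni: "vs ! i \<noteq> next_vertex i" using next_vertex_neq that(1) by auto
    have "s = 0 \<or> s = 1"
      using weight_support_epoint[OF ni, of s] that(2) ni by (metis insert_iff singletonD weight_support_vpoint)
    then show ?thesis
    proof
      assume "s = 0"
      then show ?thesis using that pos_spine[OF that(1)] by simp
    next
      assume "s = 1"
      then show ?thesis using that cis_angle_mod[OF that(1)] by simp
    qed
  qed
  show ?thesis
  proof (cases "t = 0 \<or> t = 1")
    case True
    then obtain v where "?x = vpoint v" by auto
    then show ?thesis using vertex[OF k, of t v] vertex[OF k', of t' v] t'(2) p by simp
  next
    case False
    then have "weight_support ?x = {vs ! k, next_vertex k}" using weight_support_epoint ne by metis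
    moreover have "t' \<noteq> 0 \<and> t' \<noteq> 1"
    proof -
      have "card (weight_support ?x) = 2" using calculation ne by simp
      then show ?thesis using t'(2) by (metis card_1_singleton_iff epoint_0 epoint_1 numeral_eq_one_iff semiring_norm(85) weight_support_vpoint One_nat_def)
    qed
    then have "weight_support ?x = {vs ! k', next_vertex k'}" using weight_support_epoint ne t' by metis
    ultimately have "k = k'" using spine_edge_index_unique k k' by metis
    then have "t = t'" using t'(2) inj_epoint[OF ne(1)] by simp
    then show ?thesis using p \<open>k = k'\<close> by simp
  qed
qed

lemma angle_mono: "i \<le> j \<Longrightarrow> j \<le> length vs \<Longrightarrow> \<theta> i \<le> \<theta> j"
proof (induction j)
  case (Suc j)
  then show ?case using angle(1)[of j] by (cases "i = Suc j") auto
qed simp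

text \<open>Each point of the spine is written with a parameter \<open>t < 1\<close> on a unique edge, and then its angle
  runs through a half-open turn exactly once.\<close>

lemma inj_on_planar_spine: "inj_on planar (realization C)"
proof (rule inj_onI)
  fix x y assume x: "x \<in> realization C" and y: "y \<in> realization C" and eq: "planar x = planar y"
  obtain k t where k: "k < length vs" "0 \<le> t" "t < 1" "x = epoint (vs ! k) (next_vertex k) t"
    using spine_points[OF x] by metis
  obtain l s where l: "l < length vs" "0 \<le> s" "s < 1" "y = epoint (vs ! l) (next_vertex l) s"
    using spine_points[OF y] by metis
  define \<alpha> where "\<alpha> k t = \<theta> k + t * (\<theta> (Suc k) - \<theta> k)" for k t
  have bnd: "\<theta> i \<le> \<alpha> i r \<and> \<alpha> i r < \<theta> (Suc i)" if "i < length vs" "0 \<le> r" "r < 1" for i r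
  proof -
    have "0 < \<theta> (Suc i) - \<theta> i" using angle(1)[OF that(1)] by simp
    then have "0 < (1 - r) * (\<theta> (Suc i) - \<theta> i)" "0 \<le> r * (\<theta> (Suc i) - \<theta> i)"
      using that by simp_all
    then show ?thesis unfolding \<alpha>_def by (simp add: algebra_simps)
  qed
  have per: "\<theta> 0 \<le> \<alpha> i r \<and> \<alpha> i r < \<theta> 0 + 2 * pi" if "i < length vs" "0 \<le> r" "r < 1" for i r
    using bnd[OF that] angle_mono[of 0 i] angle_mono[of "Suc i" "length vs"] angle(2) that by auto
  have "cis (\<alpha> k t) = cis (\<alpha> l s)"
    using eq k l planar_spine[of k t] planar_spine[of l s] by (simp add: \<alpha>_def)
  then have a: "\<alpha> k t = \<alpha> l s"
    using per[OF k(1-3)] per[OF l(1-3)] by (intro cis_eq_in_period[of _ _ "\<theta> 0"]) auto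
  have "k = l"
  proof (rule ccontr)
    assume "k \<noteq> l"
    then consider "k < l" | "l < k" by linarith
    then show False
    proof cases
      case 1
      then have "\<theta> (Suc k) \<le> \<theta> l" using l by (intro angle_mono) auto
      then show False using bnd[OF k(1-3)] bnd[OF l(1-3)] a by simp
    next
      case 2
      then have "\<theta> (Suc l) \<le> \<theta> k" using k by (intro angle_mono) auto
      then show False using bnd[OF k(1-3)] bnd[OF l(1-3)] a by simp
    qed
  qed
  then have "t = s" using a angle(1)[OF k(1)] by (simp add: \<alpha>_def)
  then show "x = y" using k l \<open>k = l\<close> by simp
qed

lemma planar_spine_image: "planar ` realization C = sphere 0 1"
proof (intro equalityI subsetI)
  fix z assume "z \<in> planar ` realization C"
  then obtain x where x: "x \<in> realization C" "z = planar x" by blast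
  then obtain k t where "k < length vs" "0 \<le> t" "t < 1" "x = epoint (vs ! k) (next_vertex k) t"
    using spine_points by metis
  then show "z \<in> sphere 0 1" using planar_spine[of k t] x by simp
next
  fix z :: complex assume "z \<in> sphere 0 1"
  then have "cmod z = 1" by simp
  then have "(Re z)\<^sup>2 + (Im z)\<^sup>2 = 1" by (metis cmod_power2 one_power2)
  then obtain t where t: "0 \<le> t" "t < 2 * pi" "Re z = cos t" "Im z = sin t" by (rule sincos_total_2pi)
  define \<phi> where "\<phi> = (if \<theta> 0 \<le> t then t else t + 2 * pi)"
  have z: "z = cis \<phi>" using t by (simp add: \<phi>_def complex_eq_iff)
  have \<phi>: "\<theta> 0 \<le> \<phi>" "\<phi> < \<theta> (length vs)" using t angle by (auto simp: \<phi>_def)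
  define j where "j = (LEAST j. \<phi> < \<theta> j)"
  have j: "\<phi> < \<theta> j" unfolding j_def by (rule LeastI[of _ "length vs"]) (rule \<phi>)
  have jN: "j \<le> length vs" unfolding j_def by (rule Least_le) (rule \<phi>)
  have "j \<noteq> 0" using j \<phi>(1) by (intro notI) simp
  then obtain k where k: "j = Suc k" by (cases j) auto
  have "\<not> \<phi> < \<theta> k" using not_less_Least[of k "\<lambda>j. \<phi> < \<theta> j"] k j_def by simp
  then have kk: "\<theta> k \<le> \<phi>" "\<phi> < \<theta> (Suc k)" "k < length vs" using j k jN by auto
  define s where "s = (\<phi> - \<theta> k) / (\<theta> (Suc k) - \<theta> k)"
  have s: "s \<in> {0..1}" "s * (\<theta> (Suc k) - \<theta> k) = \<phi> - \<theta> k" using kk by (auto simp: s_def)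
  have "planar (epoint (vs ! k) (next_vertex k) s) = z"
    using planar_spine[OF kk(3) s(1)] s(2) z by simp
  then show "z \<in> planar ` realization C" using spine_points_in[OF kk(3) s(1)] by (metis imageI)
qed

lemma pos_on_circle: "v \<in> set vs \<Longrightarrow> cmod (pos v) = 1"
  using pos_spine by (auto simp: in_set_conv_nth)

lemma inj_on_pos_spine: "inj_on pos (set vs)"
proof (rule inj_onI)
  fix v w assume "v \<in> set vs" "w \<in> set vs" "pos v = pos w"
  moreover have "planar (vpoint u) = pos u" if u: "u \<in> set vs" for u
  proof -
    obtain k where "k < length vs" "u = vs ! k" using u by (auto simp: in_set_conv_nth)
    then show ?thesis using planar_spine[of k 0] pos_spine by simp
  qed
  ultimately have "planar (vpoint v) = planar (vpoint w)" by simp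
  moreover have "vpoint v \<in> realization C" "vpoint w \<in> realization C"
    using \<open>v \<in> set vs\<close> \<open>w \<in> set vs\<close> verts_C by auto
  ultimately show "v = w" using inj_on_planar_spine by (metis inj_onD vpoint_eq_iff)
qed

lemma planar_vpoint: "v \<in> verts G \<Longrightarrow> planar (vpoint v) = pos v"
proof (cases "v \<in> set vs")
  case True
  then obtain k where "k < length vs" "v = vs ! k" by (auto simp: in_set_conv_nth)
  then show ?thesis using planar_spine[of k 0] pos_spine by simp
next
  assume v: "v \<in> verts G"
  case False
  then have "vpoint v \<notin> realization C" using realization_subgraph_iff(1)[OF G C] verts_C by simp
  then have "planar (vpoint v) = (\<Sum>w\<in>verts G. vpoint v w *\<^sub>R pos w)" by (simp add: planar_def)
  also have "\<dots> = (\<Sum>w\<in>{v}. vpoint v w *\<^sub>R pos w)"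
    by (rule sum.mono_neutral_right) (use v finite_verts in auto)
  finally show ?thesis by simp
qed

lemma chord_epoint_off_spine:
  assumes "{a, b} \<in> chords" "0 < t" "t < 1"
  shows "epoint a b t \<in> open_edge {a, b}" "epoint a b t \<in> realization G - realization C"
proof -
  show o: "epoint a b t \<in> open_edge {a, b}"
    using assms edge_ends[of a b] by (auto simp: open_edge_pair)
  then show "epoint a b t \<in> realization G - realization C"
    using realization_subgraph_iff(2)[OF G C, of "{a, b}"] open_edge_subset_realization[of "{a, b}" G] assms by auto
qed

lemma planar_chord_epoint:
  assumes e: "{a, b} \<in> chords" and t: "t \<in> {0..1}"
  shows "planar (epoint a b t) = (1 - t) *\<^sub>R pos a + t *\<^sub>R pos b"
proof -
  have ab: "a \<noteq> b" "a \<in> verts G" "b \<in> verts G" using edge_ends e by auto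
  consider "t = 0" | "t = 1" | "0 < t" "t < 1" using t by force
  then show ?thesis
  proof cases
    case 3
    then have "epoint a b t \<notin> realization C" using chord_epoint_off_spine[OF e] by auto
    then have "planar (epoint a b t) = (\<Sum>w\<in>verts G. epoint a b t w *\<^sub>R pos w)" by (simp add: planar_def)
    also have "\<dots> = (\<Sum>w\<in>{a, b}. epoint a b t w *\<^sub>R pos w)"
      by (rule sum.mono_neutral_right) (use ab finite_verts in auto)
    finally show ?thesis using ab by simp
  qed (use planar_vpoint ab in auto)
qed

lemma pos_edge_neq: "{a, b} \<in> edges G \<Longrightarrow> pos a \<noteq> pos b"
proof
  assume e: "{a, b} \<in> edges G" and eq: "pos a = pos b"
  have ab: "a \<noteq> b" "a \<in> verts G" "b \<in> verts G" using edge_ends e by auto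
  have "\<not> (a \<notin> set vs \<and> b \<notin> set vs)" using meets[OF e] by auto
  then show False
    using inj_onD[OF inj_on_pos_spine eq] ab eq pos_off[of a] pos_off[of b] pos_on_circle[of a] pos_on_circle[of b]
    by (metis DiffI less_irrefl)
qed

lemma planar_epoint_in_seg:
  assumes "{a, b} \<in> chords" "0 < t" "t < 1"
  shows "planar (epoint a b t) \<in> seg a b"
  using planar_chord_epoint[of a b t] pos_edge_neq[of a b] assms by (auto simp: in_segment)

lemma planar_off_spine:
  assumes "x \<in> realization G - realization C"
  shows "cmod (planar x) < 1"
proof -
  have x: "x \<in> realization G" using assms by simp
  then show ?thesis
  proof (cases rule: realization_cases)
    case (1 v)
    then have "v \<notin> set vs" using assms realization_subgraph_iff(1)[OF G C] verts_C by auto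
    then show ?thesis using 1 planar_vpoint pos_off by simp
  next
    case (2 e)
    obtain a b where ab: "a \<noteq> b" "e = {a, b}" "a \<in> verts G" "b \<in> verts G" using simple_graph_edgeE[OF G 2(1)] by metis
    have e: "{a, b} \<in> chords" using 2 assms ab realization_subgraph_iff(2)[OF G C 2(1,2)] by auto
    obtain t where t: "0 < t" "t < 1" "x = epoint a b t" using 2(2) ab by (auto simp: open_edge_pair)
    have p: "planar x = (1 - t) *\<^sub>R pos a + t *\<^sub>R pos b" using planar_chord_epoint[OF e, of t] t by simp
    have le: "cmod (pos v) \<le> 1" if "v \<in> verts G" for v
      using that pos_off[of v] pos_on_circle[of v] by (cases "v \<in> set vs") auto
    have "0 \<le> 1 - (cmod (pos v))\<^sup>2" if "v \<in> verts G" for v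
      using le[OF that] by (simp add: power_le_one)
    then have "0 \<le> (1 - t) * (1 - (cmod (pos a))\<^sup>2)" "0 \<le> t * (1 - (cmod (pos b))\<^sup>2)"
      using t ab by simp_all
    moreover have "0 < t * (1 - t) * (cmod (pos a - pos b))\<^sup>2"
      using t pos_edge_neq[of a b] e by simp
    ultimately have "(cmod (planar x))\<^sup>2 < 1"
      using chord_norm[of t "pos a" "pos b"] unfolding p by linarith
    then show ?thesis by (simp add: power_less_one_iff abs_square_less_1)
  qed
qed

lemma planar_on_spine: "x \<in> realization C \<Longrightarrow> cmod (planar x) = 1"
  using planar_spine_image by (metis imageI mem_sphere_0)

end

section \<open>Levels from colours\<close>

text \<open>The imaginary part of \<open>cnj w * w'\<close> is the determinant of \<open>w\<close> and \<open>w'\<close>.\<close>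

lemma Im_cnj_mult_parallel:
  fixes w w' :: complex
  assumes "s *\<^sub>R w = t *\<^sub>R w'" "t \<noteq> 0"
  shows "Im (cnj w * w') = 0"
proof -
  have "w' = (s / t) *\<^sub>R w" using arg_cong[OF assms(1), of "\<lambda>z. z /\<^sub>R t"] assms(2) by (simp add: field_simps)
  then show ?thesis by simp
qed

text \<open>The stage \<open>D i\<close> collects the fragments from which every descending chain of crossings has at most
  \<open>i\<close> members, and level \<open>i\<close> is what stage \<open>i\<close> adds.  Colours decrease along chains, so stage \<open>M\<close> is
  everything.  The last level is the first stage at which everything is present, since stages stop
  growing for good once they stop growing; this also makes all levels nonempty.\<close>

lemma level_partition_exists:
  fixes F :: "('a \<Rightarrow> real) \<Rightarrow> space3"
  assumes M: "1 \<le> M"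
    and col: "\<And>A. A \<in> fragments G C \<Longrightarrow> c A \<in> {1..M}"
    and dec: "\<And>A B. A \<in> fragments G C \<Longrightarrow> B \<in> fragments G C \<Longrightarrow> B \<noteq> A \<Longrightarrow> crosses_over F A B \<Longrightarrow> c B < c A"
  obtains n L where "n \<le> M" "level_partition G C F n L"
proof -
  let ?R = "\<lambda>A B. B \<noteq> A \<and> crosses_over F A B"
  let ?\<F> = "fragments G C"
  define D where "D = rec_nat {} (\<lambda>_ X. {A \<in> ?\<F>. \<forall>B\<in>?\<F>. ?R A B \<longrightarrow> B \<in> X})"
  have D0: "D 0 = {}" and DS: "D (Suc i) = {A \<in> ?\<F>. \<forall>B\<in>?\<F>. ?R A B \<longrightarrow> B \<in> D i}" for i
    by (simp_all add: D_def)
  have Dsub: "D i \<subseteq> ?\<F>" for i by (cases i) (auto simp: D0 DS)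
  have D1: "D i \<subseteq> D (Suc i)" for i
  proof (induction i)
    case (Suc i)
    then show ?case unfolding DS[of "Suc i"] DS[of i] by blast
  qed (simp add: D0)
  have mono: "i \<le> j \<Longrightarrow> D i \<subseteq> D j" for i j using lift_Suc_mono_le[of D i j] D1 by blast
  have rank: "A \<in> D i" if "A \<in> ?\<F>" "c A \<le> i" for A i
    using that
  proof (induction i arbitrary: A)
    case 0
    then show ?case using col[of A] by simp
  next
    case (Suc i)
    have "B \<in> D i" if "B \<in> ?\<F>" "?R A B" for B
      using dec[OF Suc.prems(1) that(1)] that Suc by auto
    then show ?case using Suc.prems(1) unfolding DS by blast
  qed
  have DM: "D M = ?\<F>" using rank col Dsub[of M] by fastforce
  define n where "n = (LEAST n. 1 \<le> n \<and> D n = ?\<F>)"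
  have n: "1 \<le> n" "D n = ?\<F>" using LeastI[of "\<lambda>n. 1 \<le> n \<and> D n = ?\<F>" M] DM M by (auto simp: n_def)
  have nM: "n \<le> M" unfolding n_def by (rule Least_le) (use DM M in auto)
  have stable: "D j = D i" if "D (Suc i) = D i" "i \<le> j" for i j
    using that(2)
  proof (induction j rule: dec_induct)
    case (step j)
    then show ?case unfolding DS[of j] using that(1) unfolding DS[of i] by simp
  qed simp
  define L where "L i = D i - D (i - 1)" for i
  have cover: "D j = (\<Union>k\<in>{1..j}. L k)" for j
  proof (induction j)
    case (Suc j)
    have "D (Suc j) = D j \<union> L (Suc j)" using D1[of j] by (auto simp: L_def)
    moreover have "{1..Suc j} = insert (Suc j) {1..j}" by auto
    ultimately show ?case using Suc by auto
  qed (simp add: D0)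
  have "level_partition G C F n L"
    unfolding level_partition_def
  proof (intro conjI ballI impI)
    show "(\<Union>i\<in>{1..n}. L i) = ?\<F>" using cover[of n] n by simp
    show "L i \<inter> L j = {}" if "i \<in> {1..n}" "j \<in> {1..n}" "i \<noteq> j" for i j
    proof -
      have *: "L i \<inter> L j = {}" if "i < j" for i j
      proof -
        have "i \<le> j - 1" using that by linarith
        then show ?thesis using mono[of i "j - 1"] by (auto simp: L_def)
      qed
      show ?thesis using *[of i j] *[of j i] that(3) by (cases "i < j") auto
    qed
    show "L i \<noteq> {}" if i: "i \<in> {2..n}" for i
    proof
      assume "L i = {}"
      then have "D i \<subseteq> D (i - 1)" by (auto simp: L_def)
      moreover have "Suc (i - 1) = i" "i - 1 \<le> n" using i by auto
      ultimately have "D (Suc (i - 1)) = D (i - 1)" using D1[of "i - 1"] by simp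
      then have "D n = D (i - 1)" by (rule stable) fact
      moreover have "1 \<le> i - 1" using i by auto
      ultimately have "1 \<le> i - 1 \<and> D (i - 1) = ?\<F>" using n(2) by simp
      then have "n \<le> i - 1" unfolding n_def by (rule Least_le)
      then show False using i by auto
    qed
    show "L 1 = {A \<in> ?\<F>. \<forall>B\<in>?\<F>. B \<noteq> A \<longrightarrow> \<not> crosses_over F A B}"
      using DS[of 0] by (auto simp: L_def D0)
    fix i assume i: "i \<in> {2..n}"
    obtain j where j: "i = Suc (Suc j)" using i by (metis Suc_le_D atLeastAtMost_iff numeral_2_eq_2 Suc_le_mono)
    have Dj: "(\<forall>B\<in>?\<F>. ?R A B \<longrightarrow> (\<exists>k\<in>{1..<i}. B \<in> L k)) \<longleftrightarrow> (\<forall>B\<in>?\<F>. ?R A B \<longrightarrow> B \<in> D (Suc j))" for A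
    proof -
      have "{1..<i} = {1..Suc j}" using j by auto
      then show ?thesis using cover[of "Suc j"] by auto
    qed
    have "L i = D (Suc (Suc j)) - D (Suc j)" using j by (simp add: L_def)
    also have "\<dots> = {A \<in> ?\<F>. (\<exists>B\<in>D (Suc j) - D j. ?R A B) \<and> (\<forall>B\<in>?\<F>. ?R A B \<longrightarrow> B \<in> D (Suc j))}"
    proof (intro equalityI subsetI)
      fix A assume A: "A \<in> D (Suc (Suc j)) - D (Suc j)"
      then have AF: "A \<in> ?\<F>" using Dsub by blast
      have "\<forall>B\<in>?\<F>. ?R A B \<longrightarrow> B \<in> D (Suc j)" using A unfolding DS[of "Suc j"] by blast
      moreover obtain B where "B \<in> ?\<F>" "?R A B" "B \<notin> D j" using A AF unfolding DS[of j] by blast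
      ultimately show "A \<in> {A \<in> ?\<F>. (\<exists>B\<in>D (Suc j) - D j. ?R A B) \<and> (\<forall>B\<in>?\<F>. ?R A B \<longrightarrow> B \<in> D (Suc j))}"
        using AF by blast
    next
      fix A assume A: "A \<in> {A \<in> ?\<F>. (\<exists>B\<in>D (Suc j) - D j. ?R A B) \<and> (\<forall>B\<in>?\<F>. ?R A B \<longrightarrow> B \<in> D (Suc j))}"
      then obtain B where B: "B \<in> D (Suc j)" "B \<notin> D j" "?R A B" by blast
      then have "A \<notin> D (Suc j)" unfolding DS[of j] using Dsub by blast
      moreover have "A \<in> D (Suc (Suc j))" using A unfolding DS[of "Suc j"] by blast
      ultimately show "A \<in> D (Suc (Suc j)) - D (Suc j)" by blast
    qed
    also have "D (Suc j) - D j = L (i - 1)" using j by (simp add: L_def)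
    finally show "L i = {A \<in> ?\<F>. (\<exists>B\<in>L (i - 1). ?R A B) \<and> (\<forall>B\<in>?\<F>. ?R A B \<longrightarrow> (\<exists>k\<in>{1..<i}. B \<in> L k))}"
      unfolding Dj .
  qed (use n in simp)
  then show ?thesis using that nM by blast
qed

section \<open>Crossings of straight chords\<close>

context chord_drawing
begin

lemma off_spine_cases:
  assumes "x \<in> realization G - realization C"
  obtains v where "v \<in> verts G - set vs" "x = vpoint v"
    | a b t where "{a, b} \<in> chords" "0 < t" "t < 1" "x = epoint a b t"
proof -
  have "x \<in> realization G" using assms by simp
  then show ?thesis
  proof (cases rule: realization_cases)
    case (1 v)
    then show ?thesis using that(1) assms realization_subgraph_iff(1)[OF G C] verts_C by auto
  next
    case (2 e)
    obtain a b where ab: "a \<noteq> b" "e = {a, b}" using simple_graph_edgeE[OF G 2(1)] by metis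
    moreover have "e \<in> chords" using 2 assms realization_subgraph_iff(2)[OF G C 2(1,2)] by auto
    moreover obtain t where "0 < t" "t < 1" "x = epoint a b t" using 2(2) ab by (auto simp: open_edge_pair)
    ultimately show ?thesis using that(2) by blast
  qed
qed

lemma fst_drawing [simp]: "fst (drawing x) = planar x" "(fst \<circ> drawing) = planar"
  by (auto simp: drawing_def)

lemma chord_point:
  assumes "e \<in> chords" "x \<in> open_edge e"
  shows "x \<in> realization G - realization C" "weight_support x = e"
  using assms open_edge_subset_realization[of e G] realization_subgraph_iff(2)[OF G C, of e x]
  by (auto simp: open_edge_def)

lemma planar_chord: "{a, b} \<in> chords \<Longrightarrow> x \<in> open_edge {a, b} \<Longrightarrow> planar x \<in> seg a b"
  using edge_ends[of a b] planar_epoint_in_seg[of a b] by (auto simp: open_edge_pair)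

lemma inj_on_planar_chord:
  assumes "e \<in> chords"
  shows "inj_on planar (open_edge e)"
proof -
  obtain a b where e: "e = {a, b}" using simple_graph_edgeE[OF G, of e] assms by blast
  have ab: "a \<noteq> b" "pos a \<noteq> pos b" using edge_ends pos_edge_neq assms e by auto
  have "s = t" if "s \<in> {0<..<1}" "t \<in> {0<..<1}" "planar (epoint a b s) = planar (epoint a b t)" for s t
  proof -
    have "(1 - s) *\<^sub>R pos a + s *\<^sub>R pos b = (1 - t) *\<^sub>R pos a + t *\<^sub>R pos b"
      using that planar_chord_epoint[of a b s] planar_chord_epoint[of a b t] assms e by simp
    then have "(s - t) *\<^sub>R (pos b - pos a) = 0" by (simp add: algebra_simps)
    then show ?thesis using ab by simp
  qed
  then have "inj_on (planar \<circ> epoint a b) {0<..<1}" unfolding inj_on_def comp_def by blast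
  then show ?thesis unfolding e open_edge_pair[OF ab(1)] by (rule inj_on_imageI)
qed

text \<open>The spine lies on the circle and everything else in the open disc; no off-spine vertex lies on a
  chord; and a single chord is drawn injectively.  What is left are inner points of two chords.\<close>

lemma double_point_edges:
  assumes "x \<in> realization G" "y \<in> realization G" "x \<noteq> y" "planar x = planar y"
  obtains e e' where "e \<in> chords" "e' \<in> chords" "e \<noteq> e'" "x \<in> open_edge e" "y \<in> open_edge e'"
proof -
  have "x \<in> realization C \<longleftrightarrow> y \<in> realization C"
    using planar_on_spine[of x] planar_on_spine[of y] planar_off_spine[of x] planar_off_spine[of y] assms by force
  moreover have "\<not> (x \<in> realization C \<and> y \<in> realization C)"
    using inj_on_planar_spine assms(3,4) unfolding inj_on_def by blast
  ultimately have x: "x \<in> realization G - realization C" and y: "y \<in> realization G - realization C" using assms by auto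
  have vertex_chord: False
    if "v \<in> verts G - set vs" "{a, b} \<in> chords" "0 < t" "t < 1" "planar (vpoint v) = planar (epoint a b t)" for v a b t
    using that off_edge[of v a b] planar_epoint_in_seg[of a b t] planar_vpoint[of v] by auto
  from x show ?thesis
  proof (cases rule: off_spine_cases)
    case (1 v)
    note X = 1
    from y show ?thesis
    proof (cases rule: off_spine_cases)
      case (1 w)
      then show ?thesis using inj_onD[OF pos_off_inj, of v w] X assms planar_vpoint by auto
    qed (use X vertex_chord assms(4) in metis)
  next
    case (2 a b s)
    note X = 2
    from y show ?thesis
    proof (cases rule: off_spine_cases)
      case (2 c d t)
      have m: "x \<in> open_edge {a, b}" "y \<in> open_edge {c, d}" using X 2 chord_epoint_off_spine(1) by simp_all
      then have "{a, b} \<noteq> {c, d}" using inj_on_planar_chord[OF X(1)] assms(3,4) unfolding inj_on_def by metis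
      then show ?thesis using that X(1) 2(1) m by blast
    qed (use X vertex_chord assms(4) in metis)
  qed
qed

text \<open>A second common point would make the chords parallel, against transversality there.\<close>

lemma chords_sharing_vertex:
  assumes "{u, b} \<in> chords" "{u, c} \<in> chords" "b \<noteq> c" "z \<in> seg u b"
  shows "z \<notin> seg u c"
proof
  assume z: "z \<in> seg u c"
  obtain s where s: "0 < s" "z = (1 - s) *\<^sub>R pos u + s *\<^sub>R pos b" using assms(4) by (auto simp: in_segment)
  obtain t where t: "0 < t" "z = (1 - t) *\<^sub>R pos u + t *\<^sub>R pos c" using z by (auto simp: in_segment)
  have "s *\<^sub>R (pos b - pos u) = t *\<^sub>R (pos c - pos u)"
    using s(2) t(2) by (simp add: algebra_simps)
  then have "Im (cnj (pos b - pos u) * (pos c - pos u)) = 0" by (rule Im_cnj_mult_parallel) (use t in simp)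
  moreover have "{u, b} \<noteq> {u, c}" using assms(3) by (auto simp: doubleton_eq_iff)
  ultimately show False using transverse[OF assms(1,2) _ assms(4) z] by blast
qed

text \<open>Two common points would make the chords parallel.\<close>

lemma chords_cross_once:
  assumes "{a, b} \<in> chords" "{c, d} \<in> chords" "{a, b} \<noteq> {c, d}"
    and z: "z \<in> seg a b" "z \<in> seg c d"
    and z': "z' \<in> seg a b" "z' \<in> seg c d"
  shows "z = z'"
proof (rule ccontr)
  assume ne: "z \<noteq> z'"
  obtain s s' where s: "z = (1 - s) *\<^sub>R pos a + s *\<^sub>R pos b" "z' = (1 - s') *\<^sub>R pos a + s' *\<^sub>R pos b"
    using z(1) z'(1) by (auto simp: in_segment)
  obtain t t' where t: "z = (1 - t) *\<^sub>R pos c + t *\<^sub>R pos d" "z' = (1 - t') *\<^sub>R pos c + t' *\<^sub>R pos d"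
    using z(2) z'(2) by (auto simp: in_segment)
  have "(s - s') *\<^sub>R (pos b - pos a) = z - z'" unfolding s by (simp add: algebra_simps)
  moreover have "(t - t') *\<^sub>R (pos d - pos c) = z - z'" unfolding t by (simp add: algebra_simps)
  moreover from this have "t - t' \<noteq> 0" using ne by auto
  ultimately have "Im (cnj (pos b - pos a) * (pos d - pos c)) = 0" using Im_cnj_mult_parallel by metis
  then show False using transverse[OF assms(1-3) z] by blast
qed

lemma fragment_off_spine_cases:
  assumes "A \<in> fragments G C"
  obtains e where "e \<in> chords" "A - realization C = open_edge e"
    | u where "u \<in> verts G - set vs" "A - realization C = open_star G u"
proof -
  obtain K where K: "K \<in> components (realization G - realization C)" "A = closure K"
    using assms by (auto simp: fragments_def)
  have "A - realization C = (realization G - realization C) \<inter> A"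
    using fragment_subset_realization[OF G assms] by blast
  then have "A - realization C = K" using component_closure_off_spine[OF K(1)] K(2) by simp
  moreover have "K \<in> open_edge ` {e \<in> chords. e \<subseteq> verts C} \<union> open_star G ` (verts G - verts C)"
    using K(1) components_spine_complement[OF G C edges_C_subset] meets verts_C by simp
  ultimately show ?thesis using that verts_C by blast
qed

definition fragment_colour :: "('a \<Rightarrow> real) set \<Rightarrow> nat" where
  "fragment_colour A = (SOME c. \<forall>x\<in>A - realization C. col (weight_support x) = c)"

lemma fragment_colour:
  assumes A: "A \<in> fragments G C" and x: "x \<in> A" "x \<notin> realization C"
  shows "col (weight_support x) = fragment_colour A"
proof -
  have "\<exists>c. \<forall>x\<in>A - realization C. col (weight_support x) = c"
    using A
  proof (cases rule: fragment_off_spine_cases)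
    case (1 e)
    then show ?thesis by (auto simp: open_edge_def)
  next
    case (2 u)
    have "col (weight_support x) = col {u}" if "x \<in> open_star G u" for x
    proof -
      have "x \<in> insert (vpoint u) (\<Union>b\<in>{b. {u, b} \<in> edges G}. epoint u b ` {0..<1})"
        using that open_star_eq[OF G, of u] 2(1) by blast
      then consider "x = vpoint u" | b t where "{u, b} \<in> edges G" "x = epoint u b t" "0 \<le> t" "t < 1" by auto
      then show ?thesis
      proof cases
        case (2 b t)
        then show ?thesis
          using weight_support_epoint[of u b t] edge_ends[OF 2(1)] colour_star[OF _ 2(1)] \<open>u \<in> verts G - set vs\<close>
          by (cases "t = 0") auto
      qed simp
    qed
    then show ?thesis using 2 by auto
  qed
  then have "\<forall>x\<in>A - realization C. col (weight_support x) = fragment_colour A"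
    unfolding fragment_colour_def by (rule someI_ex)
  then show ?thesis using x by blast
qed

lemma edge_at: "e \<in> edges G \<Longrightarrow> u \<in> e \<Longrightarrow> \<exists>b. e = {u, b}"
  by (rule simple_graph_edgeE[OF G, of e]) auto

text \<open>A star is the only kind of fragment with several edges, and these share its centre.\<close>

lemma inj_on_planar_fragment:
  assumes A: "A \<in> fragments G C"
  shows "inj_on planar A"
proof (rule inj_onI, rule ccontr)
  fix x y assume xy: "x \<in> A" "y \<in> A" "planar x = planar y" "x \<noteq> y"
  then have G': "x \<in> realization G" "y \<in> realization G" using fragment_subset_realization[OF G A] by auto
  obtain e e' where e: "e \<in> chords" "e' \<in> chords" "e \<noteq> e'" "x \<in> open_edge e" "y \<in> open_edge e'"
    by (rule double_point_edges[OF G' xy(4,3)])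
  have off: "x \<in> A - realization C" "y \<in> A - realization C"
    using xy chord_point(1)[OF e(1,4)] chord_point(1)[OF e(2,5)] by auto
  show False
    using A
  proof (cases rule: fragment_off_spine_cases)
    case (1 g)
    then show ?thesis using off e(3-5) open_edge_disjoint by metis
  next
    case (2 u)
    then have "u \<in> e" "u \<in> e'"
      using off e(4,5) by (auto simp: open_star_def open_edge_def weight_support_def)
    then obtain b c where bc: "e = {u, b}" "e' = {u, c}"
      using edge_at[of e u] edge_at[of e' u] e(1,2) by auto
    then show ?thesis
      using chords_sharing_vertex[of u b c "planar x"] planar_chord[of u b x] planar_chord[of u c y] e xy(3) by auto
  qed
qed

lemma crosses_over_colour:
  assumes A: "A \<in> fragments G C" "B \<in> fragments G C" and cr: "crosses_over drawing A B"
  shows "fragment_colour B < fragment_colour A"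
proof -
  obtain x y where xy: "x \<in> A" "y \<in> B" "planar x = planar y" "snd (drawing y) < snd (drawing x)"
    using cr by (auto simp: crosses_over_def)
  have G': "x \<in> realization G" "y \<in> realization G" using fragment_subset_realization[OF G] A xy by auto
  have "x \<noteq> y" using xy(4) by auto
  obtain e e' where e: "e \<in> chords" "e' \<in> chords" "e \<noteq> e'" "x \<in> open_edge e" "y \<in> open_edge e'"
    by (rule double_point_edges[OF G' \<open>x \<noteq> y\<close> xy(3)])
  note off = chord_point(1)[OF e(1,4)] chord_point(1)[OF e(2,5)]
  then have "0 < 1 - (cmod (planar x))\<^sup>2" using planar_off_spine[OF off(1)]
    by (simp add: abs_square_less_1)
  then have "col (weight_support y) < col (weight_support x)"
    using xy(3,4) by (simp add: drawing_def)
  then show ?thesis using fragment_colour[OF A(1) xy(1)] fragment_colour[OF A(2) xy(2)] off by simp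
qed

lemma fragment_colour_range: "A \<in> fragments G C \<Longrightarrow> fragment_colour A \<in> {1..M}"
proof -
  assume A: "A \<in> fragments G C"
  then show ?thesis
  proof (cases rule: fragment_off_spine_cases)
    case (1 e)
    obtain a b where "a \<noteq> b" "e = {a, b}" using simple_graph_edgeE[OF G, of e] 1(1) by (metis DiffD1)
    then have "open_edge e \<noteq> {}" by (simp add: open_edge_pair)
    then obtain x where x: "x \<in> A - realization C" "x \<in> open_edge e" using 1(2) by blast
    then have "fragment_colour A = col e" using fragment_colour[OF A, of x] by (simp add: open_edge_def)
    then show ?thesis using colour_range(1)[OF 1(1)] by simp
  next
    case (2 u)
    then have "vpoint u \<in> A - realization C" by (auto simp: open_star_def)
    then have "fragment_colour A = col {u}" using fragment_colour[OF A, of "vpoint u"] by simp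
    then show ?thesis using colour_range(3)[OF 2(1)] by simp
  qed
qed

lemma inj_on_drawing: "inj_on drawing (realization G)"
proof (rule inj_onI, rule ccontr)
  fix x y assume xy: "x \<in> realization G" "y \<in> realization G" "drawing x = drawing y" "x \<noteq> y"
  have p: "planar x = planar y" using xy(3) by (simp add: drawing_def)
  obtain e e' where e: "e \<in> chords" "e' \<in> chords" "e \<noteq> e'" "x \<in> open_edge e" "y \<in> open_edge e'"
    by (rule double_point_edges[OF xy(1,2,4) p])
  have "cmod (planar x) < 1" using planar_off_spine chord_point(1)[OF e(1,4)] by blast
  then have "0 < 1 - (cmod (planar x))\<^sup>2" by (simp add: abs_square_less_1)
  moreover have "col e * (1 - (cmod (planar x))\<^sup>2) = col e' * (1 - (cmod (planar x))\<^sup>2)"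
    using xy(3) p chord_point(2)[OF e(1,4)] chord_point(2)[OF e(2,5)] by (simp add: drawing_def)
  ultimately have "col e = col e'" by simp
  moreover obtain a b c d where "e = {a, b}" "e' = {c, d}"
    using simple_graph_edgeE[OF G, of e] simple_graph_edgeE[OF G, of e'] e(1,2) by (metis DiffD1)
  ultimately show False
    using same_colour[of a b c d "planar x"] planar_chord[of a b x] planar_chord[of c d y] e p by auto
qed

lemma continuous_on_closed_edge:
  fixes q :: "real \<Rightarrow> 'c::topological_space"
  assumes "a \<noteq> b" "continuous_on {0..1} q" "\<And>t. t \<in> {0..1} \<Longrightarrow> f (epoint a b t) = q t"
  shows "continuous_on (epoint a b ` {0..1}) f"
proof (rule continuous_on_eq[of _ "\<lambda>x. q (x b)"])
  show "continuous_on (epoint a b ` {0..1}) (\<lambda>x. q (x b))"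
    by (rule continuous_on_compose2[OF assms(2)]) (use assms(1) in \<open>auto intro: continuous_on_coordinate\<close>)
  show "\<And>x. x \<in> epoint a b ` {0..1} \<Longrightarrow> q (x b) = f x" using assms by auto
qed

lemma drawing_spine: "x \<in> realization C \<Longrightarrow> drawing x = (planar x, 0)"
  using planar_on_spine[of x] by (simp add: drawing_def)

text \<open>The formula extends to the ends of the chord: on the spine both heights vanish, and at an
  off-spine vertex the colour of the vertex is that of its edges.\<close>

lemma drawing_chord:
  assumes e: "{a, b} \<in> chords" and t: "t \<in> {0..1}"
  shows "drawing (epoint a b t) = (let p = (1 - t) *\<^sub>R pos a + t *\<^sub>R pos b in (p, col {a, b} * (1 - (cmod p)\<^sup>2)))"
proof (cases "t = 0 \<or> t = 1")
  case False
  then show ?thesis using planar_chord_epoint[OF e t] weight_support_epoint[of a b t] edge_ends[of a b] e t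
    by (simp add: drawing_def Let_def)
next
  case True
  have ab: "a \<in> verts G" "b \<in> verts G" "{a, b} \<in> edges G" "{b, a} \<in> edges G"
    using edge_ends e by (auto simp: insert_commute)
  have *: "real (col {v}) * (1 - (cmod (pos v))\<^sup>2) = real (col {v, w}) * (1 - (cmod (pos v))\<^sup>2)"
    if "v \<in> verts G" "{v, w} \<in> edges G" for v w
    using colour_star[of v w] pos_on_circle[of v] that by (cases "v \<in> set vs") auto
  show ?thesis using True *[OF ab(1,3)] *[OF ab(2,4)] planar_vpoint ab
    by (auto simp: drawing_def Let_def insert_commute)
qed

lemma continuous_on_drawing: "continuous_on (realization G) drawing"
proof -
  let ?E = "{(a, b). a \<in> verts G \<and> b \<in> verts G \<and> a \<noteq> b \<and> {a, b} \<in> edges G}"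
  have fin: "finite ?E" by (rule finite_subset[of _ "verts G \<times> verts G"]) (use finite_verts in auto)
  have ch: "continuous_on (epoint a b ` {0..1}) drawing" if e: "{a, b} \<in> chords" for a b
  proof (rule continuous_on_closed_edge)
    show "a \<noteq> b" using edge_ends e by blast
    show "drawing (epoint a b t) = ((1 - t) *\<^sub>R pos a + t *\<^sub>R pos b,
        col {a, b} * (1 - (cmod ((1 - t) *\<^sub>R pos a + t *\<^sub>R pos b))\<^sup>2))" if "t \<in> {0..1}" for t
      using drawing_chord[OF e that] by (simp add: Let_def)
  qed (intro continuous_intros)
  have sp: "continuous_on (epoint (vs ! k) (next_vertex k) ` {0..1}) drawing" if k: "k < length vs" for k
  proof (rule continuous_on_closed_edge[OF next_vertex_neq[OF k]])
    show "drawing (epoint (vs ! k) (next_vertex k) t) = (cis (\<theta> k + t * (\<theta> (Suc k) - \<theta> k)), 0)" if "t \<in> {0..1}" for t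
      using drawing_spine[OF spine_points_in[OF k that]] planar_spine[OF k that] by simp
  qed (auto intro!: continuous_intros)
  have swap: "epoint b a ` {0..1} = epoint a b ` {0..1}" for a b :: 'a
    using walk_points_rev[of "[a, b]"] by (simp add: walk_points_Cons2)
  have "continuous_on (epoint a b ` {0..1}) drawing" if "(a, b) \<in> ?E" for a b
  proof (cases "{a, b} \<in> edges C")
    case True
    then obtain k where k: "k < length vs" "{a, b} = {vs ! k, next_vertex k}" unfolding edges_C_iff by blast
    then have "a = vs ! k \<and> b = next_vertex k \<or> b = vs ! k \<and> a = next_vertex k" by (auto simp: doubleton_eq_iff)
    then show ?thesis using sp[OF k(1)] swap by metis
  qed (use ch that in auto)
  then have "continuous_on (\<Union>(a, b)\<in>?E. epoint a b ` {0..1}) drawing"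
    using fin by (intro continuous_on_closed_Union)
      (auto intro!: compact_imp_closed compact_continuous_image continuous_on_epoint)
  moreover have "continuous_on (vpoint ` verts G) drawing"
    using finite_verts by (intro continuous_on_finite) auto
  moreover have "closed (\<Union>(a, b)\<in>?E. epoint a b ` {0..1})"
    using fin by (intro closed_UN) (auto intro!: compact_imp_closed compact_continuous_image continuous_on_epoint)
  moreover have "closed (vpoint ` verts G)" using finite_verts by (intro finite_imp_closed) auto
  ultimately show ?thesis
    unfolding realization_eq_closed_edges[OF G] by (intro continuous_on_closed_Un) auto
qed

lemma double_pair_drawing_edges:
  assumes "double_pair G drawing x y"
  obtains e e' where "e \<in> chords" "e' \<in> chords" "e \<noteq> e'" "x \<in> open_edge e" "y \<in> open_edge e'"
proof -
  have "x \<in> realization G" "y \<in> realization G" "x \<noteq> y" "planar x = planar y"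
    using assms by (simp_all add: double_pair_def)
  then show ?thesis by (rule double_point_edges) (rule that)
qed

lemma inj_on_planar_open_edge:
  assumes "e \<in> edges G"
  shows "inj_on planar (open_edge e)"
proof (cases "e \<in> edges C")
  case True
  then show ?thesis using inj_on_subset[OF inj_on_planar_spine open_edge_subset_realization] by blast
qed (use inj_on_planar_chord assms in blast)

lemma double_pair_unique:
  assumes d: "double_pair G drawing x y" "double_pair G drawing x' y'"
    and w: "weight_support x = weight_support x'" "weight_support y = weight_support y'"
  shows "x = x'" "y = y'"
proof -
  obtain e e' where e: "e \<in> chords" "e' \<in> chords" "e \<noteq> e'" "x \<in> open_edge e" "y \<in> open_edge e'"
    by (rule double_pair_drawing_edges[OF d(1)])
  obtain g g' where g: "g \<in> chords" "g' \<in> chords" "g \<noteq> g'" "x' \<in> open_edge g" "y' \<in> open_edge g'"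
    by (rule double_pair_drawing_edges[OF d(2)])
  have "g = e" "g' = e'" using w e(4,5) g(4,5) by (auto simp: open_edge_def)
  then have x': "x' \<in> open_edge e" "y' \<in> open_edge e'" using g by auto
  obtain a b c d where ab: "e = {a, b}" "e' = {c, d}"
    using simple_graph_edgeE[OF G, of e] simple_graph_edgeE[OF G, of e'] e(1,2) by (metis DiffD1)
  have p: "planar x = planar y" "planar x' = planar y'" using assms(1,2) by (auto simp: double_pair_def)
  have "planar x = planar x'"
    using chords_cross_once[of a b c d "planar x" "planar x'"] planar_chord[of a b x] planar_chord[of a b x']
      planar_chord[of c d y] planar_chord[of c d y'] e x' p unfolding ab by simp
  then show "x = x'" "y = y'"
    using inj_on_planar_chord[OF e(1)] inj_on_planar_chord[OF e(2)] e(4,5) x' p unfolding inj_on_def by auto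
qed

text \<open>In the affine coordinates centred at the crossing whose axes are the directions of the two chords,
  the chords are the axes.  Scaling by \<open>\<epsilon>\<close> keeps the unit ball of these coordinates within the
  parameter ranges of both chords.\<close>

lemma transversal_chords:
  assumes e: "{a, b} \<in> chords" "{c, d} \<in> chords" "{a, b} \<noteq> {c, d}"
    and st: "0 < s" "s < 1" "0 < t" "t < 1"
    and z: "planar (epoint a b s) = planar (epoint c d t)"
  shows "transversal_at G drawing (epoint a b s) (epoint c d t)"
proof -
  let ?x = "epoint a b s" and ?y = "epoint c d t"
  define \<epsilon> where "\<epsilon> = min (min s (1 - s)) (min t (1 - t))"
  have \<epsilon>: "0 < \<epsilon>" "\<epsilon> \<le> s" "\<epsilon> \<le> 1 - s" "\<epsilon> \<le> t" "\<epsilon> \<le> 1 - t" using st by (auto simp: \<epsilon>_def)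
  define p where "p = pos b - pos a"
  define q where "q = pos d - pos c"
  define w where "w = planar ?x"
  have D: "Im (cnj p * q) \<noteq> 0"
    using transverse[OF e planar_epoint_in_seg[OF e(1) st(1,2)]] planar_epoint_in_seg[OF e(2) st(3,4)] z
    by (simp add: p_def q_def)
  define k where "k v = w + \<epsilon> *\<^sub>R (Re v *\<^sub>R p + Im v *\<^sub>R q)" for v
  \<comment> \<open>The inverse of the affine map \<open>k\<close>, by Cramer's rule.\<close>
  define h where "h u = Complex (Im (cnj (u - w) * q) / (\<epsilon> * Im (cnj p * q))) (Im (cnj p * (u - w)) / (\<epsilon> * Im (cnj p * q)))" for u
  have hk: "h (k v) = v" for v
  proof -
    have "Im (cnj (k v - w) * q) = \<epsilon> * Re v * Im (cnj p * q)"
      "Im (cnj p * (k v - w)) = \<epsilon> * Im v * Im (cnj p * q)"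
      by (simp_all add: k_def algebra_simps)
    then show ?thesis using D \<epsilon>(1) by (simp add: h_def complex_eq_iff)
  qed
  have kh: "k (h u) = u" for u
  proof -
    let ?\<delta> = "Im (cnj p * q)"
    have cramer: "?\<delta> *\<^sub>R (u - w) = Im (cnj (u - w) * q) *\<^sub>R p + Im (cnj p * (u - w)) *\<^sub>R q"
      by (simp add: complex_eq_iff algebra_simps)
    have c: "\<epsilon> * (x / (\<epsilon> * ?\<delta>)) = (1 / ?\<delta>) * x" for x using \<epsilon>(1) by simp
    have "k (h u) = w + (1 / ?\<delta>) *\<^sub>R (Im (cnj (u - w) * q) *\<^sub>R p + Im (cnj p * (u - w)) *\<^sub>R q)"
      unfolding k_def h_def complex.sel scaleR_add_right scaleR_scaleR c ..
    also have "\<dots> = u" unfolding cramer[symmetric] using D by simp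
    finally show ?thesis .
  qed
  have hom: "homeomorphism (k ` ball 0 1) (ball 0 1) h k"
    unfolding homeomorphism_def
  proof (intro conjI)
    show "continuous_on (k ` ball 0 1) h" unfolding h_def
      by (intro continuous_intros continuous_on_Complex) (use D \<epsilon>(1) in auto)
    show "continuous_on (ball 0 1) k" unfolding k_def by (intro continuous_intros)
  qed (auto simp: hk kh image_image)
  have "k ` ball 0 1 = h -` ball 0 1"
  proof (intro equalityI subsetI)
    fix u assume "u \<in> h -` ball 0 1"
    then show "u \<in> k ` ball 0 1" using kh[of u] by (intro image_eqI[of u k "h u"]) auto
  qed (auto simp: hk)
  moreover have "continuous_on UNIV h" unfolding h_def
    by (intro continuous_intros continuous_on_Complex) (use D \<epsilon>(1) in auto)
  ultimately have op: "open (k ` ball 0 1)" by (simp add: open_vimage)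
  have near: "openin (top_of_set (realization G)) (epoint i j ` {r - \<epsilon><..<r + \<epsilon>})"
    if ij: "{i, j} \<in> chords" and r: "\<epsilon> \<le> r" "\<epsilon> \<le> 1 - r" for i j r
  proof -
    have ne: "i \<noteq> j" using edge_ends ij by blast
    have "epoint i j ` {r - \<epsilon><..<r + \<epsilon>} = realization G \<inter> (({x. x i \<noteq> 0} \<inter> {x. x j \<noteq> 0}) \<inter> (\<lambda>x. x j) -` {r - \<epsilon><..<r + \<epsilon>})"
    proof (intro equalityI subsetI)
      fix x assume "x \<in> epoint i j ` {r - \<epsilon><..<r + \<epsilon>}"
      then obtain u where u: "x = epoint i j u" "r - \<epsilon> < u" "u < r + \<epsilon>" by auto
      then have "0 < u" "u < 1" using r by auto
      then show "x \<in> realization G \<inter> (({x. x i \<noteq> 0} \<inter> {x. x j \<noteq> 0}) \<inter> (\<lambda>x. x j) -` {r - \<epsilon><..<r + \<epsilon>})"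
        using u ne chord_epoint_off_spine(2)[OF ij] by auto
    next
      fix x assume x: "x \<in> realization G \<inter> (({x. x i \<noteq> 0} \<inter> {x. x j \<noteq> 0}) \<inter> (\<lambda>x. x j) -` {r - \<epsilon><..<r + \<epsilon>})"
      then have "x \<in> realization G" by simp
      then show "x \<in> epoint i j ` {r - \<epsilon><..<r + \<epsilon>}"
      proof (cases rule: realization_cases)
        case (1 v)
        then show ?thesis using x ne by (auto simp: vpoint_def split: if_splits)
      next
        case (2 g)
        then have "i \<in> g" "j \<in> g" using x by (auto simp: open_edge_def weight_support_def)
        moreover obtain i' j' where "g = {i', j'}" using simple_graph_edgeE[OF G 2(1)] by metis
        ultimately have "g = {i, j}" using ne by auto
        then obtain u where "x = epoint i j u" using 2(2) open_edge_pair[OF ne] by auto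
        then show ?thesis using x ne by auto
      qed
    qed
    moreover have "open ((\<lambda>x :: 'a \<Rightarrow> real. x j) -` {r - \<epsilon><..<r + \<epsilon>})" by (intro open_vimage) auto
    ultimately show ?thesis by (auto intro!: openin_open_Int open_Int open_coordinate_ne_0)
  qed
  have line: "planar ` epoint i j ` {r - \<epsilon><..<r + \<epsilon>} = (\<lambda>u. planar (epoint i j r) + (\<epsilon> * u) *\<^sub>R (pos j - pos i)) ` {-1<..<1}"
    if ij: "{i, j} \<in> chords" and r: "\<epsilon> \<le> r" "\<epsilon> \<le> 1 - r" for i j r
  proof -
    have "planar (epoint i j (r + \<epsilon> * u)) = planar (epoint i j r) + (\<epsilon> * u) *\<^sub>R (pos j - pos i)" if "u \<in> {-1<..<1}" for u
    proof -
      have "\<bar>\<epsilon> * u\<bar> < \<epsilon>" using that \<epsilon>(1) by (auto simp: abs_mult abs_less_iff)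
      then have "r + \<epsilon> * u \<in> {0..1}" "r \<in> {0..1}" using r \<epsilon>(1) by auto
      then show ?thesis unfolding planar_chord_epoint[OF ij \<open>r + \<epsilon> * u \<in> {0..1}\<close>] planar_chord_epoint[OF ij \<open>r \<in> {0..1}\<close>]
        by (simp add: algebra_simps)
    qed
    moreover have "{r - \<epsilon><..<r + \<epsilon>} = (\<lambda>u. r + \<epsilon> * u) ` {-1<..<1}"
    proof (intro equalityI subsetI)
      fix v assume "v \<in> {r - \<epsilon><..<r + \<epsilon>}"
      then have "(v - r) / \<epsilon> \<in> {-1<..<1}" "v = r + \<epsilon> * ((v - r) / \<epsilon>)" using \<epsilon>(1) by (auto simp: field_simps)
      then show "v \<in> (\<lambda>u. r + \<epsilon> * u) ` {-1<..<1}" by blast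
    next
      fix v assume "v \<in> (\<lambda>u. r + \<epsilon> * u) ` {-1<..<1}"
      then obtain u where "v = r + \<epsilon> * u" "u \<in> {-1<..<1}" by (rule imageE)
      moreover from this(2) have "-1 < u" "u < 1" by auto
      then have "\<epsilon> * -1 < \<epsilon> * u" "\<epsilon> * u < \<epsilon> * 1" using \<epsilon>(1) by (simp_all only: mult_less_cancel_left_pos)
      ultimately show "v \<in> {r - \<epsilon><..<r + \<epsilon>}" by auto
    qed
    ultimately show ?thesis by (simp add: image_image)
  qed
  have A: "planar ` epoint a b ` {s - \<epsilon><..<s + \<epsilon>} = (\<lambda>u. k (Complex u 0)) ` {-1<..<1}"
    unfolding line[OF e(1) \<epsilon>(2,3)] k_def w_def p_def by simp
  have B: "planar ` epoint c d ` {t - \<epsilon><..<t + \<epsilon>} = (\<lambda>u. k (Complex 0 u)) ` {-1<..<1}"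
    unfolding line[OF e(2) \<epsilon>(4,5)] k_def w_def q_def z by simp
  have ballA: "(\<lambda>u. Complex u 0) ` {-1<..<1} = {v \<in> ball 0 1. Im v = 0}"
  proof (intro equalityI subsetI)
    fix v assume "v \<in> {v \<in> ball 0 1. Im v = 0}"
    then have "v = Complex (Re v) 0" "Re v \<in> {-1<..<1}"
      using abs_Re_le_cmod[of v] by (auto simp: complex_eq_iff)
    then show "v \<in> (\<lambda>u. Complex u 0) ` {-1<..<1}" by blast
  qed (auto simp: cmod_def abs_square_less_1 abs_less_iff)
  have ballB: "(\<lambda>u. Complex 0 u) ` {-1<..<1} = {v \<in> ball 0 1. Re v = 0}"
  proof (intro equalityI subsetI)
    fix v assume "v \<in> {v \<in> ball 0 1. Re v = 0}"
    then have "v = Complex 0 (Im v)" "Im v \<in> {-1<..<1}"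
      using abs_Im_le_cmod[of v] by (auto simp: complex_eq_iff)
    then show "v \<in> (\<lambda>u. Complex 0 u) ` {-1<..<1}" by blast
  qed (auto simp: cmod_def abs_square_less_1 abs_less_iff)
  have "h ` planar ` epoint a b ` {s - \<epsilon><..<s + \<epsilon>} = {v \<in> ball 0 1. Im v = 0}"
    unfolding A ballA[symmetric] by (simp add: image_image hk)
  moreover have "h ` planar ` epoint c d ` {t - \<epsilon><..<t + \<epsilon>} = {v \<in> ball 0 1. Re v = 0}"
    unfolding B ballB[symmetric] by (simp add: image_image hk)
  moreover have "planar ` (epoint a b ` {s - \<epsilon><..<s + \<epsilon>} \<union> epoint c d ` {t - \<epsilon><..<t + \<epsilon>}) \<subseteq> k ` ball 0 1"
    unfolding image_Un A B using ballA ballB by blast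
  ultimately show ?thesis
    unfolding transversal_at_def fst_drawing(2)
    using near[OF e(1) \<epsilon>(2,3)] near[OF e(2) \<epsilon>(4,5)] op hom \<epsilon>(1)
    by (intro exI[of _ "epoint a b ` {s - \<epsilon><..<s + \<epsilon>}"] exI[of _ "epoint c d ` {t - \<epsilon><..<t + \<epsilon>}"]
        exI[of _ "k ` ball 0 1"] exI[of _ h] exI[of _ k]) simp
qed

end

section \<open>Embeddings into the 3-sphere\<close>

definition inverse_stereographic :: "space3 \<Rightarrow> space3 \<times> real" where
  "inverse_stereographic q =
     ((2 / ((norm q)\<^sup>2 + 1)) *\<^sub>R q, ((norm q)\<^sup>2 - 1) / ((norm q)\<^sup>2 + 1))"

lemma inverse_stereographic:
  "inverse_stereographic q \<in> S3" "inverse_stereographic q \<noteq> (0, 1)"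
  "stereographic (inverse_stereographic q) = q"
proof -
  define r where "r = (norm q)\<^sup>2 + 1"
  have r: "r > 0" "(norm q)\<^sup>2 = r - 1" by (auto simp: r_def add_nonneg_pos)
  have I: "inverse_stereographic q = ((2 / r) *\<^sub>R q, (r - 2) / r)"
    by (simp add: inverse_stereographic_def r_def)
  have "(norm (inverse_stereographic q))\<^sup>2 = (2 / r)\<^sup>2 * (r - 1) + ((r - 2) / r)\<^sup>2"
    unfolding I by (simp add: norm_prod_def power_mult_distrib r(2)[symmetric] power_divide abs_if add_divide_distrib)
  also have "\<dots> = 1" using r(1) by (simp add: field_simps power2_eq_square)
  finally have "norm (inverse_stereographic q) = 1" by (simp add: power2_eq_1_iff) (smt (verit) norm_ge_zero)
  then show "inverse_stereographic q \<in> S3" by simp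
  have ne: "(r - 2) / r \<noteq> 1" using r(1) by (simp add: field_simps)
  then show "inverse_stereographic q \<noteq> (0, 1)" unfolding I by simp
  have "1 - (r - 2) / r = 2 / r" using r(1) by (simp add: field_simps)
  then show "stereographic (inverse_stereographic q) = q"
    unfolding I stereographic_def using r(1) by simp
qed

lemma continuous_on_inverse_stereographic: "continuous_on S inverse_stereographic"
proof -
  have "(norm q)\<^sup>2 + 1 \<noteq> 0" for q :: space3 by (smt (verit) zero_le_power2)
  then show ?thesis unfolding inverse_stereographic_def by (intro continuous_intros) auto
qed

lemma inverse_stereographic_equator:
  "norm p = 1 \<Longrightarrow> inverse_stereographic (p, 0) = ((p, 0), 0)"
  by (simp add: inverse_stereographic_def norm_prod_def)

lemma ambient_isotopy_id: "ambient_isotopy (\<lambda>t x. x)"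
proof -
  have "continuous_on ({0..1::real} \<times> S3) (\<lambda>(t, x). x)"
    unfolding case_prod_beta' by (intro continuous_intros)
  moreover have "homeomorphism S3 S3 (\<lambda>x. x) (\<lambda>x. x)" by (simp add: homeomorphism_def)
  ultimately show ?thesis unfolding ambient_isotopy_def by blast
qed

text \<open>Without its vertices, the realization falls apart into open edges.\<close>

lemma connected_off_vertices:
  assumes G: "simple_graph G" and T: "connected T" "T \<noteq> {}" "T \<subseteq> realization G - vertex_points G"
  obtains e where "e \<in> edges G" "T \<subseteq> open_edge e"
proof -
  let ?V = "\<lparr>verts = verts G, edges = {}\<rparr>"
  have V: "realization ?V = vertex_points G" by (simp add: realization_def edge_points_eq vertex_points_eq)
  have meet: "e \<inter> verts ?V \<noteq> {}" if "e \<in> edges G" for e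
    by (rule simple_graph_edgeE[OF G that]) auto
  have comp: "components (realization G - realization ?V) =
      open_edge ` {e \<in> edges G - edges ?V. e \<subseteq> verts ?V} \<union> open_star G ` (verts G - verts ?V)"
    by (rule components_spine_complement[OF G _ _ _ meet]) auto
  obtain K where "K \<in> components (realization G - vertex_points G)" "T \<subseteq> K"
    using exists_component_superset[OF T(3) _ T(1)] T(2,3) by blast
  then show ?thesis using that comp unfolding V by auto
qed

context chord_drawing
begin

lemma drawing_is_diagram: "is_diagram G drawing"
  unfolding is_diagram_def
proof (intro conjI allI impI ballI)
  let ?D = "{(x, y). double_pair G drawing x y}"
  let ?w = "\<lambda>(x, y). (weight_support x, weight_support y)"
  have "inj_on ?w ?D" using double_pair_unique by (auto simp: inj_on_def)
  moreover have "?w ` ?D \<subseteq> Pow (verts G) \<times> Pow (verts G)"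
  proof clarify
    fix x y assume "double_pair G drawing x y"
    then obtain e e' where e: "e \<in> chords" "e' \<in> chords" "e \<noteq> e'" "x \<in> open_edge e" "y \<in> open_edge e'"
      by (rule double_pair_drawing_edges)
    have "e \<subseteq> verts G" if "e \<in> edges G" for e using simple_graph_edgeE[OF G that] by auto
    then show "weight_support x \<in> Pow (verts G) \<and> weight_support y \<in> Pow (verts G)"
      using chord_point(2)[OF e(1,4)] chord_point(2)[OF e(2,5)] e(1,2) by simp
  qed
  ultimately show "finite ?D"
    by (rule inj_on_finite) (use finite_verts in simp)
next
  fix x y assume xy: "double_pair G drawing x y"
  obtain g g' where g: "g \<in> chords" "g' \<in> chords" "g \<noteq> g'" "x \<in> open_edge g" "y \<in> open_edge g'"
    by (rule double_pair_drawing_edges[OF xy])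
  obtain a b where ab: "g = {a, b}" "a \<noteq> b" using simple_graph_edgeE[OF G, of g] g(1) by (metis DiffD1)
  obtain c d where cd: "g' = {c, d}" "c \<noteq> d" using simple_graph_edgeE[OF G, of g'] g(2) by (metis DiffD1)
  note sup = chord_point(2)[OF g(1,4)] chord_point(2)[OF g(2,5)]
  show "x \<notin> vertex_points G" using sup(1) ab by (auto simp: vertex_points_eq)
  show "y \<notin> vertex_points G" using sup(2) cd by (auto simp: vertex_points_eq)
  have eq: "planar x = planar y" using xy by (simp add: double_pair_def)
  obtain s where s: "0 < s" "s < 1" "x = epoint a b s" using g(4) open_edge_pair[OF ab(2)] ab(1) by auto
  obtain t where t: "0 < t" "t < 1" "y = epoint c d t" using g(5) open_edge_pair[OF cd(2)] cd(1) by auto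
  show "transversal_at G drawing x y"
    unfolding s(3) t(3) by (rule transversal_chords) (use g ab cd s t eq in auto)
  fix z assume z: "z \<in> realization G" "fst (drawing z) = fst (drawing x)"
  show "z = x \<or> z = y"
  proof (rule ccontr)
    assume n: "\<not> (z = x \<or> z = y)"
    have "x \<in> realization G" "y \<in> realization G" using xy by (auto simp: double_pair_def)
    then have d: "double_pair G drawing x z" "double_pair G drawing y z"
      using n z eq by (auto simp: double_pair_def)
    obtain i h where h: "i \<in> chords" "h \<in> chords" "i \<noteq> h" "x \<in> open_edge i" "z \<in> open_edge h"
      by (rule double_pair_drawing_edges[OF d(1)])
    obtain j h' where h': "j \<in> chords" "h' \<in> chords" "j \<noteq> h'" "y \<in> open_edge j" "z \<in> open_edge h'"
      by (rule double_pair_drawing_edges[OF d(2)])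
    have "g \<noteq> h" "g' \<noteq> h" using h h' g open_edge_disjoint by metis+
    moreover obtain u v where uv: "h = {u, v}" using simple_graph_edgeE[OF G, of h] h(2) by (metis DiffD1)
    moreover have "planar z = planar x" using z by simp
    ultimately show False
      using no_triple[of a b c d u v "planar x"] planar_chord[of a b x] planar_chord[of c d y] planar_chord[of u v z]
        g h(2,5) eq ab(1) cd(1) by auto
  qed
qed

lemma drawing_semi_leveled: "semi_leveled_diagram G C drawing"
  unfolding semi_leveled_diagram_def fst_drawing
proof (intro conjI ballI impI drawing_is_diagram inj_on_planar_fragment)
  fix A assume A: "A \<in> fragments G C"
  show "\<not> (\<exists>x\<in>A. \<exists>y\<in>realization C. double_pair G drawing x y)"
  proof
    assume "\<exists>x\<in>A. \<exists>y\<in>realization C. double_pair G drawing x y"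
    then obtain x y where xy: "y \<in> realization C" "double_pair G drawing x y" by blast
    obtain e e' where e: "e \<in> chords" "e' \<in> chords" "e \<noteq> e'" "x \<in> open_edge e" "y \<in> open_edge e'"
      by (rule double_pair_drawing_edges[OF xy(2)])
    then show False using chord_point(1)[of e' y] xy(1) by simp
  qed
  show "\<not> (crosses_over drawing A B \<and> crosses_over drawing B A)" if "B \<in> fragments G C" for B
    using crosses_over_colour[OF A that] crosses_over_colour[OF that A] by auto
qed

text \<open>The strands of a Reidemeister move avoid the vertices, so each lies in one open edge.  A single edge
  is drawn without self-intersections, which excludes type 1.  The two strands of a type 2 move have
  different heights at both ends, so these ends are two crossings of the same two chords, but
  chords cross at most once.\<close>

lemma drawing_reduced: "reduced_diagram G drawing"
  unfolding reduced_diagram_def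
proof (intro conjI drawing_is_diagram notI)
  have edge: "\<exists>e\<in>edges G. path_image c \<subseteq> open_edge e"
    if "arc c" "path_image c \<subseteq> realization G - vertex_points G" for c
    using connected_off_vertices[OF G, of "path_image c"] that connected_arc_image path_image_nonempty by metis
  have ends: "pathstart c \<in> path_image c" "pathfinish c \<in> path_image c" for c :: "real \<Rightarrow> 'a \<Rightarrow> real"
    by auto
  {
    assume "R1_reducible G drawing"
    then obtain c where c: "arc c" "path_image c \<subseteq> realization G - vertex_points G"
      "pathfinish (planar \<circ> c) = pathstart (planar \<circ> c)"
      unfolding R1_reducible_def fst_drawing by blast
    obtain e where e: "e \<in> edges G" "path_image c \<subseteq> open_edge e" using edge[OF c(1,2)] by blast
    have "planar (pathfinish c) = planar (pathstart c)" using c(3) by (simp add: pathstart_compose pathfinish_compose)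
    then have "pathfinish c = pathstart c"
      using inj_on_planar_open_edge[OF e(1)] ends[of c] e(2) unfolding inj_on_def by blast
    then show False using c(1) arc_distinct_ends by metis
  }
  {
    assume "R2_reducible G drawing"
    then obtain c d where cd: "arc c" "path_image c \<subseteq> realization G - vertex_points G"
      "arc d" "path_image d \<subseteq> realization G - vertex_points G"
      "pathstart (planar \<circ> c) = pathstart (planar \<circ> d)" "pathfinish (planar \<circ> c) = pathfinish (planar \<circ> d)"
      "snd (drawing (pathstart c)) > snd (drawing (pathstart d))"
      "snd (drawing (pathfinish c)) > snd (drawing (pathfinish d))"
      unfolding R2_reducible_def fst_drawing by blast
    obtain e where e: "path_image c \<subseteq> open_edge e" using edge[OF cd(1,2)] by blast
    obtain e' where e': "path_image d \<subseteq> open_edge e'" using edge[OF cd(3,4)] by blast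
    have ne: "pathstart c \<noteq> pathstart d" "pathfinish c \<noteq> pathfinish d" using cd(7,8) by auto
    have R: "pathstart c \<in> realization G" "pathfinish c \<in> realization G" "pathstart d \<in> realization G" "pathfinish d \<in> realization G"
      using ends[of c] ends[of d] cd(2,4) by blast+
    have "double_pair G drawing (pathstart c) (pathstart d)" "double_pair G drawing (pathfinish c) (pathfinish d)"
      using ne R cd(5,6) by (auto simp: double_pair_def pathstart_compose pathfinish_compose)
    moreover have "pathstart c \<in> open_edge e" "pathfinish c \<in> open_edge e" "pathstart d \<in> open_edge e'" "pathfinish d \<in> open_edge e'"
      using ends[of c] ends[of d] e e' by blast+
    then have "weight_support (pathstart c) = weight_support (pathfinish c)"
      "weight_support (pathstart d) = weight_support (pathfinish d)"
      by (simp_all add: open_edge_def)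
    ultimately have "pathstart c = pathfinish c" using double_pair_unique(1) by blast
    then show False using cd(1) arc_distinct_ends by metis
  }
qed

lemma drawing_enclosed: "spine_encloses_fragments G C drawing"
  unfolding spine_encloses_fragments_def fst_drawing
proof (intro conjI ballI inj_on_planar_spine)
  fix A assume A: "A \<in> fragments G C"
  have "inside (sphere (0::complex) 1) = ball 0 1"
    using inside_frontier_eq_interior[of "cball (0::complex) 1"] by simp
  then show "planar ` (A - realization C) \<subseteq> inside (planar ` realization C)"
    unfolding planar_spine_image using planar_off_spine fragment_subset_realization[OF G A] by auto
qed

text \<open>Inverse stereographic projection carries the unit circle at height 0 to the equator itself, so the
  spine is unknotted by the trivial isotopy and the embedding represents its own isotopy class.\<close>

theorem leveled_embedding_exists:
  obtains f n where "graph_embedding G f" "leveled_with G f C n" "n \<le> M"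
proof -
  let ?f = "inverse_stereographic \<circ> drawing"
  have st: "stereographic \<circ> ?f = drawing" by (auto simp: inverse_stereographic)
  obtain n L where n: "n \<le> M" "level_partition G C drawing n L"
    using level_partition_exists[of M G C fragment_colour drawing]
      colour_range(2) fragment_colour_range crosses_over_colour by metis
  have emb: "graph_embedding G ?f"
    unfolding graph_embedding_def
  proof
    show "?f ` realization G \<subseteq> S3" unfolding image_subset_iff comp_apply using inverse_stereographic(1) by blast
    have "continuous_on (realization G) ?f"
      by (intro continuous_on_compose continuous_on_drawing continuous_on_inverse_stereographic)
    moreover have "inj_on ?f (realization G)"
      by (intro comp_inj_on inj_on_drawing inj_on_inverseI[of _ stereographic]) (simp add: inverse_stereographic)
    ultimately show "\<exists>k. homeomorphism (realization G) (?f ` realization G) ?f k"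
      using homeomorphism_compact[OF compact_realization[OF G]] by blast
  qed
  have "?f ` realization C = equator"
  proof (intro equalityI subsetI)
    fix y assume "y \<in> ?f ` realization C"
    then obtain x where x: "x \<in> realization C" "y = ?f x" by blast
    then show "y \<in> equator"
      using drawing_spine[OF x(1)] planar_on_spine[OF x(1)] by (auto simp: inverse_stereographic_equator equator_def)
  next
    fix y assume "y \<in> equator"
    then obtain z where z: "y = ((z, 0), 0)" "cmod z = 1" by (auto simp: equator_def)
    then have "z \<in> planar ` realization C" unfolding planar_spine_image by simp
    then obtain x where x: "x \<in> realization C" "z = planar x" by blast
    then have "?f x = y" using drawing_spine[OF x(1)] z by (simp add: inverse_stereographic_equator)
    then show "y \<in> ?f ` realization C" using x by blast
  qed
  then have "unknotted (?f ` realization C)"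
    unfolding unknotted_def using ambient_isotopy_id by (intro exI[of _ "\<lambda>t x. x"]) simp
  moreover have "is_cycle G C"
    unfolding is_cycle_def using vs C by blast
  moreover have "isotopic_embeddings G ?f ?f"
    unfolding isotopic_embeddings_def using ambient_isotopy_id by blast
  moreover have "(0, 1) \<notin> ?f ` realization G"
    using inverse_stereographic(2) by (metis comp_apply imageE)
  ultimately have "leveled_with G ?f C n"
    unfolding leveled_with_def
    using drawing_semi_leveled drawing_reduced drawing_enclosed n(2) st by metis
  then show ?thesis using that emb n(1) by blast
qed

end

section \<open>General position\<close>

text \<open>Twice the signed area of the triangle \<open>a b c\<close>.\<close>

definition orient :: "complex \<Rightarrow> complex \<Rightarrow> complex \<Rightarrow> real" where
  "orient a b c = Im (cnj (b - a) * (c - a))"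

lemma orient_segment:
  "orient a b ((1 - t) *\<^sub>R c + t *\<^sub>R d) = (1 - t) * orient a b c + t * orient a b d"
  by (simp add: orient_def algebra_simps)

lemma orient_endpoints [simp]: "orient a b a = 0" "orient a b b = 0"
  by (simp_all add: orient_def algebra_simps)

lemma orient_open_segment: "z \<in> open_segment a b \<Longrightarrow> orient a b z = 0"
  by (auto simp: in_segment orient_segment)

lemma orient_ext:
  assumes "z \<in> open_segment a b"
  shows "orient z b a = 0"
proof -
  obtain u where "z = (1 - u) *\<^sub>R a + u *\<^sub>R b" using assms by (auto simp: in_segment)
  then have d: "b - z = (1 - u) *\<^sub>R (b - a)" "a - z = (- u) *\<^sub>R (b - a)" by (simp_all add: algebra_simps)
  show ?thesis unfolding orient_def d by (simp add: algebra_simps)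
qed

lemma real_multiple_if_orient_0:
  fixes w w' :: complex
  assumes "Im (cnj w * w') = 0" "w \<noteq> 0"
  obtains r where "w' = r *\<^sub>R w"
proof -
  have n: "(Re w)\<^sup>2 + (Im w)\<^sup>2 \<noteq> 0" using assms(2) by (auto simp: complex_eq_iff)
  have "w' * (cnj w * w) = (cnj w * w') * w" by (simp add: algebra_simps)
  moreover have "cnj w * w = of_real ((Re w)\<^sup>2 + (Im w)\<^sup>2)" by (simp add: complex_eq_iff power2_eq_square)
  moreover have "cnj w * w' = of_real (Re (cnj w * w'))" using assms(1) by (simp add: complex_eq_iff)
  ultimately have "w' * of_real ((Re w)\<^sup>2 + (Im w)\<^sup>2) = of_real (Re (cnj w * w')) * w" by metis
  then have "w' = (Re (cnj w * w') / ((Re w)\<^sup>2 + (Im w)\<^sup>2)) *\<^sub>R w"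
    using n by (simp add: scaleR_conv_of_real field_simps del: of_real_add of_real_power)
  then show ?thesis using that by blast
qed

text \<open>Parallel lines with a common point coincide.\<close>

lemma crossing_segments_parallel:
  assumes z: "z \<in> open_segment a b" "z \<in> open_segment c d"
    and par: "Im (cnj (b - a) * (d - c)) = 0"
  shows "orient a b c = 0" "orient a b d = 0"
proof -
  obtain s where s: "a \<noteq> b" "z = (1 - s) *\<^sub>R a + s *\<^sub>R b" using z(1) by (auto simp: in_segment)
  obtain t where t: "z = (1 - t) *\<^sub>R c + t *\<^sub>R d" using z(2) by (auto simp: in_segment)
  obtain r where r: "d - c = r *\<^sub>R (b - a)" by (rule real_multiple_if_orient_0[OF par]) (use s in auto)
  have "c - a = s *\<^sub>R (b - a) - t *\<^sub>R (d - c)" using s(2) t by (simp add: algebra_simps)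
  then have c: "c - a = (s - t * r) *\<^sub>R (b - a)" unfolding r by (simp add: algebra_simps)
  have "d - a = (c - a) + (d - c)" by simp
  then have d: "d - a = (s - t * r + r) *\<^sub>R (b - a)" unfolding c r by (simp add: algebra_simps)
  show "orient a b c = 0" "orient a b d = 0" unfolding orient_def c d by (simp_all add: algebra_simps)
qed

text \<open>A line parametrized by \<open>t\<close> meets the circle where a quadratic polynomial in \<open>t\<close> with leading
  coefficient \<open>|p - q|\<^sup>2\<close> vanishes.\<close>

lemma finite_circle_line:
  fixes q p :: complex
  assumes "q \<noteq> p"
  shows "finite {z. cmod z = r \<and> orient q p z = 0}"
proof -
  let ?w = "p - q"
  let ?P = "[:(cmod q)\<^sup>2 - r\<^sup>2, 2 * Re (cnj q * ?w), (cmod ?w)\<^sup>2:]"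
  have "{z. cmod z = r \<and> orient q p z = 0} \<subseteq> (\<lambda>t. q + t *\<^sub>R ?w) ` {t. poly ?P t = 0}"
  proof
    fix z assume z: "z \<in> {z. cmod z = r \<and> orient q p z = 0}"
    then have "Im (cnj ?w * (z - q)) = 0" by (simp add: orient_def)
    then obtain t where t: "z - q = t *\<^sub>R ?w" by (rule real_multiple_if_orient_0) (use assms in auto)
    then have zt: "z = q + t *\<^sub>R ?w" by (metis add.commute diff_add_cancel)
    have "(cmod (q + t *\<^sub>R ?w))\<^sup>2 = (cmod q)\<^sup>2 + t * (2 * Re (cnj q * ?w)) + t\<^sup>2 * (cmod ?w)\<^sup>2"
      by (simp only: cmod_power2) (simp add: power2_eq_square algebra_simps)
    then have "poly ?P t = 0" using z zt by (simp add: power2_eq_square algebra_simps)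
    then show "z \<in> (\<lambda>t. q + t *\<^sub>R ?w) ` {t. poly ?P t = 0}" using zt by blast
  qed
  moreover have "finite {t. poly ?P t = 0}" using assms by (intro poly_roots_finite) simp
  ultimately show ?thesis using finite_subset by blast
qed

lemma finite_segment_crossing:
  assumes "orient a b c \<noteq> 0"
  shows "finite (open_segment a b \<inter> open_segment c d)"
proof -
  have "z = z'" if z: "z \<in> open_segment a b" "z \<in> open_segment c d" and z': "z' \<in> open_segment a b" "z' \<in> open_segment c d" for z z'
  proof (rule ccontr)
    assume ne: "z \<noteq> z'"
    obtain s s' where s: "z = (1 - s) *\<^sub>R a + s *\<^sub>R b" "z' = (1 - s') *\<^sub>R a + s' *\<^sub>R b"
      using z(1) z'(1) by (auto simp: in_segment)
    obtain t t' where t: "z = (1 - t) *\<^sub>R c + t *\<^sub>R d" "z' = (1 - t') *\<^sub>R c + t' *\<^sub>R d"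
      using z(2) z'(2) by (auto simp: in_segment)
    have "(s - s') *\<^sub>R (b - a) = z - z'" unfolding s by (simp add: algebra_simps)
    moreover have "(t - t') *\<^sub>R (d - c) = z - z'" unfolding t by (simp add: algebra_simps)
    moreover from this have "t - t' \<noteq> 0" using ne by auto
    ultimately have "Im (cnj (b - a) * (d - c)) = 0" using Im_cnj_mult_parallel by metis
    then show False using crossing_segments_parallel(1)[OF z] assms by blast
  qed
  then have "\<exists>z0. open_segment a b \<inter> open_segment c d \<subseteq> {z0}" by blast
  then show ?thesis using finite_subset by blast
qed

definition general_position :: "nat \<Rightarrow> (nat \<Rightarrow> complex) \<Rightarrow> bool" where
  "general_position N p \<longleftrightarrow> inj_on p {..<N} \<and>
     (\<forall>a<N. \<forall>b<N. \<forall>c<N. distinct [a, b, c] \<longrightarrow> orient (p a) (p b) (p c) \<noteq> 0) \<and>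
     (\<forall>a<N. \<forall>b<N. \<forall>c<N. \<forall>d<N. \<forall>e<N. \<forall>f<N. distinct [a, b, c, d, e, f] \<longrightarrow>
        open_segment (p a) (p b) \<inter> open_segment (p c) (p d) \<inter> open_segment (p e) (p f) = {})"

text \<open>The points are chosen one after the other.  A new point creates a collinear triple only on a line
  through two old points, and a triple crossing only on a line through an old point and an old
  crossing.  These are finitely many lines, which exclude finitely many points of the circle that
  carries the infinite set of candidates.\<close>

lemma general_position_exists:
  fixes S :: "nat \<Rightarrow> complex set"
  assumes "\<And>k. k < N \<Longrightarrow> infinite (S k)" "\<And>k. k < N \<Longrightarrow> S k \<subseteq> sphere 0 (r k)"
  shows "\<exists>p. (\<forall>k<N. p k \<in> S k) \<and> general_position N p"
  using assms
proof (induction N)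
  case 0
  then show ?case by (simp add: general_position_def)
next
  case (Suc N)
  then obtain p where p: "\<And>k. k < N \<Longrightarrow> p k \<in> S k" and gp: "general_position N p" by force
  have inj: "inj_on p {..<N}" and col: "\<And>a b c. a < N \<Longrightarrow> b < N \<Longrightarrow> c < N \<Longrightarrow> distinct [a, b, c] \<Longrightarrow> orient (p a) (p b) (p c) \<noteq> 0"
    and tri: "\<And>a b c d e f. a < N \<Longrightarrow> b < N \<Longrightarrow> c < N \<Longrightarrow> d < N \<Longrightarrow> e < N \<Longrightarrow> f < N \<Longrightarrow> distinct [a, b, c, d, e, f] \<Longrightarrow>
        open_segment (p a) (p b) \<inter> open_segment (p c) (p d) \<inter> open_segment (p e) (p f) = {}"
    using gp unfolding general_position_def by auto
  define line where "line q q' = {z. cmod z = r N \<and> orient q q' z = 0}" for q q'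
  define I where "I = {(a, b, c, d). a < N \<and> b < N \<and> c < N \<and> d < N \<and> distinct [a, b, c, d]}"
  define X where "X = (\<Union>(a, b, c, d)\<in>I. open_segment (p a) (p b) \<inter> open_segment (p c) (p d))"
  have finI: "finite I"
    by (rule finite_subset[of _ "{..<N} \<times> {..<N} \<times> {..<N} \<times> {..<N}"]) (auto simp: I_def)
  have finX: "finite X"
    unfolding X_def using finI col by (intro finite_UN_I) (auto simp: I_def intro!: finite_segment_crossing)
  let ?Q = "X \<union> p ` {..<N}"
  define bad where "bad = p ` {..<N} \<union> (\<Union>b<N. \<Union>q\<in>?Q - {p b}. line q (p b))"
  have "finite bad" unfolding bad_def line_def using finX finite_circle_line by auto
  then have "S N - bad \<noteq> {}" using Suc.prems(1)[of N] finite_subset[of "S N" bad] by auto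
  then obtain w where w: "w \<in> S N" "w \<notin> bad" by blast
  have wr: "cmod w = r N" using w(1) Suc.prems(2)[of N] by auto
  have wl: "orient q (p b) w \<noteq> 0" if "b < N" "q \<in> ?Q" "q \<noteq> p b" for q b
    using w(2) that wr unfolding bad_def line_def by blast
  define p' where "p' = p(N := w)"
  have p': "p' N = w" "\<And>k. k < N \<Longrightarrow> p' k = p k" by (auto simp: p'_def)
  have inj': "inj_on p' {..<Suc N}"
  proof -
    have "inj_on p' {..<N}" using inj p' by (auto simp: inj_on_def)
    moreover have "p' N \<notin> p' ` {..<N}" using w(2) p' by (auto simp: bad_def)
    ultimately show ?thesis by (simp add: lessThan_Suc)
  qed
  have wcol: "orient (p a) (p b) w \<noteq> 0" if "a < N" "b < N" "a \<noteq> b" for a b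
    using wl[of b "p a"] inj_onD[OF inj, of a b] that by auto
  have rot: "orient x y z = orient y z x" for x y z by (simp add: orient_def algebra_simps)
  have col': "orient (p' a) (p' b) (p' c) \<noteq> 0"
    if abc: "a < Suc N" "b < Suc N" "c < Suc N" "distinct [a, b, c]" for a b c
  proof -
    consider "a < N" "b < N" "c < N" | "a = N" "b < N" "c < N" | "b = N" "a < N" "c < N" | "c = N" "a < N" "b < N"
      using abc by (auto simp: less_Suc_eq)
    then show ?thesis
    proof cases
      case 1
      then show ?thesis using col abc p' by simp
    next
      case 2
      then show ?thesis using wcol[of b c] abc p' rot[of w "p b" "p c"] by simp
    next
      case 3
      then show ?thesis using wcol[of c a] abc p' rot[of "p c" "p a" w] by simp
    next
      case 4
      then show ?thesis using wcol[of a b] abc p' by simp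
    qed
  qed
  \<comment> \<open>At most one of six distinct indices is \<open>N\<close>, so one segment is new and the other two cross in an old crossing.\<close>
  have wtri: "open_segment w (p b) \<inter> open_segment (p c) (p d) \<inter> open_segment (p e) (p f) = {}"
    if "b < N" "c < N" "d < N" "e < N" "f < N" "distinct [c, d, e, f]" for b c d e f
  proof (rule ccontr)
    assume "open_segment w (p b) \<inter> open_segment (p c) (p d) \<inter> open_segment (p e) (p f) \<noteq> {}"
    then obtain z where z: "z \<in> open_segment w (p b)" "z \<in> open_segment (p c) (p d)" "z \<in> open_segment (p e) (p f)" by blast
    then have "z \<in> X" unfolding X_def I_def using that by auto
    moreover have "z \<noteq> p b" using z(1) by (auto simp: open_segment_def)
    ultimately show False using wl[OF that(1), of z] orient_ext[OF z(1)] by simp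
  qed
  have tri': "open_segment (p' a) (p' b) \<inter> open_segment (p' c) (p' d) \<inter> open_segment (p' e) (p' f) = {}"
    if abc: "a < Suc N" "b < Suc N" "c < Suc N" "d < Suc N" "e < Suc N" "f < Suc N" "distinct [a, b, c, d, e, f]" for a b c d e f
  proof -
    have lt: "x < N" if "x < Suc N" "x \<noteq> N" for x using that by simp
    consider "a \<noteq> N" "b \<noteq> N" "c \<noteq> N" "d \<noteq> N" "e \<noteq> N" "f \<noteq> N"
      | "a = N" | "b = N" | "c = N" | "d = N" | "e = N" | "f = N" by blast
    then show ?thesis
    proof cases
      case 1
      then have "a < N" "b < N" "c < N" "d < N" "e < N" "f < N" using abc lt by auto
      then show ?thesis using tri[of a b c d e f] abc(7) p' by simp
    next
      case 2
      then have "b < N" "c < N" "d < N" "e < N" "f < N" using abc lt by auto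
      then show ?thesis using wtri[of b c d e f] abc(7) p' 2 by simp
    next
      case 3
      then have "a < N" "c < N" "d < N" "e < N" "f < N" using abc lt by auto
      then show ?thesis using wtri[of a c d e f] abc(7) p' 3 by (simp add: open_segment_commute)
    next
      case 4
      then have "a < N" "b < N" "d < N" "e < N" "f < N" using abc lt by auto
      then show ?thesis using wtri[of d a b e f] abc(7) p' 4 by (simp add: Int_commute)
    next
      case 5
      then have "a < N" "b < N" "c < N" "e < N" "f < N" using abc lt by auto
      then show ?thesis using wtri[of c a b e f] abc(7) p' 5 by (simp add: Int_commute open_segment_commute)
    next
      case 6
      then have "a < N" "b < N" "c < N" "d < N" "f < N" using abc lt by auto
      then show ?thesis using wtri[of f a b c d] abc(7) p' 6 by (simp add: Int_assoc Int_commute Int_left_commute)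
    next
      case 7
      then have "a < N" "b < N" "c < N" "d < N" "e < N" using abc lt by auto
      then show ?thesis using wtri[of e a b c d] abc(7) p' 7 open_segment_commute[of w "p e"]
        by (simp add: Int_assoc Int_commute Int_left_commute)
    qed
  qed
  have "general_position (Suc N) p'"
    unfolding general_position_def by (intro conjI allI impI inj' col' tri')
  moreover have "\<forall>k<Suc N. p' k \<in> S k" using p p' w by (auto simp: less_Suc_eq)
  ultimately show ?case by blast
qed

text \<open>Twice the area of an inscribed triangle is \<open>4 sin x sin y sin (x + y)\<close>, where \<open>2 x\<close> and \<open>2 y\<close>
  are two of its arcs; as the arcs make up less than a full turn, all three sines are positive.\<close>

lemma orient_cis_pos:
  assumes "\<alpha> < \<beta>" "\<beta> < \<gamma>" "\<gamma> < \<alpha> + 2 * pi"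
  shows "orient (cis \<alpha>) (cis \<beta>) (cis \<gamma>) > 0"
proof -
  define x where "x = (\<beta> - \<alpha>) / 2"
  define y where "y = (\<gamma> - \<beta>) / 2"
  have \<beta>: "\<beta> = \<alpha> + 2 * x" and \<gamma>: "\<gamma> = \<alpha> + 2 * x + 2 * y" by (simp_all add: x_def y_def field_simps)
  have "orient (cis \<alpha>) (cis \<beta>) (cis \<gamma>) = sin (\<gamma> - \<beta>) + sin (\<beta> - \<alpha>) - sin (\<gamma> - \<alpha>)"
    by (simp add: orient_def sin_diff algebra_simps)
  also have "\<dots> = sin (2 * y) + sin (2 * x) - sin (2 * (x + y))" by (simp add: \<beta> \<gamma> algebra_simps)
  also have "\<dots> = 2 * sin y * cos y + 2 * sin x * cos x - 2 * (sin x * cos y + cos x * sin y) * (cos x * cos y - sin x * sin y)"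
    unfolding sin_double sin_add cos_add by simp
  also have "\<dots> = 4 * sin x * sin y * sin (x + y)"
  proof -
    have c: "cos x * cos x = 1 - sin x * sin x" "cos y * cos y = 1 - sin y * sin y"
      using sin_squared_eq[of x] sin_squared_eq[of y] by (simp_all add: power2_eq_square)
    have "2 * (sin x * cos y + cos x * sin y) * (cos x * cos y - sin x * sin y) =
      2 * (sin x * cos x * (cos y * cos y) - sin x * sin x * (sin y * cos y) + sin y * cos y * (cos x * cos x) - sin x * cos x * (sin y * sin y))"
      by (simp add: algebra_simps)
    also have "\<dots> = 2 * sin y * cos y + 2 * sin x * cos x - 4 * sin x * sin y * (sin x * cos y + cos x * sin y)"
      unfolding c by (simp add: algebra_simps)
    finally show ?thesis unfolding sin_add by simp
  qed
  also have "\<dots> > 0"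
  proof -
    have "0 < sin x" "0 < sin y" "0 < sin (x + y)"
      using assms by (auto simp: x_def y_def field_simps intro!: sin_gt_zero)
    then show ?thesis by simp
  qed
  finally show ?thesis .
qed

text \<open>Both ends of one chord lie strictly on the same side of the other.\<close>

lemma parallel_chords_disjoint:
  assumes "\<alpha> < \<beta>" "\<beta> < \<gamma>" "\<gamma> < \<delta>" "\<delta> < \<alpha> + 2 * pi"
  shows "open_segment (cis \<alpha>) (cis \<beta>) \<inter> open_segment (cis \<gamma>) (cis \<delta>) = {}"
    and "open_segment (cis \<alpha>) (cis \<delta>) \<inter> open_segment (cis \<beta>) (cis \<gamma>) = {}"
proof -
  have pos: "orient a b z > 0" if cd: "orient a b c > 0" "orient a b d > 0" "z \<in> open_segment c d" for a b c d z
  proof -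
    obtain u where "0 < u" "u < 1" "z = (1 - u) *\<^sub>R c + u *\<^sub>R d" using cd(3) by (auto simp: in_segment)
    then show ?thesis using cd by (simp add: orient_segment add_pos_pos)
  qed
  have disj: "open_segment a b \<inter> open_segment c d = {}" if cd: "orient a b c > 0" "orient a b d > 0" for a b c d
  proof (rule ccontr)
    assume "open_segment a b \<inter> open_segment c d \<noteq> {}"
    then obtain z where "z \<in> open_segment a b" "z \<in> open_segment c d" by blast
    then show False using pos[OF cd] orient_open_segment by fastforce
  qed
  show "open_segment (cis \<alpha>) (cis \<beta>) \<inter> open_segment (cis \<gamma>) (cis \<delta>) = {}"
    using assms by (intro disj orient_cis_pos) auto
  have rot: "orient a b c = orient c a b" for a b c by (simp add: orient_def algebra_simps)
  have "orient (cis \<delta>) (cis \<alpha>) (cis \<beta>) > 0" "orient (cis \<delta>) (cis \<alpha>) (cis \<gamma>) > 0"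
    using orient_cis_pos[of \<alpha> \<beta> \<delta>] rot[of "cis \<alpha>" "cis \<beta>" "cis \<delta>"]
      orient_cis_pos[of \<alpha> \<gamma> \<delta>] rot[of "cis \<alpha>" "cis \<gamma>" "cis \<delta>"] assms by simp_all
  then show "open_segment (cis \<alpha>) (cis \<delta>) \<inter> open_segment (cis \<beta>) (cis \<gamma>) = {}"
    by (subst open_segment_commute) (rule disj)
qed

section \<open>A spine for complete bipartite graphs\<close>

lemma open_segment_pair:
  "{a, b} = {c, d} \<Longrightarrow> open_segment (f a) (f b) = open_segment (f c) (f d)"
  by (auto simp: doubleton_eq_iff open_segment_commute)

definition zigzag :: "nat \<Rightarrow> nat + nat" where
  "zigzag k = (if even k then Inl (k div 2) else Inr (k div 2))"

definition zigzag_cycle :: "nat \<Rightarrow> (nat + nat) list" where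
  "zigzag_cycle n = map zigzag [0..<2 * n]"

lemma inj_zigzag: "inj zigzag"
  by (rule injI) (auto simp: zigzag_def split: if_splits elim!: evenE oddE)

lemma length_zigzag_cycle [simp]: "length (zigzag_cycle n) = 2 * n"
  by (simp add: zigzag_cycle_def)

lemma nth_zigzag_cycle [simp]: "k < 2 * n \<Longrightarrow> zigzag_cycle n ! k = zigzag k"
  by (simp add: zigzag_cycle_def)

lemma distinct_zigzag_cycle: "distinct (zigzag_cycle n)"
  by (simp add: zigzag_cycle_def distinct_map inj_on_subset[OF inj_zigzag])

lemma zigzag_double: "zigzag (2 * i) = Inl i" "zigzag (2 * j + 1) = Inr j"
  by (auto simp: zigzag_def)

lemma set_zigzag_cycle: "set (zigzag_cycle n) = Inl ` {..<n} \<union> Inr ` {..<n}"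
proof (intro equalityI subsetI)
  fix v assume "v \<in> set (zigzag_cycle n)"
  then obtain k where "k < 2 * n" "v = zigzag k" by (auto simp: zigzag_cycle_def)
  then show "v \<in> Inl ` {..<n} \<union> Inr ` {..<n}" by (auto simp: zigzag_def)
next
  fix v :: "nat + nat" assume "v \<in> Inl ` {..<n} \<union> Inr ` {..<n}"
  then consider i where "i < n" "v = Inl i" | j where "j < n" "v = Inr j" by blast
  then obtain k where "k < 2 * n" "v = zigzag k"
  proof cases
    case (1 i)
    then show ?thesis using that[of "2 * i"] zigzag_double by simp
  next
    case (2 j)
    then show ?thesis using that[of "2 * j + 1"] zigzag_double by simp
  qed
  then show "v \<in> set (zigzag_cycle n)" by (auto simp: zigzag_cycle_def)
qed

lemma zigzag_edge:
  assumes "n \<le> m" "k < 2 * n" "l < 2 * n" "odd (k + l)"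
  shows "{zigzag k, zigzag l} \<in> edges (complete_bipartite m n)"
  using assms by (cases "even k") (auto simp: zigzag_def complete_bipartite_simps)

lemma zigzag_cycle_edges:
  assumes "n \<le> m"
  shows "edges (cycle_graph (zigzag_cycle n)) \<subseteq> edges (complete_bipartite m n)"
proof
  fix e assume "e \<in> edges (cycle_graph (zigzag_cycle n))"
  then obtain k where k: "k < 2 * n" "e = {zigzag_cycle n ! k, zigzag_cycle n ! (Suc k mod (2 * n))}"
    by (auto simp: cycle_graph_def)
  have l: "Suc k mod (2 * n) < 2 * n" using k(1) by simp
  have "odd (k + Suc k mod (2 * n))"
  proof (cases "Suc k = 2 * n")
    case True
    then have "odd k" by presburger
    then show ?thesis using True by simp
  next
    case False
    then have "Suc k mod (2 * n) = Suc k" using k(1) by simp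
    then show ?thesis by simp
  qed
  then show "e \<in> edges (complete_bipartite m n)"
    using zigzag_edge[OF assms k(1) l] k l by simp
qed

lemma zigzag_chords_sides:
  assumes "{a, b} \<in> edges (complete_bipartite m n) - E"
  obtains i j where "i < m" "j < n" "{a, b} = {Inl i, Inr j}" "{Inl i, Inr j} \<notin> E"
  using assms complete_bipartite_edgeE[of "{a, b}" m n] by (metis DiffE)

section \<open>One level for two right-hand vertices\<close>

text \<open>The off-spine vertices are placed on the real axis, so that the legs to \<open>\<i>\<close> stay above it and
  those to \<open>- \<i>\<close> below, and legs with the same end on the circle meet only there.\<close>

definition star_position :: "nat + nat \<Rightarrow> complex" where
  "star_position v = (case v of Inl i \<Rightarrow> if i = 0 then 1 else if i = 1 then -1 else of_real (1 / real i)
     | Inr j \<Rightarrow> if j = 0 then \<i> else - \<i>)"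

lemma complete_bipartite_two_leveled:
  assumes "2 \<le> m"
  obtains f n where "graph_embedding (complete_bipartite m 2) f"
    "leveled_with (complete_bipartite m 2) f (cycle_graph (zigzag_cycle 2)) n" "n \<le> 1"
proof -
  let ?K = "complete_bipartite m 2" and ?vs = "zigzag_cycle 2"
  have z: "k < 4 \<Longrightarrow> ?vs ! k = zigzag k" for k by simp
  have cases4: "k < 4 \<Longrightarrow> k = 0 \<or> k = 1 \<or> k = 2 \<or> k = 3" for k :: nat by auto
  have cyc: "{Inl i, Inr j} \<in> edges (cycle_graph ?vs)" if "i < 2" "j < 2" for i j
  proof -
    have "{?vs ! k, ?vs ! (Suc k mod 4)} \<in> edges (cycle_graph ?vs)" if "k < 4" for k
      using that by (auto simp: cycle_graph_def simp del: nth_zigzag_cycle)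
    from this[of 0] this[of 1] this[of 2] this[of 3]
    have "{Inl 0, Inr 0} \<in> edges (cycle_graph ?vs)" "{Inr 0, Inl 1} \<in> edges (cycle_graph ?vs)"
      "{Inl 1, Inr 1} \<in> edges (cycle_graph ?vs)" "{Inr 1, Inl 0} \<in> edges (cycle_graph ?vs)"
      by (simp_all add: zigzag_def)
    moreover have "i = 0 \<or> i = 1" "j = 0 \<or> j = 1" using that by auto
    ultimately show ?thesis by (auto simp: insert_commute)
  qed
  have chord: "\<exists>i j. 2 \<le> i \<and> i < m \<and> j < 2 \<and> {a, b} = {Inl i, Inr j} \<and>
      open_segment (star_position a) (star_position b) = open_segment (star_position (Inl i)) (star_position (Inr j))"
    if ab: "{a, b} \<in> edges ?K - edges (cycle_graph ?vs)" for a b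
  proof -
    obtain i j where ij: "i < m" "j < 2" "{a, b} = {Inl i, Inr j}" "{Inl i, Inr j} \<notin> edges (cycle_graph ?vs)"
      by (rule zigzag_chords_sides[OF ab])
    then have "2 \<le> i" using cyc[of i j] by linarith
    then show ?thesis using ij open_segment_pair[OF ij(3)] by blast
  qed
  have coords: "\<exists>u. 0 < u \<and> u < 1 \<and> Re z = (1 - u) / real i \<and> Im z = (if j = 0 then u else - u)"
    if z: "z \<in> open_segment (star_position (Inl i)) (star_position (Inr j))" "2 \<le> i" for z i j
  proof -
    obtain u where "0 < u" "u < 1" "z = (1 - u) *\<^sub>R star_position (Inl i) + u *\<^sub>R star_position (Inr j)"
      using z(1) by (auto simp: in_segment)
    then show ?thesis using z(2) by (intro exI[of _ u]) (auto simp: star_position_def)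
  qed
  have no_crossing: False
    if e: "{a, b} \<in> edges ?K - edges (cycle_graph ?vs)" "{c, d} \<in> edges ?K - edges (cycle_graph ?vs)" "{a, b} \<noteq> {c, d}"
      and zz: "z \<in> open_segment (star_position a) (star_position b)" "z \<in> open_segment (star_position c) (star_position d)"
    for a b c d z
  proof -
    obtain i j where ij: "2 \<le> i" "j < 2" "{a, b} = {Inl i, Inr j}"
      "open_segment (star_position a) (star_position b) = open_segment (star_position (Inl i)) (star_position (Inr j))"
      using chord[OF e(1)] by blast
    obtain i' j' where ij': "2 \<le> i'" "j' < 2" "{c, d} = {Inl i', Inr j'}"
      "open_segment (star_position c) (star_position d) = open_segment (star_position (Inl i')) (star_position (Inr j'))"
      using chord[OF e(2)] by blast
    obtain u where u: "0 < u" "u < 1" "Re z = (1 - u) / real i" "Im z = (if j = 0 then u else - u)"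
      using coords[of z i j] zz(1) ij by metis
    obtain u' where u': "0 < u'" "u' < 1" "Re z = (1 - u') / real i'" "Im z = (if j' = 0 then u' else - u')"
      using coords[of z i' j'] zz(2) ij' by metis
    have "u = u' \<and> (j = 0 \<longleftrightarrow> j' = 0)" using u u' by (auto split: if_splits)
    then have "j = j'" "(1 - u) / real i = (1 - u) / real i'" using u u' ij(2) ij'(2) by auto
    then have "i = i'" using u ij(1) ij'(1) by (simp add: field_simps)
    then show False using \<open>j = j'\<close> e(3) ij(3) ij'(3) by simp
  qed
  have off: "\<exists>i. 2 \<le> i \<and> i < m \<and> v = Inl i" if "v \<in> verts ?K - set ?vs" for v
    using that by (auto simp: complete_bipartite_simps set_zigzag_cycle)
  interpret chord_drawing ?K ?vs star_position "\<lambda>k. real k * (pi / 2)" "\<lambda>_. 1" 1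
  proof
    show "simple_graph ?K" by (rule simple_complete_bipartite)
    show "distinct ?vs" by (rule distinct_zigzag_cycle)
    show "set ?vs \<subseteq> verts ?K" using assms by (auto simp: set_zigzag_cycle complete_bipartite_simps)
    show "edges (cycle_graph ?vs) \<subseteq> edges ?K" using zigzag_cycle_edges assms .
    show "e \<inter> set ?vs \<noteq> {}" if "e \<in> edges ?K" for e
      using complete_bipartite_edgeE[OF that] by (metis Int_iff UnI2 empty_iff image_eqI insertI1 insert_commute lessThan_iff set_zigzag_cycle)
    show "star_position (?vs ! k) = cis (real k * (pi / 2))" if "k < length ?vs" for k
    proof -
      have "k < 4" using that by simp
      then have "k = 0 \<or> k = 1 \<or> k = 2 \<or> k = 3" by (rule cases4)
      moreover have "cis (3 * (pi / 2)) = - \<i>"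
        using sin_3over2_pi cos_3over2_pi by (simp add: complex_eq_iff)
      ultimately show ?thesis using that by (auto simp: star_position_def zigzag_def)
    qed
    show "cmod (star_position v) < 1" if "v \<in> verts ?K - set ?vs" for v
      using off[OF that] by (auto simp: star_position_def norm_divide)
    show "inj_on star_position (verts ?K - set ?vs)"
    proof (rule inj_onI)
      fix v w assume vw: "v \<in> verts ?K - set ?vs" "w \<in> verts ?K - set ?vs" "star_position v = star_position w"
      obtain i i' where "2 \<le> i" "v = Inl i" "2 \<le> i'" "w = Inl i'" using off vw(1,2) by metis
      then show "v = w" using vw(3) by (auto simp: star_position_def complex_eq_iff)
    qed
    show "star_position v \<notin> open_segment (star_position a) (star_position b)"
      if v: "v \<in> verts ?K - set ?vs" and ab: "{a, b} \<in> edges ?K - edges (cycle_graph ?vs)" for v a b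
    proof
      assume s: "star_position v \<in> open_segment (star_position a) (star_position b)"
      obtain k where k: "2 \<le> k" "v = Inl k" using off[OF v] by blast
      obtain i j where ij: "2 \<le> i" "j < 2" "star_position v \<in> open_segment (star_position (Inl i)) (star_position (Inr j))"
        using chord[OF ab] s by blast
      have "Im (star_position v) = 0" using k by (simp add: star_position_def)
      then show False using coords[OF ij(3,1)] by (auto split: if_splits)
    qed
    let ?E = "edges ?K - edges (cycle_graph ?vs)" and ?S = "\<lambda>a b. open_segment (star_position a) (star_position b)"
    show "Im (cnj (star_position b - star_position a) * (star_position d - star_position c)) \<noteq> 0"
      if "{a, b} \<in> ?E" "{c, d} \<in> ?E" "{a, b} \<noteq> {c, d}" "z \<in> ?S a b" "z \<in> ?S c d" for a b c d z
      using no_crossing[OF that] by (rule FalseE)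
    show "z \<notin> ?S g h"
      if "{a, b} \<in> ?E" "{c, d} \<in> ?E" "{g, h} \<in> ?E" "{a, b} \<noteq> {c, d}" "{a, b} \<noteq> {g, h}" "{c, d} \<noteq> {g, h}"
        "z \<in> ?S a b" "z \<in> ?S c d" for a b c d g h z
      using no_crossing[OF that(1,2,4,7,8)] by (rule FalseE)
    show "z \<notin> ?S c d"
      if "{a, b} \<in> ?E" "{c, d} \<in> ?E" "{a, b} \<noteq> {c, d}" "z \<in> ?S a b" for a b c d z
      using no_crossing[OF that] by (rule notI)
  qed (simp_all add: algebra_simps)
  show ?thesis using leveled_embedding_exists that by blast
qed

section \<open>General complete bipartite graphs\<close>

text \<open>The chord between the spine vertices with indices \<open>2 i\<close> and \<open>2 j + 1\<close> gets one of the colours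
  \<open>1, \<dots>, n\<close> according to the sum of these indices modulo \<open>2 n\<close>, hence to \<open>i + j\<close> modulo \<open>n\<close>.  The
  colours above \<open>n\<close> are left to the stars.\<close>

definition chord_colour :: "nat \<Rightarrow> (nat + nat) set \<Rightarrow> nat" where
  "chord_colour n e = (let i = THE i. Inl i \<in> e in
     if i < n then 1 + (i + (THE j. Inr j \<in> e)) mod n else 1 + i)"

lemma chord_colour:
  "chord_colour n {Inl i, Inr j} = (if i < n then 1 + (i + j) mod n else 1 + i)"
  "n \<le> i \<Longrightarrow> chord_colour n {Inl i} = 1 + i"
  by (simp_all add: chord_colour_def)

text \<open>In a regular polygon, chords with equal index sums are parallel.  For interleaved chords the
  difference of the sums is positive and less than \<open>N\<close>.\<close>

lemma same_sum_not_interleaved: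
  fixes x y x' y' N :: nat
  assumes "x < y" "y < N" "x' < y'" "y' < N" "distinct [x, y, x', y']" "(x + y) mod N = (x' + y') mod N"
  shows "\<not> (x < x' \<and> x' < y \<and> y < y')"
proof
  assume o: "x < x' \<and> x' < y \<and> y < y'"
  then have lt: "x + y < x' + y'" by linarith
  then have "N dvd (x' + y') - (x + y)" using assms(6) by (metis mod_eq_dvd_iff_nat less_imp_le)
  moreover have "0 < (x' + y') - (x + y)" "(x' + y') - (x + y) < N" using o lt assms by linarith+
  ultimately show False by (meson dvd_imp_le not_less)
qed

lemma infinite_arc:
  assumes "a < b" "b \<le> a + 2 * pi" "c \<noteq> 0"
  shows "infinite ((\<lambda>t. c *\<^sub>R cis t) ` {a<..<b})"
proof
  assume fin: "finite ((\<lambda>t. c *\<^sub>R cis t) ` {a<..<b})"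
  have "inj_on (\<lambda>t. c *\<^sub>R cis t) {a<..<b}"
  proof (rule inj_onI)
    fix s t assume "s \<in> {a<..<b}" "t \<in> {a<..<b}" "c *\<^sub>R cis s = c *\<^sub>R cis t"
    then show "s = t" using cis_eq_in_period[of s t a] assms by auto
  qed
  then have "finite {a<..<b}" using fin finite_imageD by blast
  then show False using assms(1) infinite_Ioo by blast
qed

text \<open>The first \<open>2 n\<close> points range over disjoint consecutive arcs of the unit circle, which fixes their
  cyclic order whatever the choice in \<open>general_position_exists\<close>; the others range over an arc of the
  circle of radius 1/2.\<close>

lemma generic_positions_exist:
  assumes "2 \<le> n"
  obtains p \<theta> where "general_position N p" "\<And>k. k < 2 * n \<Longrightarrow> \<theta> k < \<theta> (Suc k)"
    "\<theta> (2 * n) = \<theta> 0 + 2 * pi" "0 \<le> \<theta> 0" "\<theta> 0 < 2 * pi"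
    "\<And>k. k < 2 * n \<Longrightarrow> k < N \<Longrightarrow> p k = cis (\<theta> k)" "\<And>k. 2 * n \<le> k \<Longrightarrow> k < N \<Longrightarrow> cmod (p k) < 1"
proof -
  define I where "I k = {pi * k / n <..< pi * Suc k / n}" for k :: nat
  define S where "S k = (if k < 2 * n then (\<lambda>t. 1 *\<^sub>R cis t) ` I k else (\<lambda>t. (1 / 2) *\<^sub>R cis t) ` {0<..<1::real})" for k
  define r where "r k = (if k < 2 * n then 1 else 1 / 2 :: real)" for k
  have n: "0 < real n" using assms by simp
  have step: "pi * real (Suc k) / n = pi * k / n + pi / n" for k using n by (simp add: field_simps)
  have pin: "0 < pi / n" "pi / n \<le> 2 * pi" using n assms by (auto simp: field_simps)
  have inf: "infinite (S k)" for k
  proof (cases "k < 2 * n")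
    case True
    have "infinite ((\<lambda>t. 1 *\<^sub>R cis t) ` {pi * k / n <..< pi * Suc k / n})"
      by (rule infinite_arc) (unfold step, use pin in auto)
    then show ?thesis using True by (simp add: S_def I_def)
  next
    case False
    have "infinite ((\<lambda>t. (1 / 2) *\<^sub>R cis t) ` {0<..<1::real})"
      by (rule infinite_arc) (use pi_gt3 in auto)
    then show ?thesis using False by (simp add: S_def)
  qed
  have "S k \<subseteq> sphere 0 (r k)" for k by (auto simp: S_def r_def)
  then obtain p where p: "\<And>k. k < N \<Longrightarrow> p k \<in> S k" "general_position N p"
    using general_position_exists[of N S r] inf by blast
  have "\<exists>t. t \<in> I k \<and> (k < N \<longrightarrow> p k = cis t)" if k: "k < 2 * n" for k
  proof (cases "k < N")
    case True
    then show ?thesis using p(1)[of k] k by (auto simp: S_def)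
  next
    case False
    have "pi * k / n < pi * Suc k / n" unfolding step using pin by simp
    then have "I k \<noteq> {}" unfolding I_def by simp
    then show ?thesis using False by blast
  qed
  then obtain \<tau> where \<tau>: "\<And>k. k < 2 * n \<Longrightarrow> \<tau> k \<in> I k" "\<And>k. k < 2 * n \<Longrightarrow> k < N \<Longrightarrow> p k = cis (\<tau> k)" by metis
  define \<theta> where "\<theta> k = (if k < 2 * n then \<tau> k else \<tau> 0 + 2 * pi)" for k
  have n0: "0 < 2 * n" using assms by simp
  have t0: "0 < \<tau> 0" "\<tau> 0 < pi / n" using \<tau>(1)[OF n0] by (auto simp: I_def)
  show ?thesis
  proof (rule that[OF p(2), of \<theta>])
    fix k assume k: "k < 2 * n"
    show "\<theta> k < \<theta> (Suc k)"
    proof (cases "Suc k < 2 * n")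
      case True
      then show ?thesis using \<tau>(1)[OF k] \<tau>(1)[OF True] k by (simp add: \<theta>_def I_def)
    next
      case False
      then have "real (Suc k) = 2 * n" using k by simp
      then have "pi * real (Suc k) / n = 2 * pi" using n by (simp add: field_simps)
      then have "\<tau> k < 2 * pi" using \<tau>(1)[OF k] by (simp add: I_def)
      then show ?thesis using False k t0 by (simp add: \<theta>_def)
    qed
  next
    show "\<theta> (2 * n) = \<theta> 0 + 2 * pi" "0 \<le> \<theta> 0" using n0 t0 by (simp_all add: \<theta>_def)
    show "\<theta> 0 < 2 * pi" using n0 t0 pin by (simp add: \<theta>_def)
    show "\<And>k. k < 2 * n \<Longrightarrow> k < N \<Longrightarrow> p k = cis (\<theta> k)" using \<tau>(2) by (simp add: \<theta>_def)
    show "cmod (p k) < 1" if "2 * n \<le> k" "k < N" for k using p(1)[OF that(2)] that(1) by (auto simp: S_def)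
  qed
qed

text \<open>The position along \<open>zigzag_cycle n\<close> for the spine vertices; the remaining left-hand vertices
  follow.\<close>

definition vertex_index :: "nat \<Rightarrow> nat + nat \<Rightarrow> nat" where
  "vertex_index n v = (case v of Inl i \<Rightarrow> if i < n then 2 * i else n + i | Inr j \<Rightarrow> 2 * j + 1)"

lemma complete_bipartite_leveled:
  assumes nm: "n \<le> m" and n3: "3 \<le> n"
  obtains f N where "graph_embedding (complete_bipartite m n) f"
    "leveled_with (complete_bipartite m n) f (cycle_graph (zigzag_cycle n)) N" "N \<le> m"
proof -
  let ?K = "complete_bipartite m n" and ?vs = "zigzag_cycle n"
  let ?E = "edges ?K - edges (cycle_graph ?vs)"
  obtain p \<theta> where gp: "general_position (m + n) p" and \<theta>: "\<And>k. k < 2 * n \<Longrightarrow> \<theta> k < \<theta> (Suc k)"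
    "\<theta> (2 * n) = \<theta> 0 + 2 * pi" "0 \<le> \<theta> 0" "\<theta> 0 < 2 * pi"
    and circ: "\<And>k. k < 2 * n \<Longrightarrow> k < m + n \<Longrightarrow> p k = cis (\<theta> k)"
    and disc: "\<And>k. 2 * n \<le> k \<Longrightarrow> k < m + n \<Longrightarrow> cmod (p k) < 1"
    using generic_positions_exist[of n "m + n"] n3 by auto
  define pos where "pos v = p (vertex_index n v)" for v
  have idx: "vertex_index n v < m + n" if "v \<in> verts ?K" for v
    using that nm by (auto simp: complete_bipartite_simps vertex_index_def)
  have inj: "inj_on (vertex_index n) (verts ?K)"
  proof (rule inj_onI)
    fix v w assume vw: "v \<in> verts ?K" "w \<in> verts ?K" "vertex_index n v = vertex_index n w"
    have par: "2 * i = Suc (2 * j) \<longleftrightarrow> False" "Suc (2 * j) = 2 * i \<longleftrightarrow> False" for i j :: nat by presburger+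
    show "v = w" using vw par by (auto simp: complete_bipartite_simps vertex_index_def split: if_splits)
  qed
  have noncol: "orient (pos u) (pos v) (pos w) \<noteq> 0"
    if "u \<in> verts ?K" "v \<in> verts ?K" "w \<in> verts ?K" "distinct [u, v, w]" for u v w
    using that gp idx inj_onD[OF inj] unfolding general_position_def pos_def by (metis distinct_length_2_or_more distinct_singleton)
  have ends: "a \<in> verts ?K" "b \<in> verts ?K" "a \<noteq> b" if "{a, b} \<in> ?E" for a b
    using simple_graph_edgeE[OF simple_complete_bipartite, of "{a, b}" m n] that by (metis DiffD1 doubleton_eq_iff)+
  have trans: "Im (cnj (pos b - pos a) * (pos d - pos c)) \<noteq> 0"
    if e: "{a, b} \<in> ?E" "{c, d} \<in> ?E" "{a, b} \<noteq> {c, d}"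
      and z: "z \<in> open_segment (pos a) (pos b)" "z \<in> open_segment (pos c) (pos d)" for a b c d z
  proof
    assume par: "Im (cnj (pos b - pos a) * (pos d - pos c)) = 0"
    have o: "orient (pos a) (pos b) (pos c) = 0" "orient (pos a) (pos b) (pos d) = 0"
      using crossing_segments_parallel[OF z par] by auto
    have "c \<notin> {a, b} \<or> d \<notin> {a, b}" using e(3) ends[OF e(2)] by auto
    then show False using noncol[of a b c] noncol[of a b d] o ends[OF e(1)] ends[OF e(2)] by auto
  qed
  have share: "{a, b} \<inter> {c, d} = {}"
    if e: "{a, b} \<in> ?E" "{c, d} \<in> ?E" "{a, b} \<noteq> {c, d}"
      and z: "z \<in> open_segment (pos a) (pos b)" "z \<in> open_segment (pos c) (pos d)" for a b c d z
  proof (rule ccontr)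
    assume "{a, b} \<inter> {c, d} \<noteq> {}"
    then obtain u where "u \<in> {a, b}" "u \<in> {c, d}" by blast
    then obtain v w where vw: "{a, b} = {u, v}" "{c, d} = {u, w}" by blast
    have z': "z \<in> open_segment (pos u) (pos v)" "z \<in> open_segment (pos u) (pos w)"
      using z open_segment_pair[OF vw(1), of pos] open_segment_pair[OF vw(2), of pos] by auto
    have e': "{u, v} \<in> ?E" "{u, w} \<in> ?E" "v \<noteq> w" using e vw by auto
    obtain s where s: "0 < s" "z = (1 - s) *\<^sub>R pos u + s *\<^sub>R pos v" using z'(1) by (auto simp: in_segment)
    obtain t where t: "0 < t" "z = (1 - t) *\<^sub>R pos u + t *\<^sub>R pos w" using z'(2) by (auto simp: in_segment)
    have "s *\<^sub>R (pos v - pos u) = t *\<^sub>R (pos w - pos u)" using s(2) t(2) by (simp add: algebra_simps)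
    then have "orient (pos u) (pos v) (pos w) = 0"
      unfolding orient_def by (rule Im_cnj_mult_parallel) (use t in simp)
    then show False using noncol[of u v w] ends[OF e'(1)] ends[OF e'(2)] e'(3) by auto
  qed
  have index_spine: "vertex_index n (zigzag k) = k" if "k < 2 * n" for k
    using that by (auto simp: vertex_index_def zigzag_def)
  have same: "z \<notin> open_segment (pos c) (pos d)"
    if e: "{a, b} \<in> ?E" "{c, d} \<in> ?E" "{a, b} \<noteq> {c, d}" "chord_colour n {a, b} = chord_colour n {c, d}"
      and z: "z \<in> open_segment (pos a) (pos b)" for a b c d z
  proof
    assume z2: "z \<in> open_segment (pos c) (pos d)"
    obtain i j where ij: "i < m" "j < n" "{a, b} = {Inl i, Inr j}"
      by (rule zigzag_chords_sides[OF e(1)])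
    obtain i' j' where ij': "i' < m" "j' < n" "{c, d} = {Inl i', Inr j'}"
      by (rule zigzag_chords_sides[OF e(2)])
    have "{a, b} \<inter> {c, d} = {}" by (rule share[OF e(1-3) z z2])
    then have ne: "i \<noteq> i'" "j \<noteq> j'" using ij(3) ij'(3) by auto
    have col: "(if i < n then 1 + (i + j) mod n else 1 + i) = (if i' < n then 1 + (i' + j') mod n else 1 + i')"
      using e(4) ij(3) ij'(3) chord_colour(1) by metis
    have lt: "(x + y) mod n < n" for x y using n3 by simp
    have lti: "i < n" "i' < n" "(i + j) mod n = (i' + j') mod n"
      using col ne lt[of i j] lt[of i' j'] by (auto split: if_splits)
    have zs: "z \<in> open_segment (p (2 * i)) (p (2 * j + 1))" "z \<in> open_segment (p (2 * i')) (p (2 * j' + 1))"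
      using z[unfolded open_segment_pair[OF ij(3), of pos]] z2[unfolded open_segment_pair[OF ij'(3), of pos]] lti
      by (simp_all add: pos_def vertex_index_def)
    have sum: "(2 * i + (2 * j + 1)) mod (2 * n) = (2 * i' + (2 * j' + 1)) mod (2 * n)"
    proof -
      have "(2 * (i + j)) mod (2 * n) = (2 * (i' + j')) mod (2 * n)"
        using lti(3) by (simp only: mult_mod_right[symmetric])
      then have "(2 * (i + j) + 1) mod (2 * n) = (2 * (i' + j') + 1) mod (2 * n)" by (metis mod_add_left_eq)
      then show ?thesis by (simp add: algebra_simps)
    qed
    have lt2: "2 * i < 2 * n" "2 * j + 1 < 2 * n" "2 * i' < 2 * n" "2 * j' + 1 < 2 * n" using lti ij ij' by auto
    \<comment> \<open>The chord that starts first either ends before the other starts or encloses it; both cases are excluded by \<open>parallel_chords_disjoint\<close>.\<close>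
    have key: False if o: "x < y" "x' < y'" "y < 2 * n" "y' < 2 * n" "distinct [x, y, x', y']"
        "(x + y) mod (2 * n) = (x' + y') mod (2 * n)" "x < x'"
        and zz: "z \<in> open_segment (p x) (p y)" "z \<in> open_segment (p x') (p y')" for x y x' y'
    proof -
      have p: "p k = cis (\<theta> k)" if "k < 2 * n" for k using circ that nm by simp
      have mono: "\<theta> k < \<theta> l" if "k < l" "l \<le> 2 * n" for k l
        using that
      proof (induction l)
        case (Suc l)
        then show ?case using \<theta>(1)[of l] by (cases "k = l") auto
      qed simp
      have per: "\<theta> k < \<theta> x + 2 * pi" if "k < 2 * n" for k
        using mono[of k "2 * n"] \<theta>(2) mono[of 0 x] that o(1,3) by (cases "x = 0") auto
      have "\<not> (x < x' \<and> x' < y \<and> y < y')" by (rule same_sum_not_interleaved[OF o(1,3,2,4,5,6)])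
      then consider "y < x'" | "y' < y" "x' < y" using o by fastforce
      then show False
      proof cases
        case 1
        then show ?thesis
          using parallel_chords_disjoint(1)[of "\<theta> x" "\<theta> y" "\<theta> x'" "\<theta> y'"] mono[of x y] mono[of y x'] mono[of x' y']
            per[of y'] zz p o by auto
      next
        case 2
        then show ?thesis
          using parallel_chords_disjoint(2)[of "\<theta> x" "\<theta> x'" "\<theta> y'" "\<theta> y"] mono[of x x'] mono[of x' y'] mono[of y' y]
            per[of y] zz p o by auto
      qed
    qed
    define x where "x = min (2 * i) (2 * j + 1)"
    define y where "y = max (2 * i) (2 * j + 1)"
    define x' where "x' = min (2 * i') (2 * j' + 1)"
    define y' where "y' = max (2 * i') (2 * j' + 1)"
    have odd: "2 * k \<noteq> 2 * l + 1" for k l :: nat by presburger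
    have xy: "x < y" "x' < y'" "y < 2 * n" "y' < 2 * n" "distinct [x, y, x', y']"
      unfolding x_def y_def x'_def y'_def using lt2 odd[of i j] odd[of i' j'] odd[of i j'] odd[of i' j] ne
      by (auto simp: min_def max_def)
    have mm: "min k l + max k l = k + l" for k l :: nat by (simp add: min_def max_def)
    have sums: "(x + y) mod (2 * n) = (x' + y') mod (2 * n)"
      using sum unfolding x_def y_def x'_def y'_def by (simp only: mm)
    have zx: "z \<in> open_segment (p x) (p y)" "z \<in> open_segment (p x') (p y')"
      using zs unfolding x_def y_def x'_def y'_def by (auto simp: min_def max_def open_segment_commute)
    have "x < x' \<or> x' < x" using xy(5) by auto
    then show False
      using key[OF xy(1-5) sums _ zx] key[OF xy(2,1,4,3) _ sums[symmetric] _ zx(2,1)] xy(5) by auto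
  qed
  have triple: "z \<notin> open_segment (pos g) (pos h)"
    if e: "{a, b} \<in> ?E" "{c, d} \<in> ?E" "{g, h} \<in> ?E" "{a, b} \<noteq> {c, d}" "{a, b} \<noteq> {g, h}" "{c, d} \<noteq> {g, h}"
      and z: "z \<in> open_segment (pos a) (pos b)" "z \<in> open_segment (pos c) (pos d)" for a b c d g h z
  proof
    assume z3: "z \<in> open_segment (pos g) (pos h)"
    have "{a, b} \<inter> {c, d} = {}" "{a, b} \<inter> {g, h} = {}" "{c, d} \<inter> {g, h} = {}"
      using share[OF e(1,2,4) z] share[OF e(1,3,5) z(1) z3] share[OF e(2,3,6) z(2) z3] by auto
    then have d: "distinct [a, b, c, d, g, h]" using ends e by auto
    have v: "set [a, b, c, d, g, h] \<subseteq> verts ?K" using ends e by auto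
    have "distinct (map (vertex_index n) [a, b, c, d, g, h])"
      using d inj_on_subset[OF inj v] by (simp only: distinct_map)
    then have "open_segment (pos a) (pos b) \<inter> open_segment (pos c) (pos d) \<inter> open_segment (pos g) (pos h) = {}"
      using gp idx v unfolding general_position_def pos_def by simp
    then show False using z z3 by blast
  qed
  have off: "\<exists>i. n \<le> i \<and> i < m \<and> v = Inl i" if "v \<in> verts ?K - set ?vs" for v
    using that by (auto simp: complete_bipartite_simps set_zigzag_cycle)
  interpret chord_drawing ?K ?vs pos \<theta> "chord_colour n" m
  proof
    show "simple_graph ?K" by (rule simple_complete_bipartite)
    show "distinct ?vs" by (rule distinct_zigzag_cycle)
    show "3 \<le> length ?vs" using n3 by simp
    show "set ?vs \<subseteq> verts ?K" using nm by (auto simp: set_zigzag_cycle complete_bipartite_simps)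
    show "edges (cycle_graph ?vs) \<subseteq> edges ?K" using zigzag_cycle_edges nm .
    show "e \<inter> set ?vs \<noteq> {}" if e: "e \<in> edges ?K" for e
    proof -
      obtain i j where "i < m" "j < n" "e = {Inl i, Inr j}" using e by (rule complete_bipartite_edgeE)
      then show ?thesis by (auto simp: set_zigzag_cycle)
    qed
    show "pos (?vs ! k) = cis (\<theta> k)" if "k < length ?vs" for k
      using that index_spine[of k] circ[of k] nm by (simp add: pos_def)
    show "cmod (pos v) < 1" if "v \<in> verts ?K - set ?vs" for v
      using off[OF that] disc by (auto simp: pos_def vertex_index_def)
    show "inj_on pos (verts ?K - set ?vs)"
    proof -
      have "inj_on p {..<m + n}" using gp by (simp add: general_position_def)
      then have "inj_on p (vertex_index n ` verts ?K)" by (rule inj_on_subset) (use idx in auto)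
      then have "inj_on (p \<circ> vertex_index n) (verts ?K)" by (rule comp_inj_on[OF inj])
      then show ?thesis unfolding comp_def pos_def[symmetric] by (rule inj_on_subset) auto
    qed
    show "pos v \<notin> open_segment (pos a) (pos b)" if v: "v \<in> verts ?K - set ?vs" and ab: "{a, b} \<in> ?E" for v a b
    proof
      assume s: "pos v \<in> open_segment (pos a) (pos b)"
      then have "v \<noteq> a" "v \<noteq> b" by (auto simp: open_segment_def)
      then show False using noncol[of a b v] orient_open_segment[OF s] ends[OF ab] v by auto
    qed
    show "chord_colour n {u, b} = chord_colour n {u}" if ub: "u \<notin> set ?vs" "{u, b} \<in> edges ?K" for u b
    proof -
      have "u \<in> verts ?K - set ?vs"
        using ub simple_graph_edgeE[OF simple_complete_bipartite ub(2)] by (metis DiffI doubleton_eq_iff)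
      then obtain i where i: "n \<le> i" "u = Inl i" using off by blast
      obtain i' j where "i' < m" "j < n" "{u, b} = {Inl i', Inr j}" using ub(2) by (rule complete_bipartite_edgeE)
      then have "{u, b} = {Inl i, Inr j}" using i by (auto simp: doubleton_eq_iff)
      then show ?thesis using i by (simp add: chord_colour)
    qed
    show "1 \<le> chord_colour n e \<and> chord_colour n e \<le> m" if "e \<in> ?E" for e
    proof -
      have "e \<in> edges ?K" using that by simp
      then obtain i j where ij: "i < m" "j < n" "e = {Inl i, Inr j}" by (rule complete_bipartite_edgeE)
      moreover have "(i + j) mod n < n" using n3 by simp
      then have "Suc ((i + j) mod n) \<le> m" using nm by linarith
      ultimately show ?thesis using nm by (simp add: chord_colour)
    qed
    show "1 \<le> chord_colour n {u} \<and> chord_colour n {u} \<le> m" if "u \<in> verts ?K - set ?vs" for u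
      using off[OF that] by (auto simp: chord_colour)
    show "1 \<le> m" using nm n3 by simp
    show "\<And>k. k < length ?vs \<Longrightarrow> \<theta> k < \<theta> (Suc k)" "\<theta> (length ?vs) = \<theta> 0 + 2 * pi"
      "0 \<le> \<theta> 0" "\<theta> 0 < 2 * pi" using \<theta> by simp_all
  qed (fact trans triple same)+
  show ?thesis using leveled_embedding_exists that by blast
qed

section \<open>Level numbers\<close>

lemma zigzag_hamiltonian: "2 \<le> n \<Longrightarrow> is_hamiltonian_cycle (complete_bipartite n n) (cycle_graph (zigzag_cycle n))"
proof -
  assume n: "2 \<le> n"
  have "verts (cycle_graph (zigzag_cycle n)) = verts (complete_bipartite n n)"
    by (simp add: cycle_graph_def complete_bipartite_simps set_zigzag_cycle)
  moreover have "edges (cycle_graph (zigzag_cycle n)) \<subseteq> edges (complete_bipartite n n)"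
    by (rule zigzag_cycle_edges) simp
  moreover have "3 \<le> length (zigzag_cycle n)" using n by simp
  ultimately show ?thesis
    unfolding is_hamiltonian_cycle_def is_cycle_def using distinct_zigzag_cycle by blast
qed

lemma level_number_le:
  assumes "graph_embedding G f" "leveled_with G f C n"
  shows "level_number G \<le> enat n"
proof -
  have "level_number G \<le> spatial_level_number G f"
    unfolding level_number_def by (rule INF_lower) (use assms in simp)
  also have "\<dots> \<le> enat n" unfolding spatial_level_number_def by (rule Inf_lower) (use assms in blast)
  finally show ?thesis .
qed

lemma hamiltonian_level_number_le:
  assumes "graph_embedding G f" "is_hamiltonian_cycle G C" "leveled_with G f C n"
  shows "hamiltonian_level_number G \<le> enat n"
proof -
  have "hamiltonian_level_number G \<le> spatial_hamiltonian_level_number G f"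
    unfolding hamiltonian_level_number_def by (rule INF_lower) (use assms in simp)
  also have "\<dots> \<le> enat n" unfolding spatial_hamiltonian_level_number_def by (rule Inf_lower) (use assms in blast)
  finally show ?thesis .
qed

lemma level_number_ge:
  assumes "\<And>f C n. graph_embedding G f \<Longrightarrow> leveled_with G f C n \<Longrightarrow> N \<le> n"
  shows "enat N \<le> level_number G" "enat N \<le> hamiltonian_level_number G"
  unfolding level_number_def hamiltonian_level_number_def spatial_level_number_def spatial_hamiltonian_level_number_def
  using assms by (auto intro!: INF_greatest Inf_greatest)

lemma level_number_complete_bipartite:
  assumes "n \<le> m" "3 \<le> n"
  shows "level_number (complete_bipartite m n) = enat m"
    and "m = n \<Longrightarrow> hamiltonian_level_number (complete_bipartite m n) = enat m"
proof -
  obtain f N where f: "graph_embedding (complete_bipartite m n) f"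
    "leveled_with (complete_bipartite m n) f (cycle_graph (zigzag_cycle n)) N" "N \<le> m"
    using complete_bipartite_leveled[OF assms] by blast
  note ge = level_number_ge[of "complete_bipartite m n" m, OF bipartite_levels_ge[OF _ _ assms]]
  have Nm: "enat N \<le> enat m" using f(3) by simp
  show "level_number (complete_bipartite m n) = enat m"
    by (rule antisym[OF order_trans[OF level_number_le[OF f(1,2)] Nm] ge(1)])
  assume mn: "m = n"
  have "is_hamiltonian_cycle (complete_bipartite m n) (cycle_graph (zigzag_cycle n))"
    unfolding mn by (rule zigzag_hamiltonian) (use assms in simp)
  from hamiltonian_level_number_le[OF f(1) this f(2)]
  show "hamiltonian_level_number (complete_bipartite m n) = enat m"
    by (rule antisym[OF order_trans[OF _ Nm] ge(2)])
qed

lemma level_number_complete_bipartite_two: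
  assumes "2 \<le> m"
  shows "level_number (complete_bipartite m 2) = 1"
proof -
  obtain f N where f: "graph_embedding (complete_bipartite m 2) f"
    "leveled_with (complete_bipartite m 2) f (cycle_graph (zigzag_cycle 2)) N" "N \<le> 1"
    using complete_bipartite_two_leveled[OF assms] by blast
  have N1: "enat N \<le> enat 1" using f(3) by simp
  have "1 \<le> n" if l: "leveled_with (complete_bipartite m 2) f C n" for f C n
  proof -
    obtain g L where "level_partition (complete_bipartite m 2) C (stereographic \<circ> g) n L"
      using l unfolding leveled_with_def by (elim conjE exE) (rule that)
    then show ?thesis unfolding level_partition_def by (elim conjE)
  qed
  then have "enat 1 \<le> level_number (complete_bipartite m 2)" by (intro level_number_ge(1))
  then have "level_number (complete_bipartite m 2) = enat 1"
    by (rule antisym[OF order_trans[OF level_number_le[OF f(1,2)] N1]])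
  then show ?thesis by (simp add: one_enat_def)
qed

theorem theorem3:
  shows "(\<forall>n::nat. 3 \<le> n \<longrightarrow>
            level_number (complete_bipartite n n) = enat n \<and>
            hamiltonian_level_number (complete_bipartite n n) = enat n) \<and>
         (\<forall>m n::nat. m > n \<and> n > 2 \<longrightarrow>
            level_number (complete_bipartite m n) = enat m) \<and>
         (\<forall>m::nat. 2 \<le> m \<longrightarrow> level_number (complete_bipartite m 2) = 1)"
proof (intro conjI allI impI)
  fix n :: nat assume "3 \<le> n"
  then show "level_number (complete_bipartite n n) = enat n"
    "hamiltonian_level_number (complete_bipartite n n) = enat n"
    using level_number_complete_bipartite[of n n] by simp_all
next
  fix m n :: nat assume "m > n \<and> n > 2"
  then show "level_number (complete_bipartite m n) = enat m"
    by (intro level_number_complete_bipartite(1)) auto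
next
  fix m :: nat assume "2 \<le> m"
  then show "level_number (complete_bipartite m 2) = 1"
    by (rule level_number_complete_bipartite_two)
qed

end
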